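(* Let $(\mathcal{B},\mathbb{E},\mathfrak{s})$ be an extriangulated category and let $((\mathcal{S},\mathcal{T}),(\mathcal{U},\mathcal{V}))$ be a twin cotorsion pair on $\mathcal{B}$ with heart $\underline{\mathcal{H}}$. Then $\underline{\mathcal{H}}$ has a largest exact category structure, in the sense that every kernel-cokernel pair in $\underline{\mathcal{H}}$ is a short exact sequence of this exact structure. Moreover, $\underline{\mathcal{H}}$ is quasi-abelian.
   Context: Extriangulated categories (Nakaoka–Palu). Let $\mathcal{B}$ be an additive category with an additive bifunctor $\mathbb{E}:\mathcal{B}^{\mathrm{op}}\times\mathcal{B}\to\mathbf{Ab}$. For $\delta\in\mathbb{E}(C,A)$, $a:A\to A'$, $c:C'\to C$ write $a_*\delta=\mathbb{E}(C,a)(\delta)$, $c^*\delta=\mathbb{E}(c,A)(\delta)$. A morphism from $\delta\in\mathbb{E}(C,A)$ to $\delta'\in\mathbb{E}(C',A')$ is a pair $(a:A\to A',c:C\to C')$ with $a_*\delta=c^*\delta'$. Sequences $A\xrightarrow{x}B\xrightarrow{y}C$ and $A\xrightarrow{x'}B'\xrightarrow{y'}C$ are equivalent if there is an isomorphism $b:B\to B'$ with $bx=x'$, $y'b=y$. $\mathfrak{s}$ assigns to each $\delta\in\mathbb{E}(C,A)$ an equivalence class $\mathfrak{s}(\delta)=[A\xrightarrow{x}B\xrightarrow{y}C]$ such that every morphism $(a,c):\delta\to\delta'$ admits $b:B\to B'$ with $bx=x'a$, $y'b=cy$; moreover $\mathfrak{s}(0)=[A\to A\oplus C\to C]$ and $\mathfrak{s}(\delta\oplus\delta')=\mathfrak{s}(\delta)\oplus\mathfrak{s}(\delta')$.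 $(\mathcal{B},\mathbb{E},\mathfrak{s})$ is extriangulated if also: (ET3) given $\delta,\delta'$ realized by $A\xrightarrow{x}B\xrightarrow{y}C$, $A'\xrightarrow{x'}B'\xrightarrow{y'}C'$ and $a,b$ with $bx=x'a$, there is $c$ with $cy=y'b$ and $a_*\delta=c^*\delta'$; (ET4) if $\delta\in\mathbb{E}(D,A)$, $\delta'\in\mathbb{E}(F,B)$ are realized by $A\xrightarrow{f}B\xrightarrow{f'}D$, $B\xrightarrow{g}C\xrightarrow{g'}F$, there are an object $E$, morphisms $d:D\to E$, $e:E\to F$, $h':C\to E$ and $\delta''\in\mathbb{E}(E,A)$ realized by $A\xrightarrow{gf}C\xrightarrow{h'}E$ with $h'g=df'$, $eh'=g'$, $D\xrightarrow{d}E\xrightarrow{e}F$ realizing $f'_*\delta'$, $d^*\delta''=\delta$, $f_*\delta''=e^*\delta'$; and the duals (ET3)$^{\mathrm{op}}$, (ET4)$^{\mathrm{op}}$. If $\mathfrak{s}(\delta)=[A\xrightarrow{x}B\xrightarrow{y}C]$, then $A\xrightarrow{x}B\xrightarrow{y}C\overset{\delta}{\dashrightarrow}$ is called an $\mathbb{E}$-triangle. Twin cotorsion pairs and hearts. Subcategories are full and closed under isomorphisms. A cotorsion pair $(\mathcal{U},\mathcal{V})$ on $\mathcal{B}$ consists of two subcategories closed under direct summands with $\mathbb{E}(\mathcal{U},\mathcal{V})=0$ such that every $B\in\mathcal{B}$ has $\mathbb{E}$-triangles $V_B\to U_B\to B\dashrightarrow$ and $B\to V^B\to U^B\dashrightarrow$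 with $U_B,U^B\in\mathcal{U}$, $V_B,V^B\in\mathcal{V}$. A twin cotorsion pair is a pair of cotorsion pairs $((\mathcal{S},\mathcal{T}),(\mathcal{U},\mathcal{V}))$ with $\mathcal{S}\subseteq\mathcal{U}$. Put $\mathcal{W}=\mathcal{T}\cap\mathcal{U}$. For a subcategory $\mathcal{D}\supseteq\mathcal{W}$, the ideal quotient $\mathcal{D}/\mathcal{W}$ has the objects of $\mathcal{D}$ and morphisms those of $\mathcal{D}$ modulo morphisms factoring through objects of $\mathcal{W}$. Let $\mathcal{B}^+$ be the class of $X\in\mathcal{B}$ having an $\mathbb{E}$-triangle $V\to W\to X\dashrightarrow$ with $V\in\mathcal{V}$, $W\in\mathcal{W}$; $\mathcal{B}^-$ the class of $Y\in\mathcal{B}$ having an $\mathbb{E}$-triangle $Y\to W'\to S\dashrightarrow$ with $S\in\mathcal{S}$, $W'\in\mathcal{W}$; $\mathcal{H}=\mathcal{B}^+\cap\mathcal{B}^-$. The heart of the twin cotorsion pair is $\underline{\mathcal{H}}=\mathcal{H}/\mathcal{W}$. Exact and quasi-abelian categories. A kernel-cokernel pair is a sequence $A\xrightarrow{x}B\xrightarrow{y}C$ with $x$ a kernel of $y$ and $y$ a cokernel of $x$. An exact category structure (Quillen) on an additive category is a class of kernel-cokernel pairs, called short exact sequences, closed under isomorphisms and satisfying the usual axioms. An additive category is preabelian if every morphism has a kernel and a cokernel. A preabelian category is left quasi-abelian if in every pull-back square with $\mathbf{a}:A\to B$, $\mathbf{b}:A\to C$, $\mathbf{c}:B\to D$,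 $\mathbf{d}:C\to D$, $\mathbf{c}\mathbf{a}=\mathbf{d}\mathbf{b}$, the morphism $\mathbf{a}$ is a cokernel whenever $\mathbf{d}$ is a cokernel; right quasi-abelian is the dual condition (push-outs of kernels are kernels); quasi-abelian means both. *)

theory Defs
  imports "HOL-Algebra.Coset"
begin

section \<open>Additive categories\<close>

text \<open>
  The morphism groups \<open>Hom K A B\<close> are abelian groups in the sense of HOL-Algebra
  (\<open>comm_group\<close>), hence written multiplicatively by the library: \<open>mult\<close> is the addition of
  parallel morphisms and \<open>one\<close> is the zero morphism. Composition is written in the usual order,
  that is \<open>g \<cdot> f\<close> is \<open>f\<close> followed by \<open>g\<close>.
\<close>

record ('o, 'm) cat =
  Obj :: "'o set"
  Hom :: "'o \<Rightarrow> 'o \<Rightarrow> 'm monoid"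
  Comp :: "'m \<Rightarrow> 'm \<Rightarrow> 'm"  (infixr "\<cdot>\<index>" 75)
  Ident :: "'o \<Rightarrow> 'm"

abbreviation mor :: "('o, 'm, 'z) cat_scheme \<Rightarrow> 'o \<Rightarrow> 'o \<Rightarrow> 'm set" where
  "mor K A B \<equiv> carrier (Hom K A B)"

abbreviation zero_mor :: "('o, 'm, 'z) cat_scheme \<Rightarrow> 'o \<Rightarrow> 'o \<Rightarrow> 'm" where
  "zero_mor K A B \<equiv> \<one>\<^bsub>Hom K A B\<^esub>"

abbreviation add_mor :: "('o, 'm, 'z) cat_scheme \<Rightarrow> 'o \<Rightarrow> 'o \<Rightarrow> 'm \<Rightarrow> 'm \<Rightarrow> 'm" where
  "add_mor K A B f g \<equiv> f \<otimes>\<^bsub>Hom K A B\<^esub> g"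

text \<open>Distinct morphism sets are disjoint, so that a morphism determines its source and target.\<close>

locale category =
  fixes K :: "('o, 'm, 'z) cat_scheme" (structure)
  assumes mor_disjoint:
      "\<lbrakk> A \<in> Obj K; B \<in> Obj K; A' \<in> Obj K; B' \<in> Obj K; f \<in> mor K A B; f \<in> mor K A' B' \<rbrakk>
        \<Longrightarrow> A = A' \<and> B = B'"
    and Comp_mor:
      "\<lbrakk> A \<in> Obj K; B \<in> Obj K; C \<in> Obj K; f \<in> mor K A B; g \<in> mor K B C \<rbrakk>
        \<Longrightarrow> g \<cdot> f \<in> mor K A C"
    and Ident_mor: "A \<in> Obj K \<Longrightarrow> Ident K A \<in> mor K A A"
    and Comp_assoc:
      "\<lbrakk> A \<in> Obj K; B \<in> Obj K; C \<in> Obj K; D \<in> Obj K;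
         f \<in> mor K A B; g \<in> mor K B C; h \<in> mor K C D \<rbrakk>
        \<Longrightarrow> (h \<cdot> g) \<cdot> f = h \<cdot> (g \<cdot> f)"
    and Ident_left:
      "\<lbrakk> A \<in> Obj K; B \<in> Obj K; f \<in> mor K A B \<rbrakk> \<Longrightarrow> Ident K B \<cdot> f = f"
    and Ident_right:
      "\<lbrakk> A \<in> Obj K; B \<in> Obj K; f \<in> mor K A B \<rbrakk> \<Longrightarrow> f \<cdot> Ident K A = f"

locale preadditive_category = category K for K :: "('o, 'm, 'z) cat_scheme" (structure) +
  assumes Hom_comm_group: "\<lbrakk> A \<in> Obj K; B \<in> Obj K \<rbrakk> \<Longrightarrow> comm_group (Hom K A B)"
    and Comp_hom_right:
      "\<lbrakk> A \<in> Obj K; B \<in> Obj K; C \<in> Obj K; g \<in> mor K B C \<rbrakk>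
        \<Longrightarrow> (\<lambda>f. g \<cdot> f) \<in> hom (Hom K A B) (Hom K A C)"
    and Comp_hom_left:
      "\<lbrakk> A \<in> Obj K; B \<in> Obj K; C \<in> Obj K; f \<in> mor K A B \<rbrakk>
        \<Longrightarrow> (\<lambda>g. g \<cdot> f) \<in> hom (Hom K B C) (Hom K A C)"

definition zero_object :: "('o, 'm, 'z) cat_scheme \<Rightarrow> 'o \<Rightarrow> bool" where
  "zero_object K Z \<longleftrightarrow> Z \<in> Obj K \<and>
     (\<forall>A \<in> Obj K. mor K Z A = {zero_mor K Z A} \<and> mor K A Z = {zero_mor K A Z})"

text \<open>\<open>P\<close> is a direct sum of \<open>A\<close> and \<open>A'\<close> with injections \<open>i, i'\<close> and projections \<open>p, p'\<close>.\<close>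

definition biproduct ::
  "('o, 'm, 'z) cat_scheme \<Rightarrow> 'o \<Rightarrow> 'o \<Rightarrow> 'o \<Rightarrow> 'm \<Rightarrow> 'm \<Rightarrow> 'm \<Rightarrow> 'm \<Rightarrow> bool" where
  "biproduct K A A' P i i' p p' \<longleftrightarrow>
     A \<in> Obj K \<and> A' \<in> Obj K \<and> P \<in> Obj K \<and>
     i \<in> mor K A P \<and> i' \<in> mor K A' P \<and> p \<in> mor K P A \<and> p' \<in> mor K P A' \<and>
     p \<cdot> i = Ident K A \<and> p' \<cdot> i' = Ident K A' \<and>
     p \<cdot> i' = zero_mor K A' A \<and> p' \<cdot> i = zero_mor K A A' \<and>
     add_mor K P P (i \<cdot> p) (i' \<cdot> p') = Ident K P"
  for K (structure)

locale additive_category = preadditive_category K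
  for K :: "('o, 'm, 'z) cat_scheme" (structure) +
  assumes zero_object_exists: "\<exists>Z. zero_object K Z"
    and biproduct_exists:
      "\<lbrakk> A \<in> Obj K; A' \<in> Obj K \<rbrakk> \<Longrightarrow> \<exists>P i i' p p'. biproduct K A A' P i i' p p'"

definition iso_mor :: "('o, 'm, 'z) cat_scheme \<Rightarrow> 'o \<Rightarrow> 'o \<Rightarrow> 'm \<Rightarrow> bool" where
  "iso_mor K A B f \<longleftrightarrow> f \<in> mor K A B \<and>
     (\<exists>g \<in> mor K B A. g \<cdot> f = Ident K A \<and> f \<cdot> g = Ident K B)"
  for K (structure)


section \<open>Extriangulated categories\<close>

text \<open>
  \<open>Ext K C A\<close> is the abelian group \<open>\<E>(C, A)\<close> (written multiplicatively, like the morphism groups)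
  and \<open>ExtMap K c a\<close> is \<open>\<E>(c, a)\<close>. A sequence from \<open>A\<close> via \<open>B\<close> to \<open>C\<close> with morphisms \<open>x\<close>, \<open>y\<close> is
  the triple \<open>(B, x, y)\<close>; \<open>Real K C A \<delta>\<close> is the class of sequences realizing \<open>\<delta> \<in> \<E>(C, A)\<close>. Since
  the groups \<open>\<E>(C, A)\<close> are not required to be disjoint, \<open>Real\<close> takes \<open>C\<close> and \<open>A\<close> as arguments.
\<close>

record ('o, 'm, 'e) ext_cat = "('o, 'm) cat" +
  Ext :: "'o \<Rightarrow> 'o \<Rightarrow> 'e monoid"
  ExtMap :: "'m \<Rightarrow> 'm \<Rightarrow> 'e \<Rightarrow> 'e"
  Real :: "'o \<Rightarrow> 'o \<Rightarrow> 'e \<Rightarrow> ('o \<times> 'm \<times> 'm) set"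

text \<open>For \<open>\<delta> \<in> \<E>(C, A)\<close>, \<open>push K C a \<delta>\<close> is \<open>a\<^sub>*\<delta>\<close> and \<open>pull K A c \<delta>\<close> is \<open>c\<^sup>*\<delta>\<close>.\<close>

definition push :: "('o, 'm, 'e, 'z) ext_cat_scheme \<Rightarrow> 'o \<Rightarrow> 'm \<Rightarrow> 'e \<Rightarrow> 'e" where
  "push K C a = ExtMap K (Ident K C) a"

definition pull :: "('o, 'm, 'e, 'z) ext_cat_scheme \<Rightarrow> 'o \<Rightarrow> 'm \<Rightarrow> 'e \<Rightarrow> 'e" where
  "pull K A c = ExtMap K c (Ident K A)"

locale additive_bifunctor = additive_category K
  for K :: "('o, 'm, 'e, 'z) ext_cat_scheme" (structure) +
  assumes Ext_comm_group: "\<lbrakk> A \<in> Obj K; C \<in> Obj K \<rbrakk> \<Longrightarrow> comm_group (Ext K C A)"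
    and ExtMap_hom:
      "\<lbrakk> A \<in> Obj K; A' \<in> Obj K; C \<in> Obj K; C' \<in> Obj K; c \<in> mor K C' C; a \<in> mor K A A' \<rbrakk>
        \<Longrightarrow> ExtMap K c a \<in> hom (Ext K C A) (Ext K C' A')"
    and ExtMap_Ident:
      "\<lbrakk> A \<in> Obj K; C \<in> Obj K; \<delta> \<in> carrier (Ext K C A) \<rbrakk>
        \<Longrightarrow> ExtMap K (Ident K C) (Ident K A) \<delta> = \<delta>"
    and ExtMap_Comp:
      "\<lbrakk> A \<in> Obj K; A' \<in> Obj K; A'' \<in> Obj K; C \<in> Obj K; C' \<in> Obj K; C'' \<in> Obj K;
         a \<in> mor K A A'; a' \<in> mor K A' A''; c \<in> mor K C' C; c' \<in> mor K C'' C';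
         \<delta> \<in> carrier (Ext K C A) \<rbrakk>
        \<Longrightarrow> ExtMap K (c \<cdot> c') (a' \<cdot> a) \<delta> = ExtMap K c' a' (ExtMap K c a \<delta>)"
    and ExtMap_add_right:
      "\<lbrakk> A \<in> Obj K; A' \<in> Obj K; C \<in> Obj K; C' \<in> Obj K;
         c \<in> mor K C' C; a \<in> mor K A A'; b \<in> mor K A A'; \<delta> \<in> carrier (Ext K C A) \<rbrakk>
        \<Longrightarrow> ExtMap K c (add_mor K A A' a b) \<delta> = ExtMap K c a \<delta> \<otimes>\<^bsub>Ext K C' A'\<^esub> ExtMap K c b \<delta>"
    and ExtMap_add_left:
      "\<lbrakk> A \<in> Obj K; A' \<in> Obj K; C \<in> Obj K; C' \<in> Obj K;
         c \<in> mor K C' C; d \<in> mor K C' C; a \<in> mor K A A'; \<delta> \<in> carrier (Ext K C A) \<rbrakk>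
        \<Longrightarrow> ExtMap K (add_mor K C' C c d) a \<delta> = ExtMap K c a \<delta> \<otimes>\<^bsub>Ext K C' A'\<^esub> ExtMap K d a \<delta>"

definition seqs :: "('o, 'm, 'z) cat_scheme \<Rightarrow> 'o \<Rightarrow> 'o \<Rightarrow> ('o \<times> 'm \<times> 'm) set" where
  "seqs K A C = {(B, x, y). B \<in> Obj K \<and> x \<in> mor K A B \<and> y \<in> mor K B C}"

definition seq_equiv ::
  "('o, 'm, 'z) cat_scheme \<Rightarrow> 'o \<Rightarrow> 'o \<Rightarrow> (('o \<times> 'm \<times> 'm) \<times> ('o \<times> 'm \<times> 'm)) set" where
  "seq_equiv K A C = {((B, x, y), (B', x', y')).
     (B, x, y) \<in> seqs K A C \<and> (B', x', y') \<in> seqs K A C \<and>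
     (\<exists>b. iso_mor K B B' b \<and> b \<cdot> x = x' \<and> y' \<cdot> b = y)}"
  for K (structure)

definition E_triangle ::
  "('o, 'm, 'e, 'z) ext_cat_scheme \<Rightarrow> 'o \<Rightarrow> 'm \<Rightarrow> 'o \<Rightarrow> 'm \<Rightarrow> 'o \<Rightarrow> 'e \<Rightarrow> bool" where
  "E_triangle K A x B y C \<delta> \<longleftrightarrow>
     A \<in> Obj K \<and> B \<in> Obj K \<and> C \<in> Obj K \<and> x \<in> mor K A B \<and> y \<in> mor K B C \<and>
     \<delta> \<in> carrier (Ext K C A) \<and> (B, x, y) \<in> Real K C A \<delta>"

text \<open>\<open>f \<oplus> f'\<close> with respect to a direct sum \<open>P\<close> of the sources, with projections \<open>p, p'\<close>, and a
  direct sum \<open>Q\<close> of the targets, with injections \<open>j, j'\<close>.\<close>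

definition dsum_mor ::
  "('o, 'm, 'z) cat_scheme \<Rightarrow> 'o \<Rightarrow> 'm \<Rightarrow> 'm \<Rightarrow> 'o \<Rightarrow> 'm \<Rightarrow> 'm \<Rightarrow> 'm \<Rightarrow> 'm \<Rightarrow> 'm" where
  "dsum_mor K P p p' Q j j' f f' = add_mor K P Q (j \<cdot> (f \<cdot> p)) (j' \<cdot> (f' \<cdot> p'))"
  for K (structure)

text \<open>The element of \<open>\<E>(C \<oplus> C', A \<oplus> A')\<close> that corresponds to \<open>(\<delta>, 0, 0, \<delta>')\<close> under the canonical
  isomorphism with \<open>\<E>(C, A) \<oplus> \<E>(C, A') \<oplus> \<E>(C', A) \<oplus> \<E>(C', A')\<close>. Here \<open>r, r'\<close> are the projections of
  the direct sum \<open>R\<close> of \<open>C, C'\<close>, and \<open>i, i'\<close> are the injections of the direct sum \<open>P\<close> of \<open>A, A'\<close>.\<close>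

definition dsum_ext ::
  "('o, 'm, 'e, 'z) ext_cat_scheme \<Rightarrow> 'o \<Rightarrow> 'm \<Rightarrow> 'm \<Rightarrow> 'o \<Rightarrow> 'm \<Rightarrow> 'm \<Rightarrow> 'e \<Rightarrow> 'e \<Rightarrow> 'e" where
  "dsum_ext K R r r' P i i' \<delta> \<delta>' = ExtMap K r i \<delta> \<otimes>\<^bsub>Ext K R P\<^esub> ExtMap K r' i' \<delta>'"

locale additive_realization = additive_bifunctor K
  for K :: "('o, 'm, 'e, 'z) ext_cat_scheme" (structure) +
  assumes Real_class:
      "\<lbrakk> A \<in> Obj K; C \<in> Obj K; \<delta> \<in> carrier (Ext K C A) \<rbrakk>
        \<Longrightarrow> Real K C A \<delta> \<in> seqs K A C // seq_equiv K A C"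
    and Real_mor:
      "\<lbrakk> E_triangle K A x B y C \<delta>; E_triangle K A' x' B' y' C' \<delta>';
         a \<in> mor K A A'; c \<in> mor K C C'; push K C a \<delta> = pull K A' c \<delta>' \<rbrakk>
        \<Longrightarrow> \<exists>b \<in> mor K B B'. b \<cdot> x = x' \<cdot> a \<and> y' \<cdot> b = c \<cdot> y"
    and Real_zero:
      "biproduct K A C P i i' p p' \<Longrightarrow> E_triangle K A i P p' C \<one>\<^bsub>Ext K C A\<^esub>"
    and Real_dsum:
      "\<lbrakk> E_triangle K A x B y C \<delta>; E_triangle K A' x' B' y' C' \<delta>';
         biproduct K A A' P i i' p p'; biproduct K B B' Q j j' q q';
         biproduct K C C' R k k' r r' \<rbrakk>
        \<Longrightarrow> E_triangle K P (dsum_mor K P p p' Q j j' x x')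
                         Q (dsum_mor K Q q q' R k k' y y')
                         R (dsum_ext K R r r' P i i' \<delta> \<delta>')"

locale extriangulated_category = additive_realization K
  for K :: "('o, 'm, 'e, 'z) ext_cat_scheme" (structure) +
  assumes ET3:
      "\<lbrakk> E_triangle K A x B y C \<delta>; E_triangle K A' x' B' y' C' \<delta>';
         a \<in> mor K A A'; b \<in> mor K B B'; b \<cdot> x = x' \<cdot> a \<rbrakk>
        \<Longrightarrow> \<exists>c \<in> mor K C C'. c \<cdot> y = y' \<cdot> b \<and> push K C a \<delta> = pull K A' c \<delta>'"
    and ET3_op:
      "\<lbrakk> E_triangle K A x B y C \<delta>; E_triangle K A' x' B' y' C' \<delta>';
         b \<in> mor K B B'; c \<in> mor K C C'; c \<cdot> y = y' \<cdot> b \<rbrakk>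
        \<Longrightarrow> \<exists>a \<in> mor K A A'. b \<cdot> x = x' \<cdot> a \<and> push K C a \<delta> = pull K A' c \<delta>'"
    and ET4:
      "\<lbrakk> E_triangle K A f B f' D \<delta>; E_triangle K B g C g' F \<delta>' \<rbrakk>
        \<Longrightarrow> \<exists>E d e h' \<delta>''.
              E_triangle K A (g \<cdot> f) C h' E \<delta>'' \<and>
              d \<in> mor K D E \<and> e \<in> mor K E F \<and>
              h' \<cdot> g = d \<cdot> f' \<and> e \<cdot> h' = g' \<and>
              E_triangle K D d E e F (push K F f' \<delta>') \<and>
              pull K A d \<delta>'' = \<delta> \<and>
              push K E f \<delta>'' = pull K B e \<delta>'"
    and ET4_op:
      "\<lbrakk> E_triangle K D f' B f A \<delta>; E_triangle K F g' C g B \<delta>' \<rbrakk>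
        \<Longrightarrow> \<exists>E d e h' \<delta>''.
              E_triangle K E h' C (f \<cdot> g) A \<delta>'' \<and>
              d \<in> mor K E D \<and> e \<in> mor K F E \<and>
              g \<cdot> h' = f' \<cdot> d \<and> h' \<cdot> e = g' \<and>
              E_triangle K F e E d D (pull K F f' \<delta>') \<and>
              push K A d \<delta>'' = \<delta> \<and>
              pull K E f \<delta>'' = push K B e \<delta>'"


section \<open>Twin cotorsion pairs and their hearts\<close>

text \<open>Full subcategories closed under isomorphisms are represented by their sets of objects.\<close>

definition full_subcat :: "('o, 'm, 'z) cat_scheme \<Rightarrow> 'o set \<Rightarrow> bool" where
  "full_subcat K D \<longleftrightarrow> D \<subseteq> Obj K \<and>
     (\<forall>X \<in> D. \<forall>Y \<in> Obj K. \<forall>f. iso_mor K X Y f \<longrightarrow> Y \<in> D)"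

definition summand_closed :: "('o, 'm, 'z) cat_scheme \<Rightarrow> 'o set \<Rightarrow> bool" where
  "summand_closed K D \<longleftrightarrow>
     (\<forall>X Y P i i' p p'. biproduct K X Y P i i' p p' \<longrightarrow> P \<in> D \<longrightarrow> X \<in> D)"

definition cotorsion_pair ::
  "('o, 'm, 'e, 'z) ext_cat_scheme \<Rightarrow> 'o set \<Rightarrow> 'o set \<Rightarrow> bool" where
  "cotorsion_pair K \<U> \<V> \<longleftrightarrow>
     full_subcat K \<U> \<and> full_subcat K \<V> \<and> summand_closed K \<U> \<and> summand_closed K \<V> \<and>
     (\<forall>U \<in> \<U>. \<forall>V \<in> \<V>. carrier (Ext K U V) = {\<one>\<^bsub>Ext K U V\<^esub>}) \<and>
     (\<forall>B \<in> Obj K. \<exists>V \<in> \<V>. \<exists>U \<in> \<U>. \<exists>x y \<delta>. E_triangle K V x U y B \<delta>) \<and>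
     (\<forall>B \<in> Obj K. \<exists>V \<in> \<V>. \<exists>U \<in> \<U>. \<exists>x y \<delta>. E_triangle K B x V y U \<delta>)"

definition twin_cotorsion_pair ::
  "('o, 'm, 'e, 'z) ext_cat_scheme \<Rightarrow> 'o set \<Rightarrow> 'o set \<Rightarrow> 'o set \<Rightarrow> 'o set \<Rightarrow> bool" where
  "twin_cotorsion_pair K \<S> \<T> \<U> \<V> \<longleftrightarrow>
     cotorsion_pair K \<S> \<T> \<and> cotorsion_pair K \<U> \<V> \<and> \<S> \<subseteq> \<U>"

definition factor_through :: "('o, 'm, 'z) cat_scheme \<Rightarrow> 'o set \<Rightarrow> 'o \<Rightarrow> 'o \<Rightarrow> 'm set" where
  "factor_through K \<W> A B = {h \<cdot> g | g h W. W \<in> \<W> \<and> g \<in> mor K A W \<and> h \<in> mor K W B}"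
  for K (structure)

text \<open>
  The morphism groups of \<open>\<D>/\<W>\<close> are the factor groups by the subgroups of morphisms factoring
  through objects of \<open>\<W>\<close>; a morphism is thus a coset. The composite of two cosets \<open>G\<close> and \<open>F\<close> is the
  coset of \<open>g \<cdot> f\<close> for any representatives \<open>g\<close> and \<open>f\<close>. It is written as the union over all choices
  of representatives, these all giving the same coset when the morphisms factoring through \<open>\<W>\<close> form
  an ideal, and the objects \<open>A\<close> and \<open>C\<close> are determined by \<open>g \<cdot> f\<close>.
\<close>

definition ideal_quotient ::
  "('o, 'm, 'z) cat_scheme \<Rightarrow> 'o set \<Rightarrow> 'o set \<Rightarrow> ('o, 'm set) cat" where
  "ideal_quotient K \<D> \<W> = \<lparr>
     Obj = \<D>,
     Hom = (\<lambda>A B. Hom K A B Mod factor_through K \<W> A B),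
     Comp = (\<lambda>G F. \<Union>{factor_through K \<W> A C #>\<^bsub>Hom K A C\<^esub> (g \<cdot> f) | A C g f.
                        A \<in> \<D> \<and> C \<in> \<D> \<and> g \<in> G \<and> f \<in> F \<and> g \<cdot> f \<in> mor K A C}),
     Ident = (\<lambda>A. factor_through K \<W> A A #>\<^bsub>Hom K A A\<^esub> Ident K A) \<rparr>"
  for K (structure)

text \<open>\<open>plus_class K \<V> \<W>\<close> is \<open>\<B>\<^sup>+\<close> and \<open>minus_class K \<S> \<W>\<close> is \<open>\<B>\<^sup>-\<close>.\<close>

definition plus_class ::
  "('o, 'm, 'e, 'z) ext_cat_scheme \<Rightarrow> 'o set \<Rightarrow> 'o set \<Rightarrow> 'o set" where
  "plus_class K \<V> \<W> = {X \<in> Obj K. \<exists>V \<in> \<V>. \<exists>W \<in> \<W>. \<exists>x y \<delta>. E_triangle K V x W y X \<delta>}"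

definition minus_class ::
  "('o, 'm, 'e, 'z) ext_cat_scheme \<Rightarrow> 'o set \<Rightarrow> 'o set \<Rightarrow> 'o set" where
  "minus_class K \<S> \<W> = {Y \<in> Obj K. \<exists>W \<in> \<W>. \<exists>S \<in> \<S>. \<exists>x y \<delta>. E_triangle K Y x W y S \<delta>}"

definition heart ::
  "('o, 'm, 'e, 'z) ext_cat_scheme \<Rightarrow> 'o set \<Rightarrow> 'o set \<Rightarrow> 'o set \<Rightarrow> 'o set \<Rightarrow> ('o, 'm set) cat" where
  "heart K \<S> \<T> \<U> \<V> =
     (let \<W> = \<T> \<inter> \<U> in ideal_quotient K (plus_class K \<V> \<W> \<inter> minus_class K \<S> \<W>) \<W>)"


section \<open>Exact and quasi-abelian categories\<close>

definition kernel_of ::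
  "('o, 'm, 'z) cat_scheme \<Rightarrow> 'o \<Rightarrow> 'o \<Rightarrow> 'o \<Rightarrow> 'm \<Rightarrow> 'm \<Rightarrow> bool" where
  "kernel_of K A B C x y \<longleftrightarrow>
     A \<in> Obj K \<and> B \<in> Obj K \<and> C \<in> Obj K \<and> x \<in> mor K A B \<and> y \<in> mor K B C \<and>
     y \<cdot> x = zero_mor K A C \<and>
     (\<forall>Z \<in> Obj K. \<forall>z \<in> mor K Z B. y \<cdot> z = zero_mor K Z C \<longrightarrow> (\<exists>!u. u \<in> mor K Z A \<and> x \<cdot> u = z))"
  for K (structure)

text \<open>\<open>y\<close> is a cokernel of \<open>x\<close>; the arguments are in the order of the sequence \<open>A \<rightarrow> B \<rightarrow> C\<close>.\<close>

definition cokernel_of ::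
  "('o, 'm, 'z) cat_scheme \<Rightarrow> 'o \<Rightarrow> 'o \<Rightarrow> 'o \<Rightarrow> 'm \<Rightarrow> 'm \<Rightarrow> bool" where
  "cokernel_of K A B C x y \<longleftrightarrow>
     A \<in> Obj K \<and> B \<in> Obj K \<and> C \<in> Obj K \<and> x \<in> mor K A B \<and> y \<in> mor K B C \<and>
     y \<cdot> x = zero_mor K A C \<and>
     (\<forall>Z \<in> Obj K. \<forall>z \<in> mor K B Z. z \<cdot> x = zero_mor K A Z \<longrightarrow> (\<exists>!u. u \<in> mor K C Z \<and> u \<cdot> y = z))"
  for K (structure)

definition is_kernel :: "('o, 'm, 'z) cat_scheme \<Rightarrow> 'o \<Rightarrow> 'o \<Rightarrow> 'm \<Rightarrow> bool" where
  "is_kernel K A B x \<longleftrightarrow> (\<exists>C y. kernel_of K A B C x y)"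

definition is_cokernel :: "('o, 'm, 'z) cat_scheme \<Rightarrow> 'o \<Rightarrow> 'o \<Rightarrow> 'm \<Rightarrow> bool" where
  "is_cokernel K B C y \<longleftrightarrow> (\<exists>A x. cokernel_of K A B C x y)"

definition kernel_cokernel_pair :: "('o, 'm, 'z) cat_scheme \<Rightarrow> 'm \<Rightarrow> 'm \<Rightarrow> bool" where
  "kernel_cokernel_pair K x y \<longleftrightarrow>
     (\<exists>A B C. kernel_of K A B C x y \<and> cokernel_of K A B C x y)"

definition commutative_square ::
  "('o, 'm, 'z) cat_scheme \<Rightarrow> 'o \<Rightarrow> 'o \<Rightarrow> 'o \<Rightarrow> 'o \<Rightarrow> 'm \<Rightarrow> 'm \<Rightarrow> 'm \<Rightarrow> 'm \<Rightarrow> bool" where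
  "commutative_square K A B C D a b c d \<longleftrightarrow>
     A \<in> Obj K \<and> B \<in> Obj K \<and> C \<in> Obj K \<and> D \<in> Obj K \<and>
     a \<in> mor K A B \<and> b \<in> mor K A C \<and> c \<in> mor K B D \<and> d \<in> mor K C D \<and>
     c \<cdot> a = d \<cdot> b"
  for K (structure)

definition pullback_square ::
  "('o, 'm, 'z) cat_scheme \<Rightarrow> 'o \<Rightarrow> 'o \<Rightarrow> 'o \<Rightarrow> 'o \<Rightarrow> 'm \<Rightarrow> 'm \<Rightarrow> 'm \<Rightarrow> 'm \<Rightarrow> bool" where
  "pullback_square K A B C D a b c d \<longleftrightarrow> commutative_square K A B C D a b c d \<and>
     (\<forall>Z \<in> Obj K. \<forall>s \<in> mor K Z B. \<forall>t \<in> mor K Z C. c \<cdot> s = d \<cdot> t \<longrightarrow>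
        (\<exists>!u. u \<in> mor K Z A \<and> a \<cdot> u = s \<and> b \<cdot> u = t))"
  for K (structure)

definition pushout_square ::
  "('o, 'm, 'z) cat_scheme \<Rightarrow> 'o \<Rightarrow> 'o \<Rightarrow> 'o \<Rightarrow> 'o \<Rightarrow> 'm \<Rightarrow> 'm \<Rightarrow> 'm \<Rightarrow> 'm \<Rightarrow> bool" where
  "pushout_square K A B C D a b c d \<longleftrightarrow> commutative_square K A B C D a b c d \<and>
     (\<forall>Z \<in> Obj K. \<forall>s \<in> mor K B Z. \<forall>t \<in> mor K C Z. s \<cdot> a = t \<cdot> b \<longrightarrow>
        (\<exists>!u. u \<in> mor K D Z \<and> u \<cdot> c = s \<and> u \<cdot> d = t))"
  for K (structure)

text \<open>
  Quillen's axioms in the form of Keller and Buehler, without Quillen's redundant axiom. \<open>X\<close> is the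
  class of short exact sequences; first components are the admissible monomorphisms, second components
  the admissible epimorphisms.
\<close>

locale exact_structure = additive_category K
  for K :: "('o, 'm, 'z) cat_scheme" (structure) and X :: "('m \<times> 'm) set" +
  assumes exact_kernel_cokernel: "(x, y) \<in> X \<Longrightarrow> kernel_cokernel_pair K x y"
    and exact_iso_closed:
      "\<lbrakk> (x, y) \<in> X;
         A \<in> Obj K; B \<in> Obj K; C \<in> Obj K; x \<in> mor K A B; y \<in> mor K B C;
         A' \<in> Obj K; B' \<in> Obj K; C' \<in> Obj K; x' \<in> mor K A' B'; y' \<in> mor K B' C';
         iso_mor K A A' a; iso_mor K B B' b; iso_mor K C C' c;
         b \<cdot> x = x' \<cdot> a; c \<cdot> y = y' \<cdot> b \<rbrakk> \<Longrightarrow> (x', y') \<in> X"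
    and exact_Ident_mono: "A \<in> Obj K \<Longrightarrow> \<exists>y. (Ident K A, y) \<in> X"
    and exact_Ident_epi: "A \<in> Obj K \<Longrightarrow> \<exists>x. (x, Ident K A) \<in> X"
    and exact_Comp_mono:
      "\<lbrakk> A \<in> Obj K; B \<in> Obj K; C \<in> Obj K; x \<in> mor K A B; x' \<in> mor K B C;
         \<exists>y. (x, y) \<in> X; \<exists>y. (x', y) \<in> X \<rbrakk> \<Longrightarrow> \<exists>y. (x' \<cdot> x, y) \<in> X"
    and exact_Comp_epi:
      "\<lbrakk> A \<in> Obj K; B \<in> Obj K; C \<in> Obj K; y \<in> mor K A B; y' \<in> mor K B C;
         \<exists>x. (x, y) \<in> X; \<exists>x. (x, y') \<in> X \<rbrakk> \<Longrightarrow> \<exists>x. (x, y' \<cdot> y) \<in> X"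
    and exact_pushout:
      "\<lbrakk> A \<in> Obj K; B \<in> Obj K; C \<in> Obj K; x \<in> mor K A B; f \<in> mor K A C; \<exists>y. (x, y) \<in> X \<rbrakk>
        \<Longrightarrow> \<exists>D f' x'. pushout_square K A B C D x f f' x' \<and> (\<exists>y. (x', y) \<in> X)"
    and exact_pullback:
      "\<lbrakk> B \<in> Obj K; C \<in> Obj K; D \<in> Obj K; f \<in> mor K B D; y \<in> mor K C D; \<exists>x. (x, y) \<in> X \<rbrakk>
        \<Longrightarrow> \<exists>A y' f'. pullback_square K A B C D y' f' f y \<and> (\<exists>x. (x, y') \<in> X)"

locale preabelian_category = additive_category K
  for K :: "('o, 'm, 'z) cat_scheme" (structure) +
  assumes kernel_exists:
      "\<lbrakk> B \<in> Obj K; C \<in> Obj K; y \<in> mor K B C \<rbrakk> \<Longrightarrow> \<exists>A x. kernel_of K A B C x y"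
    and cokernel_exists:
      "\<lbrakk> A \<in> Obj K; B \<in> Obj K; x \<in> mor K A B \<rbrakk> \<Longrightarrow> \<exists>C y. cokernel_of K A B C x y"

locale left_quasi_abelian_category = preabelian_category K
  for K :: "('o, 'm, 'z) cat_scheme" (structure) +
  assumes pullback_cokernel:
      "\<lbrakk> pullback_square K A B C D a b c d; is_cokernel K C D d \<rbrakk> \<Longrightarrow> is_cokernel K A B a"

locale right_quasi_abelian_category = preabelian_category K
  for K :: "('o, 'm, 'z) cat_scheme" (structure) +
  assumes pushout_kernel:
      "\<lbrakk> pushout_square K A B C D a b c d; is_kernel K A B a \<rbrakk> \<Longrightarrow> is_kernel K C D d"

locale quasi_abelian_category =
  left_quasi_abelian_category K + right_quasi_abelian_category K
  for K :: "('o, 'm, 'z) cat_scheme" (structure)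

end

theory Submission
  imports Defs
begin

text \<open>
  A triangle \<open>A \<rightarrow> X \<rightarrow> C\<close> with \<open>X \<in> \<W>\<close> and \<open>C \<in> \<S>\<close>, realizing \<open>\<delta>\<close>, detects triviality in the
  heart: since \<open>\<E>(\<S>, \<T>) = 0\<close>, a morphism \<open>f : A \<rightarrow> B\<close> factors through \<open>\<W>\<close> if and only if
  \<open>f\<^sub>*\<delta> = 0\<close> (\<open>I_iff_push_one\<close>). This turns questions about the ideal quotient into questions about
  extensions, which the long exact sequences and the octahedral axiom answer.

  The cokernel of \<open>f\<close> is obtained from a realization \<open>B \<rightarrow> M \<rightarrow> C\<close> of \<open>f\<^sub>*\<delta>\<close> by reflecting \<open>M\<close> into
  \<open>\<B>\<^sup>+\<close> (\<open>cokernel_of_Q_exists\<close>). The resulting morphism is an inflation whose cone lies in \<open>\<S>\<close>, and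
  conversely each such inflation between objects of the heart is a cokernel of an explicit kernel
  (\<open>S_inflation_kernel\<close>). Up to isomorphism, the cokernels in the heart are therefore precisely
  the inflations with cone in \<open>\<S>\<close>. Passing to the opposite category yields kernels, so the heart is
  preabelian.

  This description of cokernels is what makes them stable under pullback. To pull \<open>g : C \<rightarrow> D\<close>, with
  cone \<open>S\<close>, back along \<open>c : B \<rightarrow> D\<close>, make \<open>c\<close> a deflation by adding to \<open>B\<close> an object of \<open>\<W>\<close>, which
  is zero in the heart. The pullback of \<open>g\<close> along a deflation exists up to the usual ambiguity, its
  base change has the same cone \<open>S\<close>, it lies again in the heart, and there the ambiguity disappears
  (\<open>S_inflation_pullback\<close>). So the heart is left quasi-abelian; the
  opposite category carries the twin cotorsion pair \<open>((\<V>, \<U>), (\<T>, \<S>))\<close> with the opposite heart, and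
  the heart is right quasi-abelian too.

  Finally, in any quasi-abelian category all kernel-cokernel pairs together form an exact structure
  (\<open>exact_structure_kernel_cokernel_pairs\<close>). It contains every other exact structure,
  as exact structures consist of kernel-cokernel pairs.
\<close>

section \<open>Calculating in preadditive categories\<close>

text \<open>Membership of the end points is part of the typing judgement, so that a rule needs one premise
  per morphism.\<close>

definition arr :: "('o, 'm, 'z) cat_scheme \<Rightarrow> 'o \<Rightarrow> 'o \<Rightarrow> 'm \<Rightarrow> bool" where
  "arr K A B f \<longleftrightarrow> A \<in> Obj K \<and> B \<in> Obj K \<and> f \<in> mor K A B"

definition is_arr :: "('o, 'm, 'z) cat_scheme \<Rightarrow> 'm \<Rightarrow> bool" where
  "is_arr K f \<longleftrightarrow> (\<exists>A B. arr K A B f)"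

definition src :: "('o, 'm, 'z) cat_scheme \<Rightarrow> 'm \<Rightarrow> 'o" where
  "src K f = (THE A. \<exists>B. arr K A B f)"

definition tgt :: "('o, 'm, 'z) cat_scheme \<Rightarrow> 'm \<Rightarrow> 'o" where
  "tgt K f = (THE B. \<exists>A. arr K A B f)"

abbreviation neg_mor :: "('o, 'm, 'z) cat_scheme \<Rightarrow> 'o \<Rightarrow> 'o \<Rightarrow> 'm \<Rightarrow> 'm" where
  "neg_mor K A B f \<equiv> inv\<^bsub>Hom K A B\<^esub> f"

abbreviation sub_mor :: "('o, 'm, 'z) cat_scheme \<Rightarrow> 'o \<Rightarrow> 'o \<Rightarrow> 'm \<Rightarrow> 'm \<Rightarrow> 'm" where
  "sub_mor K A B f g \<equiv> add_mor K A B f (neg_mor K A B g)"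

lemma arr_ObjD: "arr K A B f \<Longrightarrow> A \<in> Obj K" "arr K A B f \<Longrightarrow> B \<in> Obj K"
  by (auto simp: arr_def)

named_theorems cat_simps

context category
begin

lemma arr_unique: "arr K A B f \<Longrightarrow> arr K A' B' f \<Longrightarrow> A = A' \<and> B = B'"
  using mor_disjoint by (auto simp: arr_def)

lemma src_eq: "arr K A B f \<Longrightarrow> src K f = A"
  unfolding src_def by (rule the_equality) (use arr_unique in blast)+

lemma tgt_eq: "arr K A B f \<Longrightarrow> tgt K f = B"
  unfolding tgt_def by (rule the_equality) (use arr_unique in blast)+

text \<open>Rewriting with this rule turns every typing of a morphism into equations for its source and
  target, after which the side conditions of the laws in \<open>cat_simps\<close> are decided by the simplifier.\<close>

lemma arr_iff:
  "arr K A B f \<longleftrightarrow> A \<in> Obj K \<and> B \<in> Obj K \<and> is_arr K f \<and> src K f = A \<and> tgt K f = B"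
  unfolding is_arr_def by (metis arr_def src_eq tgt_eq)

lemma is_arr_arr: "is_arr K f \<Longrightarrow> arr K (src K f) (tgt K f) f"
  unfolding is_arr_def by (metis src_eq tgt_eq)

lemma Obj_src [cat_simps]: "is_arr K f \<Longrightarrow> src K f \<in> Obj K"
  using is_arr_arr arr_def by metis

lemma Obj_tgt [cat_simps]: "is_arr K f \<Longrightarrow> tgt K f \<in> Obj K"
  using is_arr_arr arr_def by metis

lemma arr_Comp: "arr K A B f \<Longrightarrow> arr K B C g \<Longrightarrow> arr K A C (g \<cdot> f)"
  using Comp_mor by (auto simp: arr_def)

lemma is_arr_Comp [cat_simps]:
  assumes "is_arr K f" "is_arr K g" "src K g = tgt K f"
  shows "is_arr K (g \<cdot> f)" "src K (g \<cdot> f) = src K f" "tgt K (g \<cdot> f) = tgt K g"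
  using arr_Comp[of "src K f" "tgt K f" f "tgt K g" g] assms is_arr_arr[of f] is_arr_arr[of g]
  by (auto simp: arr_iff)

lemma arr_Ident: "A \<in> Obj K \<Longrightarrow> arr K A A (Ident K A)"
  using Ident_mor by (auto simp: arr_def)

lemma is_arr_Ident [cat_simps]:
  assumes "A \<in> Obj K"
  shows "is_arr K (Ident K A)" "src K (Ident K A) = A" "tgt K (Ident K A) = A"
  using arr_Ident[OF assms] by (auto simp: arr_iff)

lemma Comp_arr_assoc [cat_simps]:
  assumes "is_arr K f" "is_arr K g" "is_arr K h" "src K g = tgt K f" "src K h = tgt K g"
  shows "(h \<cdot> g) \<cdot> f = h \<cdot> (g \<cdot> f)"
  using Comp_assoc[of "src K f" "tgt K f" "tgt K g" "tgt K h" f g h] assms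
    is_arr_arr[of f] is_arr_arr[of g] is_arr_arr[of h]
  by (auto simp: arr_def)

lemma Comp_Ident [cat_simps]:
  assumes "is_arr K f"
  shows "tgt K f = B \<Longrightarrow> Ident K B \<cdot> f = f" "src K f = A \<Longrightarrow> f \<cdot> Ident K A = f"
  using is_arr_arr[OF assms] Ident_left Ident_right by (auto simp: arr_def)

lemma comp_assoc_arr:
  "arr K A B f \<Longrightarrow> arr K B C g \<Longrightarrow> arr K C D h \<Longrightarrow> (h \<cdot> g) \<cdot> f = h \<cdot> (g \<cdot> f)"
  by (simp add: arr_iff cat_simps)

end

context preadditive_category
begin

lemma arr_zero: "A \<in> Obj K \<Longrightarrow> B \<in> Obj K \<Longrightarrow> arr K A B (zero_mor K A B)"
  using Hom_comm_group[of A B] by (simp add: arr_def comm_group_def monoid.one_closed group.is_monoid)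

lemma arr_add: "arr K A B f \<Longrightarrow> arr K A B g \<Longrightarrow> arr K A B (add_mor K A B f g)"
  using Hom_comm_group[of A B]
  by (auto simp: arr_def comm_group_def intro: monoid.m_closed group.is_monoid)

lemma arr_neg: "arr K A B f \<Longrightarrow> arr K A B (neg_mor K A B f)"
  using Hom_comm_group[of A B] by (auto simp: arr_def comm_group_def)

lemma arr_sub: "arr K A B f \<Longrightarrow> arr K A B g \<Longrightarrow> arr K A B (sub_mor K A B f g)"
  by (simp add: arr_add arr_neg)

lemma is_arr_zero [cat_simps]:
  assumes "A \<in> Obj K" "B \<in> Obj K"
  shows "is_arr K (zero_mor K A B)" "src K (zero_mor K A B) = A" "tgt K (zero_mor K A B) = B"
  using arr_zero[OF assms] by (auto simp: arr_iff)

lemma is_arr_add [cat_simps]: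
  assumes "arr K A B f" "arr K A B g"
  shows "is_arr K (add_mor K A B f g)" "src K (add_mor K A B f g) = A"
    "tgt K (add_mor K A B f g) = B"
  using arr_add[OF assms] by (auto simp: arr_iff)

lemma is_arr_neg [cat_simps]:
  assumes "arr K A B f"
  shows "is_arr K (neg_mor K A B f)" "src K (neg_mor K A B f) = A" "tgt K (neg_mor K A B f) = B"
  using arr_neg[OF assms] by (auto simp: arr_iff)

lemma Comp_zero_right [cat_simps]:
  assumes "is_arr K g" "src K g = B" "A \<in> Obj K"
  shows "g \<cdot> zero_mor K A B = zero_mor K A (tgt K g)"
proof -
  have g: "arr K B (tgt K g) g" using assms is_arr_arr by blast
  then have "(\<lambda>f. g \<cdot> f) \<in> hom (Hom K A B) (Hom K A (tgt K g))"
    using assms Comp_hom_right by (auto simp: arr_def)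
  then show ?thesis
    using Hom_comm_group[of A B] Hom_comm_group[of A "tgt K g"] g assms
    by (auto simp: arr_def comm_group_def dest: hom_one)
qed

lemma Comp_zero_left [cat_simps]:
  assumes "is_arr K f" "tgt K f = B" "C \<in> Obj K"
  shows "zero_mor K B C \<cdot> f = zero_mor K (src K f) C"
proof -
  have f: "arr K (src K f) B f" using assms is_arr_arr by blast
  then have "(\<lambda>g. g \<cdot> f) \<in> hom (Hom K B C) (Hom K (src K f) C)"
    using assms Comp_hom_left by (auto simp: arr_def)
  then show ?thesis
    using Hom_comm_group[of B C] Hom_comm_group[of "src K f" C] f assms
    by (auto simp: arr_def comm_group_def dest: hom_one)
qed

lemma Comp_add_right [cat_simps]:
  assumes "is_arr K g" "src K g = B" "arr K A B f" "arr K A B f'"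
  shows "g \<cdot> add_mor K A B f f' = add_mor K A (tgt K g) (g \<cdot> f) (g \<cdot> f')"
proof -
  have g: "arr K B (tgt K g) g" using assms is_arr_arr by blast
  then have "(\<lambda>f. g \<cdot> f) \<in> hom (Hom K A B) (Hom K A (tgt K g))"
    using assms Comp_hom_right by (auto simp: arr_def)
  then show ?thesis using assms by (auto simp: arr_def hom_def)
qed

lemma Comp_add_left [cat_simps]:
  assumes "is_arr K f" "tgt K f = B" "arr K B C g" "arr K B C g'"
  shows "add_mor K B C g g' \<cdot> f = add_mor K (src K f) C (g \<cdot> f) (g' \<cdot> f)"
proof -
  have f: "arr K (src K f) B f" using assms is_arr_arr by blast
  then have "(\<lambda>g. g \<cdot> f) \<in> hom (Hom K B C) (Hom K (src K f) C)"
    using assms Comp_hom_left by (auto simp: arr_def)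
  then show ?thesis using assms by (auto simp: arr_def hom_def)
qed

lemma Comp_neg_right [cat_simps]:
  assumes "is_arr K g" "src K g = B" "arr K A B f"
  shows "g \<cdot> neg_mor K A B f = neg_mor K A (tgt K g) (g \<cdot> f)"
proof -
  have g: "arr K B (tgt K g) g" using assms is_arr_arr by blast
  then have "group_hom (Hom K A B) (Hom K A (tgt K g)) (\<lambda>f. g \<cdot> f)"
    using assms Comp_hom_right Hom_comm_group
    by (auto simp: arr_def group_hom_def group_hom_axioms_def comm_group_def)
  then show ?thesis using assms group_hom.hom_inv[of "Hom K A B" _ "\<lambda>f. g \<cdot> f" f]
    by (auto simp: arr_def)
qed

lemma Comp_neg_left [cat_simps]:
  assumes "is_arr K f" "tgt K f = B" "arr K B C g"
  shows "neg_mor K B C g \<cdot> f = neg_mor K (src K f) C (g \<cdot> f)"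
proof -
  have f: "arr K (src K f) B f" using assms is_arr_arr by blast
  then have "group_hom (Hom K B C) (Hom K (src K f) C) (\<lambda>g. g \<cdot> f)"
    using assms Comp_hom_left Hom_comm_group
    by (auto simp: arr_def group_hom_def group_hom_axioms_def comm_group_def)
  then show ?thesis using assms group_hom.hom_inv[of "Hom K B C" _ "\<lambda>g. g \<cdot> f" g]
    by (auto simp: arr_def)
qed

lemma add_simps [cat_simps]:
  assumes "arr K A B f"
  shows "add_mor K A B f (zero_mor K A B) = f" "add_mor K A B (zero_mor K A B) f = f"
    "add_mor K A B f (neg_mor K A B f) = zero_mor K A B"
    "add_mor K A B (neg_mor K A B f) f = zero_mor K A B"
    "neg_mor K A B (neg_mor K A B f) = f"
proof -
  interpret G: comm_group "Hom K A B" using assms Hom_comm_group by (auto simp: arr_def)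
  have "f \<in> mor K A B" using assms by (auto simp: arr_def)
  then show "add_mor K A B f (zero_mor K A B) = f" "add_mor K A B (zero_mor K A B) f = f"
    "add_mor K A B f (neg_mor K A B f) = zero_mor K A B"
    "add_mor K A B (neg_mor K A B f) f = zero_mor K A B"
    "neg_mor K A B (neg_mor K A B f) = f" by auto
qed

lemma neg_zero [cat_simps]:
  "A \<in> Obj K \<Longrightarrow> B \<in> Obj K \<Longrightarrow> neg_mor K A B (zero_mor K A B) = zero_mor K A B"
  using Hom_comm_group[of A B] by (simp add: comm_group_def monoid.inv_one group.is_monoid)

lemma neg_add [cat_simps]:
  assumes "arr K A B f" "arr K A B g"
  shows "neg_mor K A B (add_mor K A B f g) = add_mor K A B (neg_mor K A B f) (neg_mor K A B g)"
proof -
  interpret G: comm_group "Hom K A B" using assms Hom_comm_group by (auto simp: arr_def)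
  show ?thesis using assms by (auto simp: arr_def G.inv_mult)
qed

lemma add_assoc [cat_simps]:
  assumes "arr K A B f" "arr K A B g" "arr K A B h"
  shows "add_mor K A B (add_mor K A B f g) h = add_mor K A B f (add_mor K A B g h)"
proof -
  interpret G: comm_group "Hom K A B" using assms Hom_comm_group by (auto simp: arr_def)
  show ?thesis using assms by (auto simp: arr_def G.m_assoc)
qed

lemma add_commute:
  assumes "arr K A B f" "arr K A B g"
  shows "add_mor K A B f g = add_mor K A B g f"
proof -
  interpret G: comm_group "Hom K A B" using assms Hom_comm_group by (auto simp: arr_def)
  show ?thesis using assms by (auto simp: arr_def G.m_comm)
qed

lemma add_neg_cancel [cat_simps]:
  assumes "arr K A B f" "arr K A B g"
  shows "add_mor K A B f (add_mor K A B (neg_mor K A B f) g) = g"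
    "add_mor K A B (neg_mor K A B f) (add_mor K A B f g) = g"
  using assms add_simps add_assoc arr_neg by metis+

lemma sub_eq_zero_iff:
  assumes "arr K A B f" "arr K A B g"
  shows "sub_mor K A B f g = zero_mor K A B \<longleftrightarrow> f = g"
  by (metis assms add_assoc add_simps arr_neg)

end

context category
begin

lemma iso_morI:
  assumes "arr K A B f" "arr K B A g" "g \<cdot> f = Ident K A" "f \<cdot> g = Ident K B"
  shows "iso_mor K A B f"
  using assms by (auto simp: iso_mor_def arr_def)

end

section \<open>Kernels, cokernels, pullbacks and pushouts\<close>

context preadditive_category
begin

lemma kernel_ofI:
  assumes "arr K A B x" "arr K B C y" "y \<cdot> x = zero_mor K A C"
    and lift: "\<And>Z z. arr K Z B z \<Longrightarrow> y \<cdot> z = zero_mor K Z C \<Longrightarrow> \<exists>u. arr K Z A u \<and> x \<cdot> u = z"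
    and mono: "\<And>Z u. arr K Z A u \<Longrightarrow> x \<cdot> u = zero_mor K Z B \<Longrightarrow> u = zero_mor K Z A"
  shows "kernel_of K A B C x y"
proof -
  have "u = v" if uv: "arr K Z A u" "arr K Z A v" "x \<cdot> u = x \<cdot> v" for Z u v
  proof -
    have "x \<cdot> sub_mor K Z A u v = zero_mor K Z B"
      using uv assms(1) by (simp add: arr_iff cat_simps)
    then show ?thesis using mono[OF arr_sub[OF uv(1,2)]] sub_eq_zero_iff uv by blast
  qed
  then show ?thesis
    using assms unfolding kernel_of_def arr_def Ex1_def by metis
qed

lemma kernel_of_arr:
  assumes "kernel_of K A B C x y"
  shows "arr K A B x" "arr K B C y" "y \<cdot> x = zero_mor K A C"
  using assms by (auto simp: kernel_of_def arr_def)

lemma kernel_of_lift: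
  "kernel_of K A B C x y \<Longrightarrow> arr K Z B z \<Longrightarrow> y \<cdot> z = zero_mor K Z C
    \<Longrightarrow> \<exists>u. arr K Z A u \<and> x \<cdot> u = z"
  unfolding kernel_of_def arr_def by metis

lemma kernel_of_mono:
  assumes k: "kernel_of K A B C x y" and u: "arr K Z A u" and v: "arr K Z A v" and eq: "x \<cdot> u = x \<cdot> v"
  shows "u = v"
proof -
  note a = kernel_of_arr[OF k]
  have "arr K Z B (x \<cdot> v)" using arr_Comp[OF v a(1)] .
  moreover have "y \<cdot> (x \<cdot> v) = zero_mor K Z C"
    using comp_assoc_arr[OF v a(1,2)] a v by (auto simp: arr_iff cat_simps)
  ultimately show ?thesis using assms unfolding kernel_of_def arr_def by metis
qed

lemma cokernel_ofI:
  assumes "arr K A B x" "arr K B C y" "y \<cdot> x = zero_mor K A C"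
    and ext: "\<And>Z z. arr K B Z z \<Longrightarrow> z \<cdot> x = zero_mor K A Z \<Longrightarrow> \<exists>u. arr K C Z u \<and> u \<cdot> y = z"
    and epi: "\<And>Z u. arr K C Z u \<Longrightarrow> u \<cdot> y = zero_mor K B Z \<Longrightarrow> u = zero_mor K C Z"
  shows "cokernel_of K A B C x y"
proof -
  have "u = v" if uv: "arr K C Z u" "arr K C Z v" "u \<cdot> y = v \<cdot> y" for Z u v
  proof -
    have "sub_mor K C Z u v \<cdot> y = zero_mor K B Z"
      using uv assms(2) by (simp add: arr_iff cat_simps)
    then show ?thesis using epi[OF arr_sub[OF uv(1,2)]] sub_eq_zero_iff uv by blast
  qed
  then show ?thesis
    using assms unfolding cokernel_of_def arr_def Ex1_def by metis
qed

lemma cokernel_of_arr: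
  assumes "cokernel_of K A B C x y"
  shows "arr K A B x" "arr K B C y" "y \<cdot> x = zero_mor K A C"
  using assms by (auto simp: cokernel_of_def arr_def)

lemma cokernel_of_ext:
  "cokernel_of K A B C x y \<Longrightarrow> arr K B Z z \<Longrightarrow> z \<cdot> x = zero_mor K A Z
    \<Longrightarrow> \<exists>u. arr K C Z u \<and> u \<cdot> y = z"
  unfolding cokernel_of_def arr_def by metis

lemma cokernel_of_epi:
  assumes k: "cokernel_of K A B C x y" and u: "arr K C Z u" and v: "arr K C Z v" and eq: "u \<cdot> y = v \<cdot> y"
  shows "u = v"
proof -
  note a = cokernel_of_arr[OF k]
  have "arr K B Z (v \<cdot> y)" using arr_Comp[OF a(2) v] .
  moreover have "(v \<cdot> y) \<cdot> x = zero_mor K A Z"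
    using a v by (simp add: arr_iff cat_simps)
  ultimately show ?thesis using assms unfolding cokernel_of_def arr_def by metis
qed

lemma cokernel_of_unique:
  assumes c: "cokernel_of K A B C x y" and c': "cokernel_of K A B C' x y'"
  obtains \<phi> \<psi> where "arr K C C' \<phi>" "arr K C' C \<psi>" "\<psi> \<cdot> \<phi> = Ident K C" "\<phi> \<cdot> \<psi> = Ident K C'" "\<phi> \<cdot> y = y'"
proof -
  note a = cokernel_of_arr[OF c] and a' = cokernel_of_arr[OF c']
  obtain \<phi> where \<phi>: "arr K C C' \<phi>" "\<phi> \<cdot> y = y'" using cokernel_of_ext[OF c a'(2,3)] by blast
  obtain \<psi> where \<psi>: "arr K C' C \<psi>" "\<psi> \<cdot> y' = y" using cokernel_of_ext[OF c' a(2,3)] by blast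
  have "\<psi> \<cdot> \<phi> = Ident K C"
    by (rule cokernel_of_epi[OF c arr_Comp[OF \<phi>(1) \<psi>(1)]])
      (use a \<phi> \<psi> arr_Ident in \<open>auto simp: arr_iff cat_simps\<close>)
  moreover have "\<phi> \<cdot> \<psi> = Ident K C'"
    by (rule cokernel_of_epi[OF c' arr_Comp[OF \<psi>(1) \<phi>(1)]])
      (use a' \<phi> \<psi> arr_Ident in \<open>auto simp: arr_iff cat_simps\<close>)
  ultimately show thesis using \<phi> \<psi> that by blast
qed

lemma cokernel_of_Comp_iso:
  assumes c: "cokernel_of K A B C x y" and \<phi>: "arr K C C' \<phi>" "arr K C' C \<psi>"
    "\<psi> \<cdot> \<phi> = Ident K C" "\<phi> \<cdot> \<psi> = Ident K C'"
  shows "cokernel_of K A B C' x (\<phi> \<cdot> y)"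
proof (rule cokernel_ofI)
  note a = cokernel_of_arr[OF c]
  show "arr K A B x" "arr K B C' (\<phi> \<cdot> y)" "(\<phi> \<cdot> y) \<cdot> x = zero_mor K A C'"
    using a \<phi> by (auto simp: arr_iff cat_simps)
  fix Z z assume z: "arr K B Z z" "z \<cdot> x = zero_mor K A Z"
  then obtain u where u: "arr K C Z u" "u \<cdot> y = z" using cokernel_of_ext[OF c] by blast
  have "(u \<cdot> \<psi>) \<cdot> (\<phi> \<cdot> y) = u \<cdot> ((\<psi> \<cdot> \<phi>) \<cdot> y)"
    using a \<phi>(1,2) u(1) by (simp add: arr_iff cat_simps)
  then have "(u \<cdot> \<psi>) \<cdot> (\<phi> \<cdot> y) = z" using a \<phi>(3) u by (simp add: arr_iff cat_simps)
  then show "\<exists>u. arr K C' Z u \<and> u \<cdot> (\<phi> \<cdot> y) = z" using u \<phi> arr_Comp by blast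
next
  note a = cokernel_of_arr[OF c]
  fix Z u assume u: "arr K C' Z u" "u \<cdot> (\<phi> \<cdot> y) = zero_mor K B Z"
  have "(u \<cdot> \<phi>) \<cdot> y = zero_mor K C Z \<cdot> y" using a \<phi>(1) u by (simp add: arr_iff cat_simps)
  then have "u \<cdot> \<phi> = zero_mor K C Z"
    using cokernel_of_epi[OF c arr_Comp[OF \<phi>(1) u(1)]] arr_zero a u by (meson arr_ObjD)
  moreover have "(u \<cdot> \<phi>) \<cdot> \<psi> = u" using \<phi> u(1) by (simp add: arr_iff cat_simps)
  ultimately show "u = zero_mor K C' Z" using \<phi> u by (auto simp: arr_iff cat_simps)
qed

lemma cokernel_of_iso_Comp:
  assumes c: "cokernel_of K A B C x y" and \<phi>: "arr K B' B \<phi>" "arr K B B' \<psi>"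
    "\<psi> \<cdot> \<phi> = Ident K B'" "\<phi> \<cdot> \<psi> = Ident K B"
  shows "cokernel_of K A B' C (\<psi> \<cdot> x) (y \<cdot> \<phi>)"
proof (rule cokernel_ofI)
  note a = cokernel_of_arr[OF c]
  show "arr K A B' (\<psi> \<cdot> x)" "arr K B' C (y \<cdot> \<phi>)"
    using a \<phi> by (auto simp: arr_iff cat_simps)
  have "(y \<cdot> \<phi>) \<cdot> (\<psi> \<cdot> x) = y \<cdot> ((\<phi> \<cdot> \<psi>) \<cdot> x)" using a(1,2) \<phi>(1,2) by (simp add: arr_iff cat_simps)
  then show "(y \<cdot> \<phi>) \<cdot> (\<psi> \<cdot> x) = zero_mor K A C" using a \<phi>(4) by (simp add: arr_iff cat_simps)
  fix Z z assume z: "arr K B' Z z" "z \<cdot> (\<psi> \<cdot> x) = zero_mor K A Z"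
  have "(z \<cdot> \<psi>) \<cdot> x = zero_mor K A Z" using a \<phi>(2) z by (simp add: arr_iff cat_simps)
  then obtain u where u: "arr K C Z u" "u \<cdot> y = z \<cdot> \<psi>"
    using cokernel_of_ext[OF c arr_Comp[OF \<phi>(2) z(1)]] by blast
  have "u \<cdot> (y \<cdot> \<phi>) = (u \<cdot> y) \<cdot> \<phi>" using u(1) a \<phi>(1) by (simp add: arr_iff cat_simps)
  also have "\<dots> = z \<cdot> (\<psi> \<cdot> \<phi>)" unfolding u(2) using z(1) \<phi>(1,2) by (simp add: arr_iff cat_simps)
  finally have "u \<cdot> (y \<cdot> \<phi>) = z" using z(1) \<phi>(3) by (simp add: arr_iff cat_simps)
  then show "\<exists>u. arr K C Z u \<and> u \<cdot> (y \<cdot> \<phi>) = z" using u by blast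
next
  note a = cokernel_of_arr[OF c]
  fix Z u assume u: "arr K C Z u" "u \<cdot> (y \<cdot> \<phi>) = zero_mor K B' Z"
  have "u \<cdot> y = u \<cdot> (y \<cdot> (\<phi> \<cdot> \<psi>))" using a u(1) \<phi>(4) by (simp add: arr_iff cat_simps)
  also have "\<dots> = (u \<cdot> (y \<cdot> \<phi>)) \<cdot> \<psi>" using a u(1) \<phi>(1,2) by (simp add: arr_iff cat_simps)
  also have "\<dots> = zero_mor K C Z \<cdot> y" using u a \<phi>(2) by (simp add: arr_iff cat_simps)
  finally show "u = zero_mor K C Z"
    using cokernel_of_epi[OF c u(1)] arr_zero a u by (meson arr_ObjD)
qed

lemma pullback_squareI:
  assumes "arr K A B a" "arr K A C b" "arr K B D c" "arr K C D d" "c \<cdot> a = d \<cdot> b"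
    and "\<And>Z s t. arr K Z B s \<Longrightarrow> arr K Z C t \<Longrightarrow> c \<cdot> s = d \<cdot> t \<Longrightarrow>
      \<exists>u. arr K Z A u \<and> a \<cdot> u = s \<and> b \<cdot> u = t"
    and mono: "\<And>Z u. arr K Z A u \<Longrightarrow> a \<cdot> u = zero_mor K Z B \<Longrightarrow> b \<cdot> u = zero_mor K Z C
      \<Longrightarrow> u = zero_mor K Z A"
  shows "pullback_square K A B C D a b c d"
proof -
  have "u = v" if uv: "arr K Z A u" "arr K Z A v" "a \<cdot> u = a \<cdot> v" "b \<cdot> u = b \<cdot> v" for Z u v
  proof -
    have "a \<cdot> sub_mor K Z A u v = zero_mor K Z B"  "b \<cdot> sub_mor K Z A u v = zero_mor K Z C"
      using uv assms(1,2) by (simp_all add: arr_iff cat_simps)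
    then show ?thesis using mono[OF arr_sub[OF uv(1,2)]] sub_eq_zero_iff uv by blast
  qed
  note unique = this
  have "\<exists>!u. u \<in> mor K Z A \<and> a \<cdot> u = s \<and> b \<cdot> u = t"
    if st: "arr K Z B s" "arr K Z C t" "c \<cdot> s = d \<cdot> t" for Z s t
  proof -
    obtain u where u: "arr K Z A u" "a \<cdot> u = s" "b \<cdot> u = t" using assms(6)[OF st] by blast
    show ?thesis
    proof (rule ex1I[of _ u])
      fix v assume v: "v \<in> mor K Z A \<and> a \<cdot> v = s \<and> b \<cdot> v = t"
      show "v = u" by (rule unique) (use u v in \<open>auto simp: arr_def\<close>)
    qed (use u in \<open>auto simp: arr_def\<close>)
  qed
  then show ?thesis
    using assms(1-5) unfolding pullback_square_def commutative_square_def arr_def by simp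
qed

lemma pullback_square_arr:
  assumes "pullback_square K A B C D a b c d"
  shows "arr K A B a" "arr K A C b" "arr K B D c" "arr K C D d" "c \<cdot> a = d \<cdot> b"
  using assms by (auto simp: pullback_square_def commutative_square_def arr_def)

lemma pullback_square_ex1:
  assumes p: "pullback_square K A B C D a b c d" and st: "arr K Z B s" "arr K Z C t" "c \<cdot> s = d \<cdot> t"
  shows "\<exists>!u. u \<in> mor K Z A \<and> a \<cdot> u = s \<and> b \<cdot> u = t"
proof -
  have "\<forall>Z \<in> Obj K. \<forall>s \<in> mor K Z B. \<forall>t \<in> mor K Z C. c \<cdot> s = d \<cdot> t \<longrightarrow>
        (\<exists>!u. u \<in> mor K Z A \<and> a \<cdot> u = s \<and> b \<cdot> u = t)"
    using p by (simp add: pullback_square_def)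
  then show ?thesis using st by (simp add: arr_def)
qed

lemma pullback_square_lift:
  assumes p: "pullback_square K A B C D a b c d" and st: "arr K Z B s" "arr K Z C t" "c \<cdot> s = d \<cdot> t"
  shows "\<exists>u. arr K Z A u \<and> a \<cdot> u = s \<and> b \<cdot> u = t"
proof -
  obtain u where "u \<in> mor K Z A" "a \<cdot> u = s" "b \<cdot> u = t" using pullback_square_ex1[OF assms] by (blast dest: ex1_implies_ex)
  then show ?thesis using pullback_square_arr(1)[OF p] st(1) by (intro exI[of _ u]) (simp add: arr_def)
qed

lemma pullback_square_unique:
  assumes p: "pullback_square K A B C D a b c d" and u: "arr K Z A u" "arr K Z A v" "a \<cdot> u = a \<cdot> v" "b \<cdot> u = b \<cdot> v"
  shows "u = v"
proof -
  note a = pullback_square_arr[OF p]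
  have av: "arr K Z B (a \<cdot> v)" "arr K Z C (b \<cdot> v)" using a u(2) arr_Comp by blast+
  have "c \<cdot> (a \<cdot> v) = d \<cdot> (b \<cdot> v)"
    using comp_assoc_arr[OF u(2) a(1,3)] comp_assoc_arr[OF u(2) a(2,4)] a(5) by simp
  then have "\<exists>!w. w \<in> mor K Z A \<and> a \<cdot> w = a \<cdot> v \<and> b \<cdot> w = b \<cdot> v"
    using pullback_square_ex1[OF p av] by simp
  then show ?thesis by (rule ex1E) (use u in \<open>auto simp: arr_def\<close>)
qed

lemma pullback_square_iso:
  assumes p: "pullback_square K A B C D a b c d" and q: "pullback_square K A' B C D a' b' c d"
  obtains \<phi> \<psi> where "arr K A A' \<phi>" "arr K A' A \<psi>" "\<psi> \<cdot> \<phi> = Ident K A" "\<phi> \<cdot> \<psi> = Ident K A'" "a' \<cdot> \<phi> = a"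
proof -
  note a = pullback_square_arr[OF p] and a' = pullback_square_arr[OF q]
  obtain \<phi> where \<phi>: "arr K A A' \<phi>" "a' \<cdot> \<phi> = a" "b' \<cdot> \<phi> = b" using pullback_square_lift[OF q a(1,2,5)] by blast
  obtain \<psi> where \<psi>: "arr K A' A \<psi>" "a \<cdot> \<psi> = a'" "b \<cdot> \<psi> = b'" using pullback_square_lift[OF p a'(1,2,5)] by blast
  have 1: "a \<cdot> (\<psi> \<cdot> \<phi>) = a" "b \<cdot> (\<psi> \<cdot> \<phi>) = b"
    using comp_assoc_arr[OF \<phi>(1) \<psi>(1)] a(1,2) \<phi> \<psi> by metis+
  have "\<psi> \<cdot> \<phi> = Ident K A"
    by (rule pullback_square_unique[OF p arr_Comp[OF \<phi>(1) \<psi>(1)]])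
      (use 1 a(1,2) in \<open>simp_all add: arr_iff cat_simps\<close>)
  moreover have 2: "a' \<cdot> (\<phi> \<cdot> \<psi>) = a'" "b' \<cdot> (\<phi> \<cdot> \<psi>) = b'"
    using comp_assoc_arr[OF \<psi>(1) \<phi>(1)] a'(1,2) \<phi> \<psi> by metis+
  have "\<phi> \<cdot> \<psi> = Ident K A'"
    by (rule pullback_square_unique[OF q arr_Comp[OF \<psi>(1) \<phi>(1)]])
      (use 2 a'(1,2) in \<open>simp_all add: arr_iff cat_simps\<close>)
  ultimately show thesis using \<phi> \<psi> that by metis
qed

lemma pullback_square_iso_corner:
  assumes p: "pullback_square K A B C D a b c d" and \<phi>: "arr K D D' \<phi>" "arr K D' D \<psi>"
    "\<psi> \<cdot> \<phi> = Ident K D"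
  shows "pullback_square K A B C D' a b (\<phi> \<cdot> c) (\<phi> \<cdot> d)"
proof (rule pullback_squareI)
  note a = pullback_square_arr[OF p]
  show "arr K A B a" "arr K A C b" "arr K B D' (\<phi> \<cdot> c)" "arr K C D' (\<phi> \<cdot> d)"
    by (fact a)+ (rule arr_Comp[OF a(3) \<phi>(1)], rule arr_Comp[OF a(4) \<phi>(1)])
  show "(\<phi> \<cdot> c) \<cdot> a = (\<phi> \<cdot> d) \<cdot> b"
    using comp_assoc_arr[OF a(1,3) \<phi>(1)] comp_assoc_arr[OF a(2,4) \<phi>(1)] a(5) by simp
next
  note a = pullback_square_arr[OF p]
  fix Z s t assume st: "arr K Z B s" "arr K Z C t" "(\<phi> \<cdot> c) \<cdot> s = (\<phi> \<cdot> d) \<cdot> t"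
  have "\<psi> \<cdot> ((\<phi> \<cdot> c) \<cdot> s) = ((\<psi> \<cdot> \<phi>) \<cdot> c) \<cdot> s" "\<psi> \<cdot> ((\<phi> \<cdot> d) \<cdot> t) = ((\<psi> \<cdot> \<phi>) \<cdot> d) \<cdot> t"
    using a(3,4) st(1,2) \<phi>(1,2) by (simp_all add: arr_iff cat_simps)
  then have "c \<cdot> s = d \<cdot> t" unfolding st(3) \<phi>(3) using a(3,4) by (simp add: arr_iff cat_simps)
  then show "\<exists>u. arr K Z A u \<and> a \<cdot> u = s \<and> b \<cdot> u = t" using pullback_square_lift[OF p] st by blast
next
  note a = pullback_square_arr[OF p]
  fix Z u assume u: "arr K Z A u" "a \<cdot> u = zero_mor K Z B" "b \<cdot> u = zero_mor K Z C"
  show "u = zero_mor K Z A"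
    by (rule pullback_square_unique[OF p u(1)]) (use u a(1,2) in \<open>simp_all add: arr_iff cat_simps\<close>)
qed

lemma is_cokernel_via_pullback:
  assumes p: "pullback_square K A B C D a b c d" and q: "pullback_square K A' B C D a' b' c d"
    and "is_cokernel K A' B a'"
  shows "is_cokernel K A B a"
proof -
  obtain \<phi> \<psi> where *: "arr K A A' \<phi>" "arr K A' A \<psi>" "\<psi> \<cdot> \<phi> = Ident K A" "\<phi> \<cdot> \<psi> = Ident K A'" "a' \<cdot> \<phi> = a"
    using pullback_square_iso[OF p q] .
  obtain X x where "cokernel_of K X A' B x a'" using assms(3) unfolding is_cokernel_def by blast
  from cokernel_of_iso_Comp[OF this *(1-4)] show ?thesis unfolding *(5) is_cokernel_def by (intro exI)
qed

lemma pushout_squareI: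
  assumes "arr K A B a" "arr K A C b" "arr K B D c" "arr K C D d" "c \<cdot> a = d \<cdot> b"
    and "\<And>Z s t. arr K B Z s \<Longrightarrow> arr K C Z t \<Longrightarrow> s \<cdot> a = t \<cdot> b \<Longrightarrow>
      \<exists>u. arr K D Z u \<and> u \<cdot> c = s \<and> u \<cdot> d = t"
    and epi: "\<And>Z u. arr K D Z u \<Longrightarrow> u \<cdot> c = zero_mor K B Z \<Longrightarrow> u \<cdot> d = zero_mor K C Z
      \<Longrightarrow> u = zero_mor K D Z"
  shows "pushout_square K A B C D a b c d"
proof -
  have "u = v" if uv: "arr K D Z u" "arr K D Z v" "u \<cdot> c = v \<cdot> c" "u \<cdot> d = v \<cdot> d" for Z u v
  proof -
    have "sub_mor K D Z u v \<cdot> c = zero_mor K B Z"  "sub_mor K D Z u v \<cdot> d = zero_mor K C Z"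
      using uv assms(3,4) by (simp_all add: arr_iff cat_simps)
    then show ?thesis using epi[OF arr_sub[OF uv(1,2)]] sub_eq_zero_iff uv by blast
  qed
  note unique = this
  have "\<exists>!u. u \<in> mor K D Z \<and> u \<cdot> c = s \<and> u \<cdot> d = t"
    if st: "arr K B Z s" "arr K C Z t" "s \<cdot> a = t \<cdot> b" for Z s t
  proof -
    obtain u where u: "arr K D Z u" "u \<cdot> c = s" "u \<cdot> d = t" using assms(6)[OF st] by blast
    show ?thesis
    proof (rule ex1I[of _ u])
      fix v assume v: "v \<in> mor K D Z \<and> v \<cdot> c = s \<and> v \<cdot> d = t"
      show "v = u" by (rule unique[where Z = Z]) (use u v in \<open>auto simp: arr_def\<close>)
    qed (use u in \<open>auto simp: arr_def\<close>)
  qed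
  then show ?thesis
    using assms(1-5) unfolding pushout_square_def commutative_square_def arr_def by simp
qed

lemma pushout_square_arr:
  assumes "pushout_square K A B C D a b c d"
  shows "arr K A B a" "arr K A C b" "arr K B D c" "arr K C D d" "c \<cdot> a = d \<cdot> b"
  using assms by (auto simp: pushout_square_def commutative_square_def arr_def)

lemma pushout_square_ext:
  assumes p: "pushout_square K A B C D a b c d" and st: "arr K B Z s" "arr K C Z t" "s \<cdot> a = t \<cdot> b"
  shows "\<exists>u. arr K D Z u \<and> u \<cdot> c = s \<and> u \<cdot> d = t"
proof -
  have "\<forall>Z \<in> Obj K. \<forall>s \<in> mor K B Z. \<forall>t \<in> mor K C Z. s \<cdot> a = t \<cdot> b \<longrightarrow>
        (\<exists>!u. u \<in> mor K D Z \<and> u \<cdot> c = s \<and> u \<cdot> d = t)"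
    using p by (simp add: pushout_square_def)
  then have "\<exists>!u. u \<in> mor K D Z \<and> u \<cdot> c = s \<and> u \<cdot> d = t" using st by (simp add: arr_def)
  then obtain u where "u \<in> mor K D Z" "u \<cdot> c = s" "u \<cdot> d = t" by (blast dest: ex1_implies_ex)
  then show ?thesis using pushout_square_arr(3)[OF p] st(1) by (intro exI[of _ u]) (simp add: arr_def)
qed

end

section \<open>The opposite category\<close>

text \<open>Extra record fields are dropped, which makes \<open>opp\<close> an involution on plain categories.\<close>

definition opp :: "('o, 'm, 'z) cat_scheme \<Rightarrow> ('o, 'm) cat" where
  "opp K = \<lparr> Obj = Obj K, Hom = (\<lambda>A B. Hom K B A), Comp = (\<lambda>g f. Comp K f g), Ident = Ident K \<rparr>"

lemma opp_simps [simp]: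
  "Obj (opp K) = Obj K" "Hom (opp K) A B = Hom K B A" "Comp (opp K) g f = Comp K f g"
  "Ident (opp K) = Ident K"
  by (simp_all add: opp_def)

lemma arr_opp [simp]: "arr (opp K) A B f = arr K B A f"
  by (auto simp: arr_def)

lemma biproduct_opp: "biproduct (opp K) A A' P i i' p p' = biproduct K A A' P p p' i i'"
  by (auto simp: biproduct_def)

lemma kernel_of_opp: "kernel_of (opp K) A B C x y = cokernel_of K C B A y x"
  by (auto simp: kernel_of_def cokernel_of_def)

lemma cokernel_of_opp: "cokernel_of (opp K) A B C x y = kernel_of K C B A y x"
  by (auto simp: kernel_of_def cokernel_of_def)

lemma is_kernel_opp: "is_kernel (opp K) A B x = is_cokernel K B A x"
  by (simp add: is_kernel_def is_cokernel_def kernel_of_opp)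

lemma kernel_cokernel_pair_opp: "kernel_cokernel_pair (opp K) x y = kernel_cokernel_pair K y x"
  unfolding kernel_cokernel_pair_def kernel_of_opp cokernel_of_opp by blast

lemma pushout_square_opp: "pushout_square (opp K) A B C D a b c d = pullback_square K D B C A c d a b"
  by (auto simp: pullback_square_def pushout_square_def commutative_square_def)

lemma pullback_square_sym:
  "pullback_square K A B C D a b c d \<Longrightarrow> pullback_square K A C B D b a d c"
  unfolding pullback_square_def commutative_square_def by metis

lemma (in category) category_opp: "category (opp K)"
  by unfold_locales
    (auto simp: Comp_mor Ident_mor Comp_assoc Ident_left Ident_right dest: mor_disjoint)

lemma (in preadditive_category) preadditive_category_opp: "preadditive_category (opp K)"
  using category_opp unfolding preadditive_category_def preadditive_category_axioms_def
  by (simp add: Hom_comm_group Comp_hom_right Comp_hom_left)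

lemma zero_object_opp: "zero_object (opp K) Z = zero_object K Z"
  by (auto simp: zero_object_def)

lemma (in additive_category) additive_category_opp: "additive_category (opp K)"
proof -
  have "\<exists>P i i' p p'. biproduct (opp K) A A' P i i' p p'" if "A \<in> Obj K" "A' \<in> Obj K" for A A'
    using biproduct_exists[OF that] unfolding biproduct_opp by metis
  then show ?thesis
    using preadditive_category_opp zero_object_exists
    unfolding additive_category_def additive_category_axioms_def zero_object_opp by simp
qed

lemma (in preabelian_category) preabelian_category_opp: "preabelian_category (opp K)"
  using additive_category_opp unfolding preabelian_category_def preabelian_category_axioms_def
  by (auto simp: kernel_of_opp cokernel_of_opp kernel_exists cokernel_exists)

lemma (in left_quasi_abelian_category) right_quasi_abelian_category_opp:
  "right_quasi_abelian_category (opp K)"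
  using preabelian_category_opp
  unfolding right_quasi_abelian_category_def right_quasi_abelian_category_axioms_def
  by (auto simp: is_kernel_opp pushout_square_opp dest: pullback_cokernel[OF pullback_square_sym])

section \<open>The maximal exact structure of a quasi-abelian category\<close>

lemma (in category) biproduct_arr:
  assumes "biproduct K A A' P i i' p p'"
  shows "arr K A P i" "arr K A' P i'" "arr K P A p" "arr K P A' p'"
  using assms by (auto simp: biproduct_def arr_def)

context preabelian_category
begin

text \<open>A pushout of \<open>f\<close> and \<open>g\<close> is a cokernel of \<open>(f, -g) : A \<rightarrow> B \<oplus> C\<close>.\<close>

lemma pushout_exists:
  assumes f: "arr K A B f" and g: "arr K A C g"
  shows "\<exists>D c d. pushout_square K A B C D f g c d"
proof -
  obtain P i i' p p' where P: "biproduct K B C P i i' p p'"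
    using biproduct_exists f g by (auto simp: arr_def) metis
  note a = biproduct_arr[OF P]
  have eqs: "p \<cdot> i = Ident K B" "p' \<cdot> i' = Ident K C" "p \<cdot> i' = zero_mor K C B" "p' \<cdot> i = zero_mor K B C"
    "add_mor K P P (i \<cdot> p) (i' \<cdot> p') = Ident K P"
    using P by (auto simp: biproduct_def)
  have Obj: "A \<in> Obj K" "B \<in> Obj K" "C \<in> Obj K" "P \<in> Obj K" using a f by (auto simp: arr_def)
  define k where "k = sub_mor K A P (i \<cdot> f) (i' \<cdot> g)"
  have k: "arr K A P k" unfolding k_def using a f g by (intro arr_sub arr_Comp)
  obtain D y where y: "cokernel_of K A P D k y"
    using cokernel_exists k by (auto simp: arr_def) metis
  note c = cokernel_of_arr[OF y]
  have "pushout_square K A B C D f g (y \<cdot> i) (y \<cdot> i')"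
  proof (rule pushout_squareI)
    show "arr K A B f" "arr K A C g" "arr K B D (y \<cdot> i)" "arr K C D (y \<cdot> i')"
      using f g a c arr_Comp by blast+
    have "sub_mor K A D (y \<cdot> (i \<cdot> f)) (y \<cdot> (i' \<cdot> g)) = zero_mor K A D"
      using c f g a by (simp add: arr_iff cat_simps k_def)
    then have "y \<cdot> (i \<cdot> f) = y \<cdot> (i' \<cdot> g)"
      using sub_eq_zero_iff arr_Comp c a f g by meson
    then show "(y \<cdot> i) \<cdot> f = (y \<cdot> i') \<cdot> g" using c a f g by (simp add: arr_iff cat_simps)
  next
    fix Z s t assume st: "arr K B Z s" "arr K C Z t" "s \<cdot> f = t \<cdot> g"
    define u where "u = add_mor K P Z (s \<cdot> p) (t \<cdot> p')"
    have u: "arr K P Z u" unfolding u_def using a st by (intro arr_add arr_Comp)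
    have ui: "u \<cdot> i = s" "u \<cdot> i' = t"
      using a st(1,2) eqs(1-4) Obj by (simp_all add: arr_iff cat_simps u_def)
    have "u \<cdot> k = sub_mor K A Z ((u \<cdot> i) \<cdot> f) ((u \<cdot> i') \<cdot> g)"
      unfolding k_def using a f g u by (simp add: arr_iff cat_simps)
    also have "\<dots> = zero_mor K A Z" unfolding ui st(3) using st(2) g by (simp add: arr_iff cat_simps)
    finally obtain v where v: "arr K D Z v" "v \<cdot> y = u" using cokernel_of_ext[OF y u] by blast
    have "v \<cdot> (y \<cdot> i) = (v \<cdot> y) \<cdot> i" "v \<cdot> (y \<cdot> i') = (v \<cdot> y) \<cdot> i'"
      using v(1) c a by (simp_all add: arr_iff cat_simps)
    then show "\<exists>u. arr K D Z u \<and> u \<cdot> (y \<cdot> i) = s \<and> u \<cdot> (y \<cdot> i') = t" using v ui by auto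
  next
    fix Z u assume u: "arr K D Z u" "u \<cdot> (y \<cdot> i) = zero_mor K B Z" "u \<cdot> (y \<cdot> i') = zero_mor K C Z"
    have "u \<cdot> y = (u \<cdot> y) \<cdot> add_mor K P P (i \<cdot> p) (i' \<cdot> p')"
      unfolding eqs(5) using u(1) c by (simp add: arr_iff cat_simps)
    also have "\<dots> = add_mor K P Z ((u \<cdot> (y \<cdot> i)) \<cdot> p) ((u \<cdot> (y \<cdot> i')) \<cdot> p')"
      using u(1) c a by (simp add: arr_iff cat_simps)
    also have "\<dots> = zero_mor K D Z \<cdot> y"
      unfolding u(2,3) using u(1) c a by (simp add: arr_iff cat_simps)
    finally show "u = zero_mor K D Z"
      using cokernel_of_epi[OF y u(1)] arr_zero arr_ObjD u(1) by meson
  qed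
  then show ?thesis by blast
qed

text \<open>If \<open>x\<close> is a kernel of \<open>y'\<close>, then \<open>y'\<close> factors through the cokernel \<open>y\<close>, so that everything
  annihilated by \<open>y\<close> is annihilated by \<open>y'\<close> and lifts to \<open>A\<close>.\<close>

lemma is_kernel_of_cokernel:
  assumes "is_kernel K A B x" "cokernel_of K A B C x y"
  shows "kernel_of K A B C x y"
proof -
  obtain C' y' where k: "kernel_of K A B C' x y'" using assms by (auto simp: is_kernel_def)
  note a = kernel_of_arr[OF k] and c = cokernel_of_arr[OF assms(2)]
  obtain v where v: "arr K C C' v" "v \<cdot> y = y'" using cokernel_of_ext[OF assms(2) a(2,3)] by blast
  show ?thesis
  proof (rule kernel_ofI[OF c])
    fix Z z assume z: "arr K Z B z" "y \<cdot> z = zero_mor K Z C"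
    have "y' \<cdot> z = v \<cdot> (y \<cdot> z)" using v c z(1) by (auto simp: arr_iff cat_simps)
    then have "y' \<cdot> z = zero_mor K Z C'" using v z by (auto simp: arr_iff cat_simps)
    then show "\<exists>u. arr K Z A u \<and> x \<cdot> u = z" using kernel_of_lift[OF k z(1)] by blast
  next
    fix Z u assume u: "arr K Z A u" "x \<cdot> u = zero_mor K Z B"
    show "u = zero_mor K Z A"
      by (rule kernel_of_mono[OF k u(1)]) (use u a in \<open>auto simp: arr_iff cat_simps\<close>)
  qed
qed

lemma is_kernel_iff_pair:
  assumes "arr K A B x"
  shows "(\<exists>y. kernel_cokernel_pair K x y) \<longleftrightarrow> is_kernel K A B x"
proof
  assume "\<exists>y. kernel_cokernel_pair K x y"
  then obtain y A' B' C where k: "kernel_of K A' B' C x y" by (auto simp: kernel_cokernel_pair_def)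
  then have "A' = A" "B' = B" using arr_unique[OF assms kernel_of_arr(1)[OF k]] by auto
  then show "is_kernel K A B x" using k by (auto simp: is_kernel_def)
next
  assume k: "is_kernel K A B x"
  obtain C y where "cokernel_of K A B C x y" using cokernel_exists assms by (auto simp: arr_def) metis
  then show "\<exists>y. kernel_cokernel_pair K x y"
    using is_kernel_of_cokernel[OF k] unfolding kernel_cokernel_pair_def by blast
qed

lemma kernel_cokernel_pair_Ident:
  assumes "A \<in> Obj K"
  shows "\<exists>y. kernel_cokernel_pair K (Ident K A) y"
proof -
  obtain Z where Z: "zero_object K Z" using zero_object_exists by blast
  have ZO: "Z \<in> Obj K" using Z by (auto simp: zero_object_def)
  have "kernel_of K A A Z (Ident K A) (zero_mor K A Z)"
    by (rule kernel_ofI) (use assms ZO in \<open>auto simp: arr_iff cat_simps\<close>)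
  then show ?thesis using is_kernel_iff_pair[OF arr_Ident[OF assms]] by (auto simp: is_kernel_def)
qed

lemma kernel_of_iso:
  assumes k: "kernel_of K A B C x y"
    and a: "arr K A A' a" "arr K A' A a'" "a' \<cdot> a = Ident K A" "a \<cdot> a' = Ident K A'"
    and b: "arr K B B' b" "arr K B' B b'" "b' \<cdot> b = Ident K B" "b \<cdot> b' = Ident K B'"
    and c: "arr K C C' c" "arr K C' C c'" "c' \<cdot> c = Ident K C" "c \<cdot> c' = Ident K C'"
    and x': "arr K A' B' x'" and y': "arr K B' C' y'" and bx: "b \<cdot> x = x' \<cdot> a" and cy: "c \<cdot> y = y' \<cdot> b"
  shows "kernel_of K A' B' C' x' y'"
proof (rule kernel_ofI[OF x' y'])
  note t = kernel_of_arr[OF k]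
  have x'': "x' = b \<cdot> (x \<cdot> a')"
  proof -
    have "b \<cdot> (x \<cdot> a') = (b \<cdot> x) \<cdot> a'" using b(1) t(1) a(2) by (simp add: arr_iff cat_simps)
    then show ?thesis unfolding bx using a x' by (auto simp: arr_iff cat_simps)
  qed
  have y'': "y' \<cdot> b = c \<cdot> y" and y3: "y \<cdot> b' = c' \<cdot> y'"
  proof -
    have "c' \<cdot> y' = c' \<cdot> ((y' \<cdot> b) \<cdot> b')" using b y' c(2) by (simp add: arr_iff cat_simps)
    also have "\<dots> = ((c' \<cdot> c) \<cdot> y) \<cdot> b'" unfolding cy[symmetric] using b c(1,2) t y' by (simp add: arr_iff cat_simps)
    also have "\<dots> = y \<cdot> b'" unfolding c(3) using t(2) by (simp add: arr_iff cat_simps)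
    finally show "y \<cdot> b' = c' \<cdot> y'" ..
  qed (simp add: cy)
  have "y' \<cdot> x' = (y' \<cdot> b) \<cdot> (x \<cdot> a')" unfolding x'' using b(1) y' t(1) a(2) by (simp add: arr_iff cat_simps)
  also have "\<dots> = c \<cdot> ((y \<cdot> x) \<cdot> a')" unfolding y'' using t(1,2) c(1) a(2) by (simp add: arr_iff cat_simps)
  also have "\<dots> = zero_mor K A' C'" unfolding t(3) using t(1,2) c(1) a(2) by (simp add: arr_iff cat_simps)
  finally show "y' \<cdot> x' = zero_mor K A' C'" .
  fix Z z assume z: "arr K Z B' z" "y' \<cdot> z = zero_mor K Z C'"
  have "y \<cdot> (b' \<cdot> z) = (y \<cdot> b') \<cdot> z" using z b t by (simp add: arr_iff cat_simps)
  also have "\<dots> = c' \<cdot> (y' \<cdot> z)" unfolding y3 using z(1) y' c(2) by (simp add: arr_iff cat_simps)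
  also have "\<dots> = zero_mor K Z C" unfolding z(2) using z(1) y' c(2) by (simp add: arr_iff cat_simps)
  finally obtain u where u: "arr K Z A u" "x \<cdot> u = b' \<cdot> z"
    using kernel_of_lift[OF k arr_Comp[OF z(1) b(2)]] by blast
  have "x' \<cdot> (a \<cdot> u) = (x' \<cdot> a) \<cdot> u" using u x' a(1) by (simp add: arr_iff cat_simps)
  also have "\<dots> = b \<cdot> (x \<cdot> u)" unfolding bx[symmetric] using u(1) t(1) b(1) by (simp add: arr_iff cat_simps)
  also have "\<dots> = (b \<cdot> b') \<cdot> z" unfolding u(2) using z b(1,2) by (simp add: arr_iff cat_simps)
  also have "\<dots> = z" unfolding b(4) using z(1) by (simp add: arr_iff cat_simps)
  finally show "\<exists>u. arr K Z A' u \<and> x' \<cdot> u = z" using u a(1) arr_Comp by blast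
next
  note t = kernel_of_arr[OF k]
  fix Z u assume u: "arr K Z A' u" "x' \<cdot> u = zero_mor K Z B'"
  have "x \<cdot> (a' \<cdot> u) = (b' \<cdot> b) \<cdot> (x \<cdot> (a' \<cdot> u))" unfolding b(3) using t a(2) u by (simp add: arr_iff cat_simps)
  also have "\<dots> = b' \<cdot> ((b \<cdot> x) \<cdot> (a' \<cdot> u))" using t a(2) b(1,2) u by (simp add: arr_iff cat_simps)
  also have "\<dots> = b' \<cdot> (x' \<cdot> ((a \<cdot> a') \<cdot> u))" unfolding bx using t a(1,2) b(1,2) u x' by (simp add: arr_iff cat_simps)
  also have "\<dots> = x \<cdot> zero_mor K Z A" unfolding a(4) using t u b(2) by (simp add: arr_iff cat_simps)
  finally have *: "a' \<cdot> u = zero_mor K Z A"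
    using kernel_of_mono[OF k arr_Comp[OF u(1) a(2)]] arr_zero arr_ObjD a u by meson
  have "u = a \<cdot> (a' \<cdot> u)" using comp_assoc_arr[OF u(1) a(2,1)] a(4) u(1) by (simp add: arr_iff cat_simps)
  then show "u = zero_mor K Z A'" unfolding * using a u(1) by (simp add: arr_iff cat_simps)
qed

end

lemma (in preabelian_category) kernel_cokernel_pair_iso:
  assumes p: "kernel_cokernel_pair K x y" and xy: "arr K A B x" "arr K B C y" "arr K A' B' x'" "arr K B' C' y'"
    and iso: "iso_mor K A A' a" "iso_mor K B B' b" "iso_mor K C C' c"
    and comm: "b \<cdot> x = x' \<cdot> a" "c \<cdot> y = y' \<cdot> b"
  shows "kernel_cokernel_pair K x' y'"
proof -
  have "\<exists>A B C. kernel_of K A B C x y \<and> cokernel_of K A B C x y"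
    using p by (auto simp: kernel_cokernel_pair_def)
  then have kc: "kernel_of K A B C x y" "cokernel_of K A B C x y"
    using xy(1,2) kernel_of_arr arr_unique by metis+
  obtain a' where a: "arr K A A' a" "arr K A' A a'" "a' \<cdot> a = Ident K A" "a \<cdot> a' = Ident K A'"
    using iso xy by (auto simp: iso_mor_def arr_def)
  obtain b' where b: "arr K B B' b" "arr K B' B b'" "b' \<cdot> b = Ident K B" "b \<cdot> b' = Ident K B'"
    using iso xy by (auto simp: iso_mor_def arr_def)
  obtain c' where c: "arr K C C' c" "arr K C' C c'" "c' \<cdot> c = Ident K C" "c \<cdot> c' = Ident K C'"
    using iso xy by (auto simp: iso_mor_def arr_def)
  have k: "kernel_of K A' B' C' x' y'"
    using kernel_of_iso[OF kc(1) a b c xy(3,4) comm] .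
  \<comment> \<open>The inverse isomorphisms also form a morphism of sequences, from the primed one; reversing all
    arrows makes it one between the opposite sequences.\<close>
  interpret op: preabelian_category "opp K" by (rule preabelian_category_opp)
  have ba: "x \<cdot> a' = b' \<cdot> x'"
  proof -
    have "b' \<cdot> x' = b' \<cdot> ((x' \<cdot> a) \<cdot> a')" using a xy(3) b(2) by (simp add: arr_iff cat_simps)
    also have "\<dots> = (b' \<cdot> b) \<cdot> (x \<cdot> a')" unfolding comm(1)[symmetric]
      using a(1,2) b(1,2) xy by (simp add: arr_iff cat_simps)
    finally show ?thesis unfolding b(3) using a(2) xy(1) by (simp add: arr_iff cat_simps)
  qed
  have cb: "y \<cdot> b' = c' \<cdot> y'"
  proof -
    have "c' \<cdot> y' = c' \<cdot> ((y' \<cdot> b) \<cdot> b')" using b xy(4) c(2) by (simp add: arr_iff cat_simps)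
    also have "\<dots> = (c' \<cdot> c) \<cdot> (y \<cdot> b')" unfolding comm(2)[symmetric]
      using c(1,2) b(1,2) xy by (simp add: arr_iff cat_simps)
    finally show ?thesis unfolding c(3) using b(2) xy(2) by (simp add: arr_iff cat_simps)
  qed
  have "kernel_of (opp K) C' B' A' y' x'"
    by (rule op.kernel_of_iso[of C B A y x C' c' c B' b' b A' a' a])
      (use kc(2) a b c xy ba cb in \<open>simp_all add: kernel_of_opp\<close>)
  then show ?thesis using k by (auto simp: kernel_of_opp kernel_cokernel_pair_def)
qed

text \<open>If \<open>E\<close> is the pushout of \<open>x'\<close> along the cokernel \<open>y\<close> of \<open>x\<close>, then \<open>D \<rightarrow> E\<close> is a kernel and
  hence a monomorphism, which makes \<open>x' \<cdot> x\<close> a kernel of \<open>C \<rightarrow> E\<close>.\<close>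

lemma (in right_quasi_abelian_category) is_kernel_Comp:
  assumes k: "is_kernel K A B x" and k': "is_kernel K B C x'"
  shows "is_kernel K A C (x' \<cdot> x)"
proof -
  obtain D y where c: "cokernel_of K A B D x y"
    using cokernel_exists k by (auto simp: is_kernel_def kernel_of_def) metis
  obtain F p where c': "cokernel_of K B C F x' p"
    using cokernel_exists k' by (auto simp: is_kernel_def kernel_of_def) metis
  note a = cokernel_of_arr[OF c] and a' = cokernel_of_arr[OF c']
  have kk: "kernel_of K A B D x y" and kk': "kernel_of K B C F x' p"
    using is_kernel_of_cokernel k k' c c' by auto
  obtain E q r where po: "pushout_square K B C D E x' y q r" using pushout_exists[OF a'(1) a(2)] by metis
  note b = pushout_square_arr[OF po]
  obtain G g where r: "kernel_of K D E G r g"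
    using pushout_kernel[OF po k'] by (auto simp: is_kernel_def)
  have "kernel_of K A C E (x' \<cdot> x) q"
  proof (rule kernel_ofI)
    show "arr K A C (x' \<cdot> x)" "arr K C E q" using a(1) a'(1) b(3) arr_Comp by blast+
    have "q \<cdot> (x' \<cdot> x) = (q \<cdot> x') \<cdot> x" using a(1) a'(1) b(3) by (simp add: arr_iff cat_simps)
    also have "\<dots> = r \<cdot> (y \<cdot> x)" unfolding b(5) using a(1,2) b(4) by (simp add: arr_iff cat_simps)
    finally show "q \<cdot> (x' \<cdot> x) = zero_mor K A E" using a b(4) by (simp add: arr_iff cat_simps)
    fix Z z assume z: "arr K Z C z" "q \<cdot> z = zero_mor K Z E"
    have "p \<cdot> x' = zero_mor K D F \<cdot> y" using a a' by (simp add: arr_iff cat_simps)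
    then obtain w where w: "arr K E F w" "w \<cdot> q = p"
      using pushout_square_ext[OF po a'(2) arr_zero] a a' by (meson arr_ObjD)
    have "p \<cdot> z = w \<cdot> (q \<cdot> z)" using w z(1) b(3) by (auto simp: arr_iff cat_simps)
    then have "p \<cdot> z = zero_mor K Z F" using w z by (simp add: arr_iff cat_simps)
    then obtain v where v: "arr K Z B v" "x' \<cdot> v = z" using kernel_of_lift[OF kk' z(1)] by blast
    have "r \<cdot> (y \<cdot> v) = (q \<cdot> x') \<cdot> v" unfolding b(5) using a(2) b(4) v(1) by (simp add: arr_iff cat_simps)
    also have "\<dots> = q \<cdot> z" using v a' b(3) by (auto simp: arr_iff cat_simps)
    also have "\<dots> = r \<cdot> zero_mor K Z D" using z b(4) by (simp add: arr_iff cat_simps)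
    finally have "y \<cdot> v = zero_mor K Z D"
      using kernel_of_mono[OF r arr_Comp[OF v(1) a(2)]] arr_zero v a by (meson arr_ObjD)
    then obtain u where u: "arr K Z A u" "x \<cdot> u = v" using kernel_of_lift[OF kk v(1)] by blast
    have "(x' \<cdot> x) \<cdot> u = z" using u v a(1) a'(1) by (auto simp: arr_iff cat_simps)
    then show "\<exists>u. arr K Z A u \<and> (x' \<cdot> x) \<cdot> u = z" using u by blast
  next
    fix Z u assume u: "arr K Z A u" "(x' \<cdot> x) \<cdot> u = zero_mor K Z C"
    have "x' \<cdot> (x \<cdot> u) = x' \<cdot> zero_mor K Z B" using u a(1) a'(1) by (simp add: arr_iff cat_simps)
    then have "x \<cdot> u = zero_mor K Z B"
      using kernel_of_mono[OF kk' arr_Comp[OF u(1) a(1)]] arr_zero u a by (meson arr_ObjD)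
    also have "\<dots> = x \<cdot> zero_mor K Z A" using u a by (simp add: arr_iff cat_simps)
    finally show "u = zero_mor K Z A"
      using kernel_of_mono[OF kk u(1)] arr_zero u a by (meson arr_ObjD)
  qed
  then show ?thesis by (auto simp: is_kernel_def)
qed

lemma (in right_quasi_abelian_category) kernels_Comp_pushout:
  shows "\<lbrakk> arr K A B x; arr K B C x';
         \<exists>y. kernel_cokernel_pair K x y; \<exists>y. kernel_cokernel_pair K x' y \<rbrakk>
         \<Longrightarrow> \<exists>y. kernel_cokernel_pair K (x' \<cdot> x) y"
    and "\<lbrakk> arr K A B x; arr K A C f; \<exists>y. kernel_cokernel_pair K x y \<rbrakk>
        \<Longrightarrow> \<exists>D f' x'. pushout_square K A B C D x f f' x' \<and> (\<exists>y. kernel_cokernel_pair K x' y)"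
proof -
  show "\<exists>y. kernel_cokernel_pair K (x' \<cdot> x) y" if "arr K A B x" "arr K B C x'"
         "\<exists>y. kernel_cokernel_pair K x y" "\<exists>y. kernel_cokernel_pair K x' y"
    using that is_kernel_Comp is_kernel_iff_pair arr_Comp by metis
  assume *: "arr K A B x" "arr K A C f" "\<exists>y. kernel_cokernel_pair K x y"
  then obtain D f' x' where po: "pushout_square K A B C D x f f' x'" using pushout_exists by metis
  then have "is_kernel K C D x'" using pushout_kernel is_kernel_iff_pair * by metis
  then have "\<exists>y. kernel_cokernel_pair K x' y"
    using is_kernel_iff_pair pushout_square_arr[OF po] by metis
  then show "\<exists>D f' x'. pushout_square K A B C D x f f' x' \<and> (\<exists>y. kernel_cokernel_pair K x' y)"
    using po by blast
qed

text \<open>Kernels and cokernels determine each other, so the first components of the pairs are exactly the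
  kernels. The axioms for cokernels are those for kernels in the opposite category.\<close>

theorem (in quasi_abelian_category) exact_structure_kernel_cokernel_pairs:
  "exact_structure K {(x, y). kernel_cokernel_pair K x y}"
proof -
  interpret op: right_quasi_abelian_category "opp K" by (rule right_quasi_abelian_category_opp)
  show ?thesis
  proof (unfold_locales, goal_cases)
    case 1 then show ?case by simp
  next
    case (2 x y A B C A' B' C' x' y' a b c)
    then show ?case using kernel_cokernel_pair_iso[of x y A B C A' B' x' C' y' a b c] by (simp add: arr_def)
  next
    case 3 then show ?case using kernel_cokernel_pair_Ident by simp
  next
    case (4 A) then show ?case
      using op.kernel_cokernel_pair_Ident[of A] by (simp add: kernel_cokernel_pair_opp)
  next
    case (5 A B C x x') then show ?case
      using kernels_Comp_pushout(1)[of A B x C x'] by (simp add: arr_def)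
  next
    case (6 A B C y y') then show ?case
      using op.kernels_Comp_pushout(1)[of C B y' A y] by (simp add: arr_def kernel_cokernel_pair_opp)
  next
    case (7 A B C x f) then show ?case
      using kernels_Comp_pushout(2)[of A B x C f] by (simp add: arr_def)
  next
    case (8 B C D f y)
    then obtain A f' y' where "pushout_square (opp K) D C B A y f f' y'" "\<exists>z. kernel_cokernel_pair (opp K) y' z"
      using op.kernels_Comp_pushout(2)[of D C y B f] by (auto simp: arr_def kernel_cokernel_pair_opp)
    moreover have "pullback_square K A B C D y' f' f y"
      using calculation(1) unfolding pushout_square_opp
      unfolding pullback_square_def commutative_square_def by metis
    ultimately show ?case by (auto simp: kernel_cokernel_pair_opp)
  qed
qed

section \<open>The opposite of an extriangulated category\<close>

text \<open>An \<open>\<E>\<close>-triangle becomes one of the opposite category when read backwards. This exchanges push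
  and pull, and each of (ET3) and (ET4) with its dual.\<close>

definition eopp :: "('o, 'm, 'e, 'z) ext_cat_scheme \<Rightarrow> ('o, 'm, 'e) ext_cat" where
  "eopp K = \<lparr> Obj = Obj K, Hom = (\<lambda>A B. Hom K B A), Comp = (\<lambda>g f. Comp K f g), Ident = Ident K,
     Ext = (\<lambda>C A. Ext K A C), ExtMap = (\<lambda>c a. ExtMap K a c),
     Real = (\<lambda>C A \<delta>. (\<lambda>(B, x, y). (B, y, x)) ` Real K A C \<delta>) \<rparr>"

lemma eopp_simps [simp]:
  "Obj (eopp K) = Obj K" "Hom (eopp K) A B = Hom K B A" "Comp (eopp K) g f = Comp K f g"
  "Ident (eopp K) = Ident K" "Ext (eopp K) C A = Ext K A C" "ExtMap (eopp K) c a = ExtMap K a c"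
  "(B, x, y) \<in> Real (eopp K) C A \<delta> \<longleftrightarrow> (B, y, x) \<in> Real K A C \<delta>"
  by (force simp add: eopp_def)+

lemma arr_eopp [simp]: "arr (eopp K) A B f = arr K B A f"
  by (auto simp: arr_def)

lemma push_eopp [simp]: "push (eopp K) C a = pull K C a"
  by (simp add: push_def pull_def)

lemma pull_eopp [simp]: "pull (eopp K) A c = push K A c"
  by (simp add: push_def pull_def)

lemma biproduct_eopp: "biproduct (eopp K) A A' P i i' p p' = biproduct K A A' P p p' i i'"
  by (auto simp: biproduct_def)

lemma iso_mor_eopp: "iso_mor (eopp K) A B f = iso_mor K B A f"
  by (auto simp: iso_mor_def)

lemma E_triangle_eopp [simp]: "E_triangle (eopp K) A x B y C = E_triangle K C y B x A"
  by (rule ext) (auto simp: E_triangle_def)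

lemma additive_category_eopp:
  assumes "additive_category K" shows "additive_category (eopp K)"
proof -
  have "additive_category (opp K)" using assms by (rule additive_category.additive_category_opp)
  then show ?thesis
    unfolding additive_category_def additive_category_axioms_def preadditive_category_def
      preadditive_category_axioms_def category_def zero_object_def biproduct_def opp_simps eopp_simps .
qed

lemma (in preadditive_category) biproduct_swap:
  assumes "biproduct K A A' P i i' p p'"
  shows "biproduct K A' A P i' i p' p"
proof -
  note a = biproduct_arr[OF assms]
  have "add_mor K P P (i' \<cdot> p') (i \<cdot> p) = add_mor K P P (i \<cdot> p) (i' \<cdot> p')"
    by (rule add_commute) (use a arr_Comp in blast)+
  then show ?thesis using assms by (simp add: biproduct_def)
qed

context additive_bifunctor
begin

lemma additive_bifunctor_eopp: "additive_bifunctor (eopp K)"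
proof -
  have "additive_category (eopp K)" using additive_category_eopp additive_category_axioms .
  then show ?thesis
    unfolding additive_bifunctor_def additive_bifunctor_axioms_def eopp_simps
    by (auto simp: Ext_comm_group ExtMap_Ident ExtMap_add_right ExtMap_add_left ExtMap_Comp
        intro: ExtMap_hom)
qed

lemma ExtMap_closed:
  "\<lbrakk> arr K A A' a; arr K C' C c; \<delta> \<in> carrier (Ext K C A) \<rbrakk> \<Longrightarrow> ExtMap K c a \<delta> \<in> carrier (Ext K C' A')"
  using ExtMap_hom[of A A' C C' c a] by (auto simp: arr_def hom_def)

lemma push_closed:
  "\<lbrakk> arr K A A' a; C \<in> Obj K; \<delta> \<in> carrier (Ext K C A) \<rbrakk> \<Longrightarrow> push K C a \<delta> \<in> carrier (Ext K C A')"
  unfolding push_def using ExtMap_closed arr_Ident by blast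

lemma pull_closed:
  "\<lbrakk> arr K C' C c; A \<in> Obj K; \<delta> \<in> carrier (Ext K C A) \<rbrakk> \<Longrightarrow> pull K A c \<delta> \<in> carrier (Ext K C' A)"
  unfolding pull_def using ExtMap_closed arr_Ident by blast

lemma push_Comp:
  assumes "arr K A A' a" "arr K A' A'' a'" "C \<in> Obj K" "\<delta> \<in> carrier (Ext K C A)"
  shows "push K C (a' \<cdot> a) \<delta> = push K C a' (push K C a \<delta>)"
  using ExtMap_Comp[of A A' A'' C C C a a' "Ident K C" "Ident K C" \<delta>] assms arr_Ident[of C]
  by (simp add: push_def arr_def Ident_left)

lemma pull_Comp:
  assumes "arr K C' C c" "arr K C'' C' c'" "A \<in> Obj K" "\<delta> \<in> carrier (Ext K C A)"
  shows "pull K A (c \<cdot> c') \<delta> = pull K A c' (pull K A c \<delta>)"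
  using ExtMap_Comp[of A A A C C' C'' "Ident K A" "Ident K A" c c' \<delta>] assms arr_Ident[of A]
  by (simp add: pull_def arr_def Ident_left)

lemma push_pull:
  assumes "arr K A A' a" "arr K C' C c" "\<delta> \<in> carrier (Ext K C A)"
  shows "push K C' a (pull K A c \<delta>) = pull K A' c (push K C a \<delta>)"
proof -
  have "push K C' a (pull K A c \<delta>) = ExtMap K c a \<delta>"
    using ExtMap_Comp[of A A A' C C' C' "Ident K A" a c "Ident K C'" \<delta>] assms
      arr_Ident[of C'] arr_Ident[of A]
    by (simp add: pull_def push_def arr_def Ident_left Ident_right)
  also have "\<dots> = pull K A' c (push K C a \<delta>)"
    using ExtMap_Comp[of A A' A' C C C' a "Ident K A'" "Ident K C" c \<delta>] assms
      arr_Ident[of C] arr_Ident[of A']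
    by (simp add: pull_def push_def arr_def Ident_left Ident_right)
  finally show ?thesis .
qed

lemma push_Ident: "A \<in> Obj K \<Longrightarrow> C \<in> Obj K \<Longrightarrow> \<delta> \<in> carrier (Ext K C A) \<Longrightarrow> push K C (Ident K A) \<delta> = \<delta>"
  by (simp add: push_def ExtMap_Ident)

lemma pull_Ident: "A \<in> Obj K \<Longrightarrow> C \<in> Obj K \<Longrightarrow> \<delta> \<in> carrier (Ext K C A) \<Longrightarrow> pull K A (Ident K C) \<delta> = \<delta>"
  by (simp add: pull_def ExtMap_Ident)

lemma push_one:
  assumes "arr K A A' a" "C \<in> Obj K"
  shows "push K C a \<one>\<^bsub>Ext K C A\<^esub> = \<one>\<^bsub>Ext K C A'\<^esub>"
proof -
  have "push K C a \<in> hom (Ext K C A) (Ext K C A')"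
    unfolding push_def using ExtMap_hom assms arr_Ident[of C] by (auto simp: arr_def)
  then show ?thesis using Ext_comm_group[of A C] Ext_comm_group[of A' C] assms
    by (auto simp: arr_def comm_group_def dest: hom_one)
qed

lemma pull_one:
  assumes "arr K C' C c" "A \<in> Obj K"
  shows "pull K A c \<one>\<^bsub>Ext K C A\<^esub> = \<one>\<^bsub>Ext K C' A\<^esub>"
  using additive_bifunctor.push_one[OF additive_bifunctor_eopp, of C C' c A] assms by simp

lemma push_add:
  assumes "arr K A A' a" "arr K A A' b" "C \<in> Obj K" "\<delta> \<in> carrier (Ext K C A)"
  shows "push K C (add_mor K A A' a b) \<delta> = push K C a \<delta> \<otimes>\<^bsub>Ext K C A'\<^esub> push K C b \<delta>"
  unfolding push_def using ExtMap_add_right assms arr_Ident[of C] by (auto simp: arr_def)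

lemma push_zero:
  assumes "A' \<in> Obj K" "A \<in> Obj K" "C \<in> Obj K" "\<delta> \<in> carrier (Ext K C A)"
  shows "push K C (zero_mor K A A') \<delta> = \<one>\<^bsub>Ext K C A'\<^esub>"
proof -
  interpret E: comm_group "Ext K C A'" using assms Ext_comm_group by blast
  have z: "arr K A A' (zero_mor K A A')" using assms arr_zero by blast
  let ?e = "push K C (zero_mor K A A') \<delta>"
  have "?e \<in> carrier (Ext K C A')" using z assms push_closed by blast
  moreover have "?e = ?e \<otimes>\<^bsub>Ext K C A'\<^esub> ?e"
    using push_add[OF z z assms(3,4)] add_simps(1)[OF z] by simp
  ultimately show ?thesis by (simp add: E.l_cancel_one')
qed

lemma pull_zero:
  assumes "C' \<in> Obj K" "A \<in> Obj K" "C \<in> Obj K" "\<delta> \<in> carrier (Ext K C A)"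
  shows "pull K A (zero_mor K C' C) \<delta> = \<one>\<^bsub>Ext K C' A\<^esub>"
  using additive_bifunctor.push_zero[OF additive_bifunctor_eopp, of C' C A \<delta>] assms by simp

lemma push_sub_eq_one:
  assumes "arr K A A' a" "arr K A A' b" "C \<in> Obj K" "\<delta> \<in> carrier (Ext K C A)"
    and eq: "push K C a \<delta> = push K C b \<delta>"
  shows "push K C (sub_mor K A A' a b) \<delta> = \<one>\<^bsub>Ext K C A'\<^esub>"
proof -
  have n: "arr K A A' (neg_mor K A A' b)" using assms arr_neg by blast
  have "push K C (sub_mor K A A' a b) \<delta> = push K C (sub_mor K A A' b b) \<delta>"
    using push_add[OF _ n] assms by simp
  also have "\<dots> = \<one>\<^bsub>Ext K C A'\<^esub>"
    using assms push_zero add_simps(3)[OF assms(2)] by (simp add: arr_def)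
  finally show ?thesis .
qed

end

lemma E_triangleD:
  assumes "E_triangle K A x B y C \<delta>"
  shows "arr K A B x" "arr K B C y" "\<delta> \<in> carrier (Ext K C A)" "A \<in> Obj K" "B \<in> Obj K" "C \<in> Obj K"
  using assms by (auto simp: E_triangle_def arr_def)

lemma (in category) seq_equiv_sym:
  assumes "A \<in> Obj K" "C \<in> Obj K" and st: "(s, t) \<in> seq_equiv K A C"
  shows "(t, s) \<in> seq_equiv K A C"
proof -
  obtain B x y B' x' y' b where s: "s = (B, x, y)" "t = (B', x', y')" "(B, x, y) \<in> seqs K A C" "(B', x', y') \<in> seqs K A C"
    and b: "iso_mor K B B' b" "b \<cdot> x = x'" "y' \<cdot> b = y"
    using st by (auto simp: seq_equiv_def)
  then obtain c where c: "arr K B B' b" "arr K B' B c" "c \<cdot> b = Ident K B" "b \<cdot> c = Ident K B'"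
    by (auto simp: iso_mor_def seqs_def arr_def)
  have x: "arr K A B x" "arr K B' C y'" using s assms by (auto simp: seqs_def arr_def)
  have "c \<cdot> x' = x" using comp_assoc_arr[OF x(1) c(1,2)] b c x by (simp add: arr_iff cat_simps)
  moreover have "y \<cdot> c = y'" using comp_assoc_arr[OF c(2,1) x(2)] b c x by (simp add: arr_iff cat_simps)
  ultimately show ?thesis using s iso_morI[OF c(2,1,4,3)] by (auto simp: seq_equiv_def)
qed

lemma seqs_eopp: "(B, x, y) \<in> seqs (eopp K) C A \<longleftrightarrow> (B, y, x) \<in> seqs K A C"
  by (auto simp: seqs_def)

text \<open>The two sequences also trade places, since an isomorphism between their middle terms is reversed.\<close>

lemma seq_equiv_eopp:
  "((B, x, y), (B', x', y')) \<in> seq_equiv (eopp K) C A \<longleftrightarrow> ((B', y', x'), (B, y, x)) \<in> seq_equiv K A C"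
  unfolding seq_equiv_def by (auto simp: seqs_eopp iso_mor_eopp)

lemma (in additive_realization) additive_realization_eopp: "additive_realization (eopp K)"
proof -
  interpret op: additive_bifunctor "eopp K" by (rule additive_bifunctor_eopp)
  show ?thesis
  proof (unfold_locales, goal_cases)
    case (1 A C \<delta>)
    then have "Real K A C \<delta> \<in> seqs K C A // seq_equiv K C A" using Real_class by simp
    then obtain B x y where s: "(B, x, y) \<in> seqs K C A" "Real K A C \<delta> = seq_equiv K C A `` {(B, x, y)}"
      by (auto elim!: quotientE)
    have "t \<in> Real (eopp K) C A \<delta> \<longleftrightarrow> t \<in> seq_equiv (eopp K) A C `` {(B, y, x)}" for t
    proof -
      obtain B' y' x' where t: "t = (B', y', x')" by (cases t)
      have "t \<in> Real (eopp K) C A \<delta> \<longleftrightarrow> ((B, x, y), (B', x', y')) \<in> seq_equiv K C A"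
        unfolding t eopp_simps s by simp
      also have "\<dots> \<longleftrightarrow> ((B', x', y'), (B, x, y)) \<in> seq_equiv K C A"
        using seq_equiv_sym 1 by auto
      finally show ?thesis unfolding t by (simp add: seq_equiv_eopp)
    qed
    then have "Real (eopp K) C A \<delta> = seq_equiv (eopp K) A C `` {(B, y, x)}" by blast
    moreover have "(B, y, x) \<in> seqs (eopp K) A C" using s(1) by (simp add: seqs_eopp)
    ultimately show ?case by (simp add: quotientI)
  next
    case (2 A x B y C \<delta> A' x' B' y' C' \<delta>' a c)
    then show ?case using Real_mor[of C' y' B' x' A' \<delta>' C y B x A \<delta> c a] by auto
  next
    case (3 A C P i i' p p')
    then show ?case using Real_zero[OF biproduct_swap] by (simp add: biproduct_eopp)
  next
    case (4 A x B y C \<delta> A' x' B' y' C' \<delta>' P i i' p p' Q j j' q q' R k k' r r')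
    then have t: "E_triangle K C y B x A \<delta>" "E_triangle K C' y' B' x' A' \<delta>'"
      and b: "biproduct K A A' P p p' i i'" "biproduct K B B' Q q q' j j'" "biproduct K C C' R r r' k k'"
      by (simp_all add: biproduct_eopp)
    note a = biproduct_arr[OF b(1)] biproduct_arr[OF b(2)] biproduct_arr[OF b(3)] E_triangleD[OF t(1)] E_triangleD[OF t(2)]
    have "dsum_mor (eopp K) P p p' Q j j' x x' = dsum_mor K Q j j' P p p' x x'"
      "dsum_mor (eopp K) Q q q' R k k' y y' = dsum_mor K R k k' Q q q' y y'"
      using a by (simp_all add: dsum_mor_def arr_iff cat_simps)
    moreover have "dsum_ext (eopp K) R r r' P i i' \<delta> \<delta>' = dsum_ext K P i i' R r r' \<delta> \<delta>'"
      by (simp add: dsum_ext_def)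
    ultimately show ?case using Real_dsum[OF t b(3,2,1)] by simp
  qed
qed

lemma (in extriangulated_category) extriangulated_category_eopp: "extriangulated_category (eopp K)"
proof -
  interpret op: additive_realization "eopp K" by (rule additive_realization_eopp)
  show ?thesis
  proof (unfold_locales, goal_cases)
    case (1 A x B y C \<delta> A' x' B' y' C' \<delta>' a b)
    then have "\<exists>c \<in> mor K C' C. b \<cdot> y' = y \<cdot> c \<and> push K A' c \<delta>' = pull K C a \<delta>"
      using ET3_op[of C' y' B' x' A' \<delta>' C y B x A \<delta> b a] by auto
    then show ?case by auto
  next
    case (2 A x B y C \<delta> A' x' B' y' C' \<delta>' b c)
    then have "\<exists>a \<in> mor K A' A. a \<cdot> x' = x \<cdot> b \<and> push K A' c \<delta>' = pull K C a \<delta>"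
      using ET3[of C' y' B' x' A' \<delta>' C y B x A \<delta> c b] by auto
    then have "\<exists>a \<in> mor K A' A. x \<cdot> b = a \<cdot> x' \<and> pull K C a \<delta> = push K A' c \<delta>'" by metis
    then show ?case by simp
  next
    case (3 A f B f' D \<delta> g C g' F \<delta>')
    then show ?case using ET4_op[of D f' B f A \<delta> F g' C g \<delta>'] by simp
  next
    case (4 D f' B f A \<delta> F g' C g \<delta>')
    then show ?case using ET4[of A f B f' D \<delta> g C g' F \<delta>'] by simp
  qed
qed

section \<open>Exact sequences of an \<open>\<E>\<close>-triangle\<close>

context extriangulated_category
begin

lemma realization_exists:
  assumes "A \<in> Obj K" "C \<in> Obj K" "\<delta> \<in> carrier (Ext K C A)"
  shows "\<exists>B x y. E_triangle K A x B y C \<delta>"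
proof -
  obtain B x y where s: "(B, x, y) \<in> seqs K A C" "Real K C A \<delta> = seq_equiv K A C `` {(B, x, y)}"
    using Real_class[OF assms] by (auto elim!: quotientE)
  moreover have "((B, x, y), (B, x, y)) \<in> seq_equiv K A C"
    using s(1) assms(1,2) Ident_left[of A B x] Ident_right[of B C y] Ident_left[of B B] Ident_mor[of B]
    by (auto simp: seq_equiv_def seqs_def iso_mor_def intro!: exI[of _ "Ident K B"])
  ultimately show ?thesis using s assms by (auto simp: E_triangle_def seqs_def)
qed

lemma biproduct_zero:
  assumes "zero_object K Z" "A \<in> Obj K"
  shows "biproduct K A Z A (Ident K A) (zero_mor K Z A) (Ident K A) (zero_mor K A Z)"
proof -
  have Z: "Z \<in> Obj K" using assms by (auto simp: zero_object_def)
  then have "Ident K Z = zero_mor K Z Z" using assms Ident_mor[of Z] by (auto simp: zero_object_def)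
  then show ?thesis
    using Z assms(2) arr_zero[of Z A, unfolded arr_def] arr_zero[of A Z, unfolded arr_def] Ident_mor[of A]
    by (simp add: biproduct_def arr_iff cat_simps)
qed

lemma E_triangle_Ident_zero:
  assumes "zero_object K Z" "A \<in> Obj K"
  shows "E_triangle K A (Ident K A) A (zero_mor K A Z) Z \<one>\<^bsub>Ext K Z A\<^esub>"
  using Real_zero[OF biproduct_zero[OF assms]] .

lemma E_triangle_zero_Ident:
  assumes "zero_object K Z" "A \<in> Obj K"
  shows "E_triangle K Z (zero_mor K Z A) A (Ident K A) A \<one>\<^bsub>Ext K A Z\<^esub>"
  using Real_zero[OF biproduct_swap[OF biproduct_zero[OF assms]]] .

text \<open>The morphism \<open>(1, x)\<close> from \<open>A \<rightarrow> A \<rightarrow> 0\<close> to \<open>A \<rightarrow> B \<rightarrow> C\<close> extends to the third terms, so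
  \<open>y \<cdot> x\<close> factors through a zero object.\<close>

lemma E_triangle_Comp_zero:
  assumes "E_triangle K A x B y C \<delta>"
  shows "y \<cdot> x = zero_mor K A C"
proof -
  note t = E_triangleD[OF assms]
  obtain Z where Z: "zero_object K Z" using zero_object_exists by blast
  then have ZO: "Z \<in> Obj K" by (auto simp: zero_object_def)
  obtain c where c: "c \<in> mor K Z C" "c \<cdot> zero_mor K A Z = y \<cdot> x"
    using ET3[OF E_triangle_Ident_zero[OF Z t(4)] assms, of "Ident K A" x] t arr_Ident[of A]
    by (auto simp: arr_def)
  then have "arr K Z C c" using ZO t by (auto simp: arr_def)
  then show ?thesis using c(2) t(4) by (simp add: arr_iff cat_simps)
qed

text \<open>Compare \<open>\<delta>\<close> with the split triangle \<open>X \<rightarrow> X \<rightarrow> 0\<close>: its extension group is trivial.\<close>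

lemma extends_iff_push_one:
  assumes t: "E_triangle K A x B y C \<delta>" and a: "arr K A X a"
  shows "(\<exists>b. arr K B X b \<and> b \<cdot> x = a) \<longleftrightarrow> push K C a \<delta> = \<one>\<^bsub>Ext K C X\<^esub>"
proof -
  note d = E_triangleD[OF t]
  obtain Z where Z: "zero_object K Z" using zero_object_exists by blast
  have Obj: "Z \<in> Obj K" "X \<in> Obj K" using Z a by (auto simp: zero_object_def arr_def)
  note i = E_triangle_Ident_zero[OF Z Obj(2)]
  show ?thesis
  proof
    assume "\<exists>b. arr K B X b \<and> b \<cdot> x = a"
    then obtain b where b: "arr K B X b" "b \<cdot> x = a" by blast
    obtain c where "c \<in> mor K C Z" "push K C a \<delta> = pull K X c \<one>\<^bsub>Ext K Z X\<^esub>"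
      using ET3[OF t i, of a b] a b d by (auto simp: arr_def Ident_left)
    then show "push K C a \<delta> = \<one>\<^bsub>Ext K C X\<^esub>" using pull_one[of C Z c X] Obj d by (auto simp: arr_def)
  next
    assume p: "push K C a \<delta> = \<one>\<^bsub>Ext K C X\<^esub>"
    have z: "arr K C Z (zero_mor K C Z)" using arr_zero d Obj by blast
    obtain b where "b \<in> mor K B X" "b \<cdot> x = Ident K X \<cdot> a"
      using Real_mor[OF t i, of a "zero_mor K C Z"] a z p pull_one[OF z Obj(2)] by (auto simp: arr_def)
    then show "\<exists>b. arr K B X b \<and> b \<cdot> x = a" using a d by (auto simp: arr_def Ident_left)
  qed
qed

text \<open>Compare with the triangle \<open>0 \<rightarrow> X \<rightarrow> X\<close>: (ET3) completes \<open>A \<rightarrow> 0\<close> and \<open>b\<close> to a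
  morphism of triangles.\<close>

lemma factors_through_deflation:
  assumes t: "E_triangle K A x B y C \<delta>" and b: "arr K B X b" "b \<cdot> x = zero_mor K A X"
  shows "\<exists>c. arr K C X c \<and> c \<cdot> y = b"
proof -
  note d = E_triangleD[OF t]
  obtain Z where Z: "zero_object K Z" using zero_object_exists by blast
  have Obj: "Z \<in> Obj K" "X \<in> Obj K" using Z b by (auto simp: zero_object_def arr_def)
  have z: "arr K A Z (zero_mor K A Z)" "arr K Z X (zero_mor K Z X)" using arr_zero d Obj by blast+
  have "zero_mor K Z X \<cdot> zero_mor K A Z = zero_mor K A X"
    using z d(4) Obj by (simp add: arr_iff cat_simps)
  then obtain c where "c \<in> mor K C X" "c \<cdot> y = Ident K X \<cdot> b"
    using ET3[OF t E_triangle_zero_Ident[OF Z Obj(2)], of "zero_mor K A Z" b] b z by (auto simp: arr_def)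
  then show ?thesis using b d Obj by (auto simp: arr_def Ident_left)
qed

text \<open>Exactness of \<open>\<E>(C, X) \<rightarrow> \<E>(B, X) \<rightarrow> \<E>(A, X)\<close>: if \<open>X \<rightarrow> Q \<rightarrow> B\<close> realizes \<open>\<epsilon>\<close>, the
  octahedral axiom provides \<open>E \<rightarrow> Q \<rightarrow> C\<close> where \<open>X \<rightarrow> E \<rightarrow> A\<close> realizes the pullback of \<open>\<epsilon>\<close>. When
  the latter splits, a retraction \<open>E \<rightarrow> X\<close> carries the extension of \<open>C\<close> by \<open>E\<close> to one by \<open>X\<close>.\<close>

lemma pull_exact:
  assumes t: "E_triangle K A x B y C \<delta>" and X: "X \<in> Obj K" and e: "\<epsilon> \<in> carrier (Ext K B X)"
    and z: "pull K X x \<epsilon> = \<one>\<^bsub>Ext K A X\<^esub>"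
  shows "\<exists>\<epsilon>' \<in> carrier (Ext K C X). pull K X y \<epsilon>' = \<epsilon>"
proof -
  note d = E_triangleD[OF t]
  obtain Q u v where u: "E_triangle K X u Q v B \<epsilon>" using realization_exists[OF X d(5) e] by blast
  obtain E p k h \<delta>' where E: "E_triangle K E h Q (y \<cdot> v) C \<delta>'" "E_triangle K X k E p A (pull K X x \<epsilon>)"
    "pull K E y \<delta>' = push K B k \<epsilon>"
    using ET4_op[OF t u] by blast
  note a = E_triangleD[OF E(1)] E_triangleD[OF E(2)]
  have "push K A (Ident K X) (pull K X x \<epsilon>) = \<one>\<^bsub>Ext K A X\<^esub>"
    unfolding z using push_one arr_Ident X d by blast
  then obtain r where r: "arr K E X r" "r \<cdot> k = Ident K X"
    using extends_iff_push_one[OF E(2) arr_Ident[OF X]] by blast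
  have "pull K X y (push K C r \<delta>') = push K B r (pull K E y \<delta>')"
    using push_pull[OF r(1) d(2) a(3)] by simp
  also have "\<dots> = push K B (r \<cdot> k) \<epsilon>" unfolding E(3) using push_Comp[OF a(7) r(1) d(5) e] by simp
  also have "\<dots> = \<epsilon>" unfolding r(2) using push_Ident X d e by blast
  finally show ?thesis using push_closed[OF r(1) d(6) a(3)] by blast
qed

lemma lifts_iff_pull_one:
  assumes "E_triangle K A x B y C \<delta>" "arr K X C c"
  shows "(\<exists>b. arr K X B b \<and> y \<cdot> b = c) \<longleftrightarrow> pull K A c \<delta> = \<one>\<^bsub>Ext K X A\<^esub>"
  using extriangulated_category.extends_iff_push_one[OF extriangulated_category_eopp, of C y B x A \<delta> X c] assms by simp

lemma factors_through_inflation: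
  assumes "E_triangle K A x B y C \<delta>" "arr K X B b" "y \<cdot> b = zero_mor K X C"
  shows "\<exists>a. arr K X A a \<and> x \<cdot> a = b"
  using extriangulated_category.factors_through_deflation[OF extriangulated_category_eopp, of C y B x A \<delta> X b] assms by simp

text \<open>Triviality of the extension yields a retraction \<open>r\<close> of \<open>x\<close> and a section \<open>u\<close> of \<open>y\<close>. The
  complementary idempotent \<open>1 - x \<cdot> r\<close> annihilates \<open>x\<close>, hence is of the form \<open>s \<cdot> y\<close>; this \<open>s\<close>
  is the injection with \<open>r \<cdot> s = 0\<close>, as one sees after cancelling \<open>y\<close> on the right by means of \<open>u\<close>.\<close>

lemma split_triangle_biproduct:
  assumes t: "E_triangle K A x B y C \<one>\<^bsub>Ext K C A\<^esub>"
  shows "\<exists>s r. biproduct K A C B x s r y"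
proof -
  note d = E_triangleD[OF t]
  obtain r where r: "arr K B A r" "r \<cdot> x = Ident K A"
    using extends_iff_push_one[OF t arr_Ident[OF d(4)]] push_one[OF arr_Ident[OF d(4)] d(6)] by blast
  obtain u where u: "arr K C B u" "y \<cdot> u = Ident K C"
    using lifts_iff_pull_one[OF t arr_Ident[OF d(6)]] pull_one[OF arr_Ident[OF d(6)] d(4)] by blast
  note yx = E_triangle_Comp_zero[OF t]
  have e: "arr K B B (sub_mor K B B (Ident K B) (x \<cdot> r))" using arr_sub arr_Ident arr_Comp d r by blast
  have "sub_mor K B B (Ident K B) (x \<cdot> r) \<cdot> x = zero_mor K A B"
    using d r by (simp add: arr_iff cat_simps)
  then obtain s where s: "arr K C B s" "s \<cdot> y = sub_mor K B B (Ident K B) (x \<cdot> r)"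
    using factors_through_deflation[OF t e] by blast
  have ys: "y \<cdot> s = Ident K C"
  proof -
    have "y \<cdot> s = (y \<cdot> (s \<cdot> y)) \<cdot> u" using d(1-2) u s(1) by (simp add: arr_iff cat_simps)
    also have "y \<cdot> (s \<cdot> y) = sub_mor K B C y ((y \<cdot> x) \<cdot> r)" unfolding s(2) using d(1,2) r(1) by (simp add: arr_iff cat_simps)
    also have "\<dots> = y" unfolding yx using d(1,2) r(1) by (simp add: arr_iff cat_simps)
    finally show ?thesis using u by simp
  qed
  have rs: "r \<cdot> s = zero_mor K C A"
  proof -
    have "r \<cdot> s = (r \<cdot> (s \<cdot> y)) \<cdot> u" using d(1-2) u s(1) r(1) by (simp add: arr_iff cat_simps)
    also have "r \<cdot> (s \<cdot> y) = sub_mor K B A r ((r \<cdot> x) \<cdot> r)" unfolding s(2) using d(1,2) r(1) by (simp add: arr_iff cat_simps)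
    also have "\<dots> = zero_mor K B A" unfolding r(2) using d(1,2) r(1) by (simp add: arr_iff cat_simps)
    finally show ?thesis using u(1) d by (simp add: arr_iff cat_simps)
  qed
  have "add_mor K B B (x \<cdot> r) (s \<cdot> y) = Ident K B"
  proof -
    have xr: "arr K B B (x \<cdot> r)" using d r arr_Comp by blast
    have "add_mor K B B (x \<cdot> r) (s \<cdot> y) = add_mor K B B (s \<cdot> y) (x \<cdot> r)"
      by (rule add_commute) (use xr s d arr_Comp in blast)+
    also have "\<dots> = Ident K B" unfolding s(2) using xr arr_Ident[OF d(5)] by (simp add: add_assoc arr_neg add_simps)
    finally show ?thesis .
  qed
  then have "biproduct K A C B x s r y"
    using d r s ys rs yx unfolding biproduct_def by (auto simp: arr_def)
  then show ?thesis by blast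
qed

text \<open>The morphism \<open>[b, y] : B \<oplus> W \<rightarrow> S\<close> is the composite of \<open>1 \<oplus> y : B \<oplus> W \<rightarrow> B \<oplus> S\<close> with
  \<open>[b, 1] : B \<oplus> S \<rightarrow> S\<close>, a projection of \<open>B \<oplus> S\<close> in a decomposition whose other injection is
  \<open>(1, -b)\<close>. Both are deflations, and so is their composite by the octahedral axiom.\<close>

lemma deflation_from_biproduct:
  assumes t: "E_triangle K L x W y S \<delta>" and b: "arr K B S b" and P: "biproduct K B W P i i' p p'"
  shows "\<exists>M h k \<epsilon>. E_triangle K M h P (add_mor K P S (b \<cdot> p) (y \<cdot> p')) S \<epsilon> \<and>
      E_triangle K L k M (p \<cdot> h) B (pull K L (neg_mor K B S b) \<delta>) \<and>
      h \<cdot> k = i' \<cdot> x \<and> push K S k \<delta> = \<epsilon>"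
proof -
  note d = E_triangleD[OF t]
  have BO: "B \<in> Obj K" using b by (auto simp: arr_def)
  obtain R j j' q q' where R: "biproduct K B S R j j' q q'" using biproduct_exists[OF BO d(6)] by metis
  note a = biproduct_arr[OF P] biproduct_arr[OF R]
  have Peq: "p \<cdot> i = Ident K B" "p' \<cdot> i' = Ident K W" "p \<cdot> i' = zero_mor K W B" "p' \<cdot> i = zero_mor K B W"
    "add_mor K P P (i \<cdot> p) (i' \<cdot> p') = Ident K P" using P by (auto simp: biproduct_def)
  have Req: "q \<cdot> j = Ident K B" "q' \<cdot> j' = Ident K S" "q \<cdot> j' = zero_mor K S B" "q' \<cdot> j = zero_mor K B S"
    "add_mor K R R (j \<cdot> q) (j' \<cdot> q') = Ident K R" using R by (auto simp: biproduct_def)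
  have RO: "R \<in> Obj K" using R by (auto simp: biproduct_def)
  define f f' where "f = add_mor K R S (b \<cdot> q) q'" and "f' = sub_mor K B R j (j' \<cdot> b)"
  have ff: "arr K R S f" "arr K B R f'"
    unfolding f_def f'_def by (rule arr_add[OF arr_Comp[OF a(7) b] a(8)], rule arr_sub[OF a(5) arr_Comp[OF b a(6)]])
  have R': "biproduct K B S R f' j' q f"
  proof -
    have "add_mor K R R (f' \<cdot> q) (j' \<cdot> f) = add_mor K R R (j \<cdot> q) (j' \<cdot> q')"
      using a b by (simp add: f_def f'_def arr_iff cat_simps)
    moreover have "q \<cdot> f' = sub_mor K B B (q \<cdot> j) ((q \<cdot> j') \<cdot> b)"
      "f \<cdot> j' = add_mor K S S (b \<cdot> (q \<cdot> j')) (q' \<cdot> j')" "f \<cdot> j = add_mor K B S (b \<cdot> (q \<cdot> j)) (q' \<cdot> j)"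
      using a(5-8) b by (simp_all add: f_def f'_def arr_iff cat_simps)
    then have "q \<cdot> f' = Ident K B" "f \<cdot> j' = Ident K S" "f \<cdot> j = b"
      unfolding Req using b BO d(6) by (simp_all add: arr_iff cat_simps)
    moreover have "f \<cdot> f' = sub_mor K B S (f \<cdot> j) ((f \<cdot> j') \<cdot> b)"
      using a(5-8) b ff(1) by (simp add: f'_def arr_iff cat_simps)
    then have "f \<cdot> f' = zero_mor K B S"
      unfolding calculation(3,4) using b by (simp add: arr_iff cat_simps)
    ultimately show ?thesis using R ff Req by (simp add: biproduct_def arr_def)
  qed
  obtain Z where Z: "zero_object K Z" using zero_object_exists by blast
  have ZO: "Z \<in> Obj K" using Z by (auto simp: zero_object_def)
  have g: "E_triangle K L (i' \<cdot> x) P (add_mor K P R (j \<cdot> p) (j' \<cdot> (y \<cdot> p'))) R (pull K L q' \<delta>)"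
  proof -
    have "E_triangle K L (dsum_mor K L (zero_mor K L Z) (Ident K L) P i i' (zero_mor K Z B) x)
                   P (dsum_mor K P p p' R j j' (Ident K B) y)
                   R (dsum_ext K R q q' L (zero_mor K Z L) (Ident K L) \<one>\<^bsub>Ext K B Z\<^esub> \<delta>)"
      by (rule Real_dsum[OF E_triangle_zero_Ident[OF Z BO] t biproduct_swap[OF biproduct_zero[OF Z d(4)]] P R])
    moreover have "dsum_mor K L (zero_mor K L Z) (Ident K L) P i i' (zero_mor K Z B) x = i' \<cdot> x"
      using a d ZO BO by (simp add: dsum_mor_def arr_iff cat_simps)
    moreover have "dsum_mor K P p p' R j j' (Ident K B) y = add_mor K P R (j \<cdot> p) (j' \<cdot> (y \<cdot> p'))"
      using a d BO by (simp add: dsum_mor_def arr_iff cat_simps)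
    moreover have "dsum_ext K R q q' L (zero_mor K Z L) (Ident K L) \<one>\<^bsub>Ext K B Z\<^esub> \<delta> = pull K L q' \<delta>"
    proof -
      interpret E: comm_group "Ext K R L" using Ext_comm_group RO d by blast
      have z: "arr K Z L (zero_mor K Z L)" using arr_zero ZO d by blast
      have "ExtMap K q (zero_mor K Z L) \<in> hom (Ext K B Z) (Ext K R L)"
        using ExtMap_hom z a by (auto simp: arr_def)
      then have "ExtMap K q (zero_mor K Z L) \<one>\<^bsub>Ext K B Z\<^esub> = \<one>\<^bsub>Ext K R L\<^esub>"
        using hom_one Ext_comm_group[OF ZO BO] E.is_group by (auto simp: comm_group_def)
      moreover have "ExtMap K q' (Ident K L) \<delta> \<in> carrier (Ext K R L)"
        using ExtMap_closed arr_Ident a d by blast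
      ultimately show ?thesis by (simp add: dsum_ext_def pull_def)
    qed
    ultimately show ?thesis by simp
  qed
  define G where "G = add_mor K P R (j \<cdot> p) (j' \<cdot> (y \<cdot> p'))"
  have qd: "pull K L q' \<delta> \<in> carrier (Ext K R L)" using pull_closed a d by blast
  obtain M m k h \<epsilon> where M: "E_triangle K M h P (f \<cdot> G) S \<epsilon>" "m \<in> mor K M B" "G \<cdot> h = f' \<cdot> m" "h \<cdot> k = i' \<cdot> x"
    "E_triangle K L k M m B (pull K L f' (pull K L q' \<delta>))" "pull K M f \<epsilon> = push K R k (pull K L q' \<delta>)"
    using ET4_op[OF Real_zero[OF R'] g[folded G_def]] by blast
  note e = E_triangleD[OF M(1)] E_triangleD[OF M(5)]
  have Ga: "arr K P R G" unfolding G_def by (rule arr_add[OF arr_Comp[OF a(3,5)] arr_Comp[OF arr_Comp[OF a(4) d(2)] a(6)]])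
  have "f \<cdot> G = add_mor K P S ((b \<cdot> (q \<cdot> j)) \<cdot> p) ((q' \<cdot> j') \<cdot> (y \<cdot> p'))"
  proof -
    have "f \<cdot> G = add_mor K P S ((f \<cdot> j) \<cdot> p) ((f \<cdot> j') \<cdot> (y \<cdot> p'))"
      unfolding G_def using ff a d(2) by (simp add: arr_iff cat_simps)
    moreover have "f \<cdot> j' = add_mor K S S (b \<cdot> (q \<cdot> j')) (q' \<cdot> j')" "f \<cdot> j = add_mor K B S (b \<cdot> (q \<cdot> j)) (q' \<cdot> j)"
      using a(5-8) b by (simp_all add: f_def arr_iff cat_simps)
    then have "f \<cdot> j = b \<cdot> (q \<cdot> j)" "f \<cdot> j' = q' \<cdot> j'"
      unfolding Req using b BO d(6) by (simp_all add: arr_iff cat_simps)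
    ultimately show ?thesis by simp
  qed
  then have 1: "f \<cdot> G = add_mor K P S (b \<cdot> p) (y \<cdot> p')"
    unfolding Req using a b d(2) by (simp add: arr_iff cat_simps)
  have "p \<cdot> h = q \<cdot> (G \<cdot> h)"
  proof -
    have "q \<cdot> (G \<cdot> h) = add_mor K M B ((q \<cdot> j) \<cdot> (p \<cdot> h)) ((q \<cdot> j') \<cdot> (y \<cdot> (p' \<cdot> h)))"
      unfolding G_def using a e(1) d(2) by (simp add: arr_iff cat_simps)
    then show ?thesis unfolding Req using a e(1) d(2) by (simp add: arr_iff cat_simps)
  qed
  also have "\<dots> = (q \<cdot> f') \<cdot> m" unfolding M(3) using a ff e(8) by (simp add: arr_iff cat_simps)
  also have "q \<cdot> f' = Ident K B" using R' by (simp add: biproduct_def)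
  finally have 2: "p \<cdot> h = m" using e(8) by (simp add: arr_iff cat_simps)
  have "q' \<cdot> f' = neg_mor K B S b"
  proof -
    have "q' \<cdot> f' = sub_mor K B S (q' \<cdot> j) ((q' \<cdot> j') \<cdot> b)"
      unfolding f'_def using a b by (simp add: arr_iff cat_simps)
    then show ?thesis unfolding Req using b BO d(6) by (simp add: arr_iff cat_simps)
  qed
  then have 3: "pull K L f' (pull K L q' \<delta>) = pull K L (neg_mor K B S b) \<delta>"
    using pull_Comp[OF a(8) ff(2) d(4,3)] by simp
  have "\<epsilon> = pull K M (f \<cdot> j') \<epsilon>"
    using R' pull_Ident e by (simp add: biproduct_def)
  also have "\<dots> = pull K M j' (push K R k (pull K L q' \<delta>))"
    using pull_Comp[OF ff(1) a(6) e(4,3)] M(6) by simp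
  also have "\<dots> = push K S k (pull K L (q' \<cdot> j') \<delta>)"
    using push_pull[OF e(7) a(6) qd] pull_Comp[OF a(8,6) d(4,3)] by simp
  also have "\<dots> = push K S k \<delta>" unfolding Req using pull_Ident d by simp
  finally have 4: "push K S k \<delta> = \<epsilon>" ..
  show ?thesis using M(1,4,5) 4 unfolding 1 3 2[symmetric] by blast
qed

end

section \<open>Quotients by the ideal of morphisms factoring through a subcategory\<close>

lemma (in category) factor_through_iff:
  assumes "A \<in> Obj K" "B \<in> Obj K" "W \<subseteq> Obj K"
  shows "f \<in> factor_through K W A B \<longleftrightarrow> (\<exists>X g h. X \<in> W \<and> arr K A X g \<and> arr K X B h \<and> f = h \<cdot> g)"
  using assms unfolding factor_through_def arr_def by blast

locale quotient_setting = additive_category K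
  for K :: "('o, 'm, 'z) cat_scheme" (structure) +
  fixes D W :: "'o set"
  assumes D_Obj: "D \<subseteq> Obj K" and W_Obj: "W \<subseteq> Obj K"
    and D_zero: "zero_object K Z \<Longrightarrow> Z \<in> D" and W_zero: "zero_object K Z \<Longrightarrow> Z \<in> W"
    and D_biproduct: "\<lbrakk> A \<in> D; A' \<in> D; biproduct K A A' P i i' p p' \<rbrakk> \<Longrightarrow> P \<in> D"
    and W_biproduct: "\<lbrakk> A \<in> W; A' \<in> W; biproduct K A A' P i i' p p' \<rbrakk> \<Longrightarrow> P \<in> W"
begin

abbreviation I :: "'o \<Rightarrow> 'o \<Rightarrow> 'm set" where
  "I A B \<equiv> factor_through K W A B"

abbreviation Q :: "('o, 'm set) cat" where
  "Q \<equiv> ideal_quotient K D W"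

definition cls :: "'o \<Rightarrow> 'o \<Rightarrow> 'm \<Rightarrow> 'm set" where
  "cls A B f = I A B #>\<^bsub>Hom K A B\<^esub> f"

lemma I_iff:
  "A \<in> Obj K \<Longrightarrow> B \<in> Obj K \<Longrightarrow>
    f \<in> I A B \<longleftrightarrow> (\<exists>X g h. X \<in> W \<and> arr K A X g \<and> arr K X B h \<and> f = h \<cdot> g)"
  using factor_through_iff W_Obj by blast

lemma I_I:
  "X \<in> W \<Longrightarrow> arr K A X g \<Longrightarrow> arr K X B h \<Longrightarrow> h \<cdot> g \<in> I A B"
  using I_iff[of A B] by (auto simp: arr_def)

lemma I_arr: "A \<in> Obj K \<Longrightarrow> B \<in> Obj K \<Longrightarrow> f \<in> I A B \<Longrightarrow> arr K A B f"
  using I_iff[of A B f] arr_Comp by auto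

lemma I_zero: "A \<in> Obj K \<Longrightarrow> B \<in> Obj K \<Longrightarrow> zero_mor K A B \<in> I A B"
proof -
  assume AB: "A \<in> Obj K" "B \<in> Obj K"
  obtain Z where Z: "zero_object K Z" using zero_object_exists by blast
  then have ZO: "Z \<in> Obj K" by (auto simp: zero_object_def)
  have "zero_mor K Z B \<cdot> zero_mor K A Z \<in> I A B"
    using I_I[OF W_zero[OF Z]] arr_zero AB ZO by blast
  then show ?thesis using AB ZO by (simp add: cat_simps)
qed

lemma I_Comp_left: "arr K A B f \<Longrightarrow> f \<in> I A B \<Longrightarrow> arr K B C g \<Longrightarrow> g \<cdot> f \<in> I A C"
proof -
  assume f: "arr K A B f" "f \<in> I A B" and g: "arr K B C g"
  then obtain X u v where u: "X \<in> W" "arr K A X u" "arr K X B v" "f = v \<cdot> u"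
    using I_iff by (auto simp: arr_def)
  have "g \<cdot> f = (g \<cdot> v) \<cdot> u" unfolding u(4) using comp_assoc_arr[OF u(2,3) g] by simp
  then show ?thesis using I_I[OF u(1,2) arr_Comp[OF u(3) g]] by simp
qed

lemma I_Comp_right: "arr K A B f \<Longrightarrow> arr K B C g \<Longrightarrow> g \<in> I B C \<Longrightarrow> g \<cdot> f \<in> I A C"
proof -
  assume f: "arr K A B f" and g: "arr K B C g" "g \<in> I B C"
  then obtain X u v where u: "X \<in> W" "arr K B X u" "arr K X C v" "g = v \<cdot> u"
    using I_iff by (auto simp: arr_def)
  have "g \<cdot> f = v \<cdot> (u \<cdot> f)" unfolding u(4) using comp_assoc_arr[OF f u(2,3)] by simp
  then show ?thesis using I_I[OF u(1) arr_Comp[OF f u(2)] u(3)] by simp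
qed

lemma I_neg: "A \<in> Obj K \<Longrightarrow> B \<in> Obj K \<Longrightarrow> f \<in> I A B \<Longrightarrow> neg_mor K A B f \<in> I A B"
proof -
  assume AB: "A \<in> Obj K" "B \<in> Obj K" and f: "f \<in> I A B"
  then obtain X u v where u: "X \<in> W" "arr K A X u" "arr K X B v" "f = v \<cdot> u" using I_iff by auto
  have "neg_mor K X B v \<cdot> u = neg_mor K A B f" using u by (simp add: arr_iff cat_simps)
  then show ?thesis using I_I[OF u(1,2) arr_neg[OF u(3)]] by simp
qed

text \<open>A sum of two morphisms through objects of \<open>W\<close> factors through their direct sum.\<close>

lemma I_add: "A \<in> Obj K \<Longrightarrow> B \<in> Obj K \<Longrightarrow> f \<in> I A B \<Longrightarrow> g \<in> I A B \<Longrightarrow> add_mor K A B f g \<in> I A B"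
proof -
  assume AB: "A \<in> Obj K" "B \<in> Obj K" and f: "f \<in> I A B" and g: "g \<in> I A B"
  obtain X u v where u: "X \<in> W" "arr K A X u" "arr K X B v" "f = v \<cdot> u" using I_iff AB f by auto
  obtain Y s t where s: "Y \<in> W" "arr K A Y s" "arr K Y B t" "g = t \<cdot> s" using I_iff AB g by auto
  have "X \<in> Obj K" "Y \<in> Obj K" using u s by (auto simp: arr_def)
  then obtain P i i' p p' where P: "biproduct K X Y P i i' p p'" using biproduct_exists by metis
  note a = biproduct_arr[OF P]
  have eq: "p \<cdot> i = Ident K X" "p' \<cdot> i' = Ident K Y" "p \<cdot> i' = zero_mor K Y X" "p' \<cdot> i = zero_mor K X Y"
    using P by (auto simp: biproduct_def)
  define m where "m = add_mor K A P (i \<cdot> u) (i' \<cdot> s)"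
  define n where "n = add_mor K P B (v \<cdot> p) (t \<cdot> p')"
  have m: "arr K A P m" unfolding m_def by (rule arr_add[OF arr_Comp[OF u(2) a(1)] arr_Comp[OF s(2) a(2)]])
  have n: "arr K P B n" unfolding n_def by (rule arr_add[OF arr_Comp[OF a(3) u(3)] arr_Comp[OF a(4) s(3)]])
  have "n \<cdot> m = add_mor K A B ((n \<cdot> i) \<cdot> u) ((n \<cdot> i') \<cdot> s)"
    unfolding m_def using a(1,2) n u(2) s(2) by (simp add: arr_iff cat_simps)
  moreover have "n \<cdot> i = add_mor K X B (v \<cdot> (p \<cdot> i)) (t \<cdot> (p' \<cdot> i))"
    "n \<cdot> i' = add_mor K Y B (v \<cdot> (p \<cdot> i')) (t \<cdot> (p' \<cdot> i'))"
    unfolding n_def using a u(3) s(3) by (simp_all add: arr_iff cat_simps)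
  then have "n \<cdot> i = v" "n \<cdot> i' = t" unfolding eq using u(3) s(3) by (simp_all add: arr_iff cat_simps)
  ultimately have "n \<cdot> m = add_mor K A B f g" using u s by simp
  then show ?thesis using I_I[OF W_biproduct[OF u(1) s(1) P] m n] by simp
qed

lemma I_normal: "A \<in> Obj K \<Longrightarrow> B \<in> Obj K \<Longrightarrow> I A B \<lhd> Hom K A B"
proof -
  assume AB: "A \<in> Obj K" "B \<in> Obj K"
  interpret G: comm_group "Hom K A B" using Hom_comm_group AB .
  have "subgroup (I A B) (Hom K A B)"
    by (rule G.subgroupI) (use AB I_arr I_zero[of A B] I_neg I_add in \<open>auto simp: arr_def\<close>)
  then show ?thesis by (rule G.subgroup_imp_normal)
qed

lemma mem_cls_iff:
  assumes "arr K A B f"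
  shows "g \<in> cls A B f \<longleftrightarrow> arr K A B g \<and> sub_mor K A B g f \<in> I A B"
proof
  note AB = arr_ObjD[OF assms]
  assume "g \<in> cls A B f"
  then obtain h where h: "h \<in> I A B" "g = add_mor K A B h f" by (auto simp: cls_def r_coset_def)
  then have "arr K A B h" using I_arr AB by blast
  then show "arr K A B g \<and> sub_mor K A B g f \<in> I A B"
    using h assms by (simp add: arr_add add_assoc arr_neg add_simps)
next
  assume g: "arr K A B g \<and> sub_mor K A B g f \<in> I A B"
  have "add_mor K A B (sub_mor K A B g f) f = g" using g assms by (simp add: add_assoc arr_neg add_simps)
  then show "g \<in> cls A B f" using g by (force simp: cls_def r_coset_def)
qed

lemma cls_eq_iff:
  assumes "arr K A B f" "arr K A B g"
  shows "cls A B f = cls A B g \<longleftrightarrow> sub_mor K A B f g \<in> I A B"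
proof -
  note AB = arr_ObjD[OF assms(1)]
  interpret N: normal "I A B" "Hom K A B" using I_normal AB .
  have "sub_mor K A B f g \<in> I A B \<longleftrightarrow> f \<in> cls A B g" using mem_cls_iff assms by blast
  also have "\<dots> \<longleftrightarrow> cls A B f = cls A B g"
    using N.repr_independence[of f "I A B" g] N.rcos_self[of f "I A B"] N.is_subgroup assms
    by (auto simp: cls_def arr_def)
  finally show ?thesis ..
qed

lemma Obj_Q [simp]: "Obj Q = D"
  by (simp add: ideal_quotient_def)

lemma mor_Q: "mor Q A B = cls A B ` mor K A B"
  by (simp add: ideal_quotient_def carrier_FactGroup cls_def)

lemma Ident_Q [simp]: "Ident Q A = cls A A (Ident K A)"
  by (simp add: ideal_quotient_def cls_def)

lemma zero_Q: "A \<in> D \<Longrightarrow> B \<in> D \<Longrightarrow> zero_mor Q A B = cls A B (zero_mor K A B)"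
proof -
  assume AB: "A \<in> D" "B \<in> D"
  interpret N: normal "I A B" "Hom K A B" using I_normal AB D_Obj by blast
  show ?thesis by (simp add: ideal_quotient_def cls_def N.subset)
qed

lemma add_Q: "A \<in> D \<Longrightarrow> B \<in> D \<Longrightarrow> arr K A B f \<Longrightarrow> arr K A B g
  \<Longrightarrow> add_mor Q A B (cls A B f) (cls A B g) = cls A B (add_mor K A B f g)"
proof -
  assume AB: "A \<in> D" "B \<in> D" and fg: "arr K A B f" "arr K A B g"
  interpret N: normal "I A B" "Hom K A B" using I_normal AB D_Obj by blast
  show ?thesis using fg by (simp add: ideal_quotient_def cls_def N.rcos_sum arr_def)
qed

lemma arr_Q_cls: "A \<in> D \<Longrightarrow> B \<in> D \<Longrightarrow> arr K A B f \<Longrightarrow> arr Q A B (cls A B f)"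
  by (simp add: arr_def mor_Q)

lemma arr_QE:
  assumes "arr Q A B F"
  obtains f where "A \<in> D" "B \<in> D" "arr K A B f" "F = cls A B f"
  using assms D_Obj by (auto simp: arr_def mor_Q)

text \<open>Changing the representatives changes the composite by \<open>g' \<cdot> (f' - f) + (g' - g) \<cdot> f\<close>, which lies in
  the ideal, and the composite determines its source and target. All the cosets in the defining union
  therefore coincide.\<close>

lemma Comp_Q:
  assumes "A \<in> D" "C \<in> D" and f: "arr K A B f" and g: "arr K B C g"
  shows "Comp Q (cls B C g) (cls A B f) = cls A C (g \<cdot> f)"
proof -
  note AB = arr_ObjD[OF f] and BC = arr_ObjD[OF g]
  have coset: "I A' C' #>\<^bsub>Hom K A' C'\<^esub> (g' \<cdot> f') = cls A C (g \<cdot> f)"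
    if *: "A' \<in> D" "C' \<in> D" "g' \<in> cls B C g" "f' \<in> cls A B f" "g' \<cdot> f' \<in> mor K A' C'" for A' C' g' f'
  proof -
    have f': "arr K A B f'" "sub_mor K A B f' f \<in> I A B" using mem_cls_iff[OF f] * by auto
    have g': "arr K B C g'" "sub_mor K B C g' g \<in> I B C" using mem_cls_iff[OF g] * by auto
    have "arr K A' C' (g' \<cdot> f')" using * D_Obj by (auto simp: arr_def)
    then have eq: "A' = A" "C' = C" using arr_unique arr_Comp[OF f'(1) g'(1)] by blast+
    have i: "g' \<cdot> sub_mor K A B f' f \<in> I A C"
      by (rule I_Comp_left[OF arr_sub[OF f'(1) f] f'(2) g'(1)])
    have j: "sub_mor K B C g' g \<cdot> f \<in> I A C"
      by (rule I_Comp_right[OF f arr_sub[OF g'(1) g] g'(2)])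
    have "add_mor K A C (g' \<cdot> sub_mor K A B f' f) (sub_mor K B C g' g \<cdot> f) = sub_mor K A C (g' \<cdot> f') (g \<cdot> f)"
      using f g f'(1) g'(1) by (simp add: arr_iff cat_simps)
    then have "sub_mor K A C (g' \<cdot> f') (g \<cdot> f) \<in> I A C" using I_add[OF AB(1) BC(2) i j] by simp
    then show ?thesis
      unfolding eq using cls_eq_iff[OF arr_Comp[OF f'(1) g'(1)] arr_Comp[OF f g]] by (simp add: cls_def)
  qed
  have self: "f \<in> cls A B f" "g \<in> cls B C g"
    using mem_cls_iff f g I_zero AB BC by (auto simp: add_simps)
  have gf: "g \<cdot> f \<in> mor K A C" using arr_Comp[OF f g] by (simp add: arr_def)
  have "{I A' C' #>\<^bsub>Hom K A' C'\<^esub> (g' \<cdot> f') | A' C' g' f'. A' \<in> D \<and> C' \<in> D \<and>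
          g' \<in> cls B C g \<and> f' \<in> cls A B f \<and> g' \<cdot> f' \<in> mor K A' C'} = {cls A C (g \<cdot> f)}" (is "?L = _")
  proof (intro equalityI subsetI)
    fix c assume "c \<in> ?L"
    then show "c \<in> {cls A C (g \<cdot> f)}" using coset by blast
  next
    fix c assume "c \<in> {cls A C (g \<cdot> f)}"
    then have "c = I A C #>\<^bsub>Hom K A C\<^esub> (g \<cdot> f)" by (simp add: cls_def)
    then show "c \<in> ?L" using self assms(1,2) gf by blast
  qed
  then show ?thesis by (simp add: ideal_quotient_def)
qed

lemma cls_zero_iff:
  assumes "A \<in> D" "B \<in> D" "arr K A B f"
  shows "cls A B f = zero_mor Q A B \<longleftrightarrow> f \<in> I A B"
  using cls_eq_iff[OF assms(3) arr_zero[OF arr_ObjD[OF assms(3)]]] assms arr_ObjD[OF assms(3)]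
  by (simp add: zero_Q neg_zero add_simps)

sublocale Q: category Q
proof
  show "A = A' \<and> B = B'" if m: "A \<in> Obj Q" "B \<in> Obj Q" "A' \<in> Obj Q" "B' \<in> Obj Q" "F \<in> mor Q A B" "F \<in> mor Q A' B'"
    for A B A' B' F
  proof -
    have O: "A \<in> Obj K" "B \<in> Obj K" "A' \<in> Obj K" "B' \<in> Obj K" using m D_Obj by auto
    obtain f where f: "arr K A B f" "F = cls A B f" using m(5) O(1,2) by (auto simp: mor_Q arr_def)
    obtain g where g: "arr K A' B' g" "F = cls A' B' g" using m(6) O(3,4) by (auto simp: mor_Q arr_def)
    have "f \<in> F" unfolding f(2) mem_cls_iff[OF f(1)] using f I_zero O by (simp add: add_simps)
    then have "arr K A' B' f" unfolding g(2) mem_cls_iff[OF g(1)] by blast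
    then show ?thesis using arr_unique[OF f(1)] by blast
  qed
  show "Comp Q G F \<in> mor Q A C" if m: "A \<in> Obj Q" "B \<in> Obj Q" "C \<in> Obj Q" "F \<in> mor Q A B" "G \<in> mor Q B C"
    for A B C F G
  proof -
    obtain f g where *: "arr K A B f" "F = cls A B f" "arr K B C g" "G = cls B C g"
      using m D_Obj by (auto simp: mor_Q arr_def)
    then have "Comp Q G F = cls A C (g \<cdot> f)" using Comp_Q m by simp
    then show ?thesis using arr_Comp[OF *(1,3)] by (auto simp: mor_Q arr_def)
  qed
  show "Ident Q A \<in> mor Q A A" if m: "A \<in> Obj Q" for A
    using m D_Obj Ident_mor by (auto simp: mor_Q)
  show "Comp Q (Comp Q H G) F = Comp Q H (Comp Q G F)" if m: "A \<in> Obj Q" "B \<in> Obj Q" "C \<in> Obj Q" "E \<in> Obj Q"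
    "F \<in> mor Q A B" "G \<in> mor Q B C" "H \<in> mor Q C E" for A B C E F G H
  proof -
    obtain f g h where *: "arr K A B f" "F = cls A B f" "arr K B C g" "G = cls B C g" "arr K C E h" "H = cls C E h"
      using m D_Obj by (auto simp: mor_Q arr_def)
    then show ?thesis using m Comp_Q arr_Comp[OF *(1,3)] arr_Comp[OF *(3,5)] comp_assoc_arr[OF *(1,3,5)] by simp
  qed
  show "Comp Q (Ident Q B) F = F" if m: "A \<in> Obj Q" "B \<in> Obj Q" "F \<in> mor Q A B" for A B F
  proof -
    obtain f where f: "arr K A B f" "F = cls A B f" using m D_Obj by (auto simp: mor_Q arr_def)
    then show ?thesis using m Comp_Q[OF _ _ f(1) arr_Ident] D_Obj by (auto simp: arr_iff cat_simps)
  qed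
  show "Comp Q F (Ident Q A) = F" if m: "A \<in> Obj Q" "B \<in> Obj Q" "F \<in> mor Q A B" for A B F
  proof -
    obtain f where f: "arr K A B f" "F = cls A B f" using m D_Obj by (auto simp: mor_Q arr_def)
    then show ?thesis using m Comp_Q[OF _ _ arr_Ident f(1)] D_Obj by (auto simp: arr_iff cat_simps)
  qed
qed

sublocale Q: preadditive_category Q
proof (rule preadditive_category.intro[OF Q.category_axioms preadditive_category_axioms.intro])
  show "comm_group (Hom Q A B)" if m: "A \<in> Obj Q" "B \<in> Obj Q" for A B
  proof -
    have AB: "A \<in> Obj K" "B \<in> Obj K" using m D_Obj by auto
    have "comm_group (Hom K A B Mod I A B)"
      using comm_group.abelian_FactGroup[OF Hom_comm_group[OF AB]] I_normal[OF AB] normal_imp_subgroup by blast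
    then show ?thesis by (simp add: ideal_quotient_def)
  qed
  show "(\<lambda>F. Comp Q G F) \<in> hom (Hom Q A B) (Hom Q A C)"
    if m: "A \<in> Obj Q" "B \<in> Obj Q" "C \<in> Obj Q" "G \<in> mor Q B C" for A B C G
  proof (rule homI)
    obtain g where g: "arr K B C g" "G = cls B C g" using m D_Obj by (auto simp: mor_Q arr_def)
    fix F assume "F \<in> mor Q A B"
    then show "Comp Q G F \<in> mor Q A C" using m Q.Comp_mor by blast
    fix F' assume "F' \<in> mor Q A B"
    then obtain f f' where f: "arr K A B f" "F = cls A B f" "arr K A B f'" "F' = cls A B f'"
      using m D_Obj \<open>F \<in> mor Q A B\<close> by (auto simp: mor_Q arr_def)
    have "g \<cdot> add_mor K A B f f' = add_mor K A C (g \<cdot> f) (g \<cdot> f')" using f g by (simp add: arr_iff cat_simps)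
    then show "Comp Q G (add_mor Q A B F F') = add_mor Q A C (Comp Q G F) (Comp Q G F')"
      using m f g add_Q Comp_Q[of A C B] arr_add arr_Comp[OF _ g(1)] by simp
  qed
  show "(\<lambda>G. Comp Q G F) \<in> hom (Hom Q B C) (Hom Q A C)"
    if m: "A \<in> Obj Q" "B \<in> Obj Q" "C \<in> Obj Q" "F \<in> mor Q A B" for A B C F
  proof (rule homI)
    obtain f where f: "arr K A B f" "F = cls A B f" using m D_Obj by (auto simp: mor_Q arr_def)
    fix G assume "G \<in> mor Q B C"
    then show "Comp Q G F \<in> mor Q A C" using m Q.Comp_mor by blast
    fix G' assume "G' \<in> mor Q B C"
    then obtain g g' where g: "arr K B C g" "G = cls B C g" "arr K B C g'" "G' = cls B C g'"
      using m D_Obj \<open>G \<in> mor Q B C\<close> by (auto simp: mor_Q arr_def)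
    have "add_mor K B C g g' \<cdot> f = add_mor K A C (g \<cdot> f) (g' \<cdot> f)" using f g by (simp add: arr_iff cat_simps)
    then show "Comp Q (add_mor Q B C G G') F = add_mor Q A C (Comp Q G F) (Comp Q G' F)"
      using m f g add_Q Comp_Q[of A C B] arr_add arr_Comp[OF f(1)] by simp
  qed
qed

sublocale Q: additive_category Q
proof
  obtain Z where Z: "zero_object K Z" using zero_object_exists by blast
  have "zero_object Q Z"
    using Z W_zero D_zero D_Obj by (auto simp: zero_object_def mor_Q zero_Q)
  then show "\<exists>Z. zero_object Q Z" by blast
  show "\<exists>P i i' p p'. biproduct Q A A' P i i' p p'" if "A \<in> Obj Q" "A' \<in> Obj Q" for A A'
  proof -
    have "A \<in> D" "A' \<in> D" "A \<in> Obj K" "A' \<in> Obj K" using that D_Obj by auto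
    then obtain P i i' p p' where P: "biproduct K A A' P i i' p p'" using biproduct_exists by metis
    note a = biproduct_arr[OF P]
    have PD: "P \<in> D" using D_biproduct P \<open>A \<in> D\<close> \<open>A' \<in> D\<close> by blast
    have "biproduct Q A A' P (cls A P i) (cls A' P i') (cls P A p) (cls P A' p')"
      using P PD a that arr_Comp[OF a(3,1)] arr_Comp[OF a(4,2)]
      by (simp add: biproduct_def Comp_Q add_Q zero_Q) (simp add: mor_Q)
    then show ?thesis by blast
  qed
qed

lemma sub_Q:
  assumes "A \<in> D" "B \<in> D" "arr K A B f" "arr K A B g"
  shows "sub_mor Q A B (cls A B f) (cls A B g) = cls A B (sub_mor K A B f g)"
proof -
  have "add_mor Q A B (cls A B (sub_mor K A B f g)) (cls A B g) = cls A B f"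
    using add_Q[OF assms(1,2) arr_sub[OF assms(3,4)] assms(4)] assms(3,4)
    by (simp add: add_assoc arr_neg add_simps)
  then show ?thesis
    using Q.add_assoc[of A B "cls A B (sub_mor K A B f g)" "cls A B g" "neg_mor Q A B (cls A B g)"]
      Q.arr_neg Q.add_simps arr_Q_cls assms arr_sub by metis
qed

text \<open>A criterion on representatives. The factorization of \<open>h\<close> is asked for on the nose, and not only
  modulo the ideal, because extending morphisms along an inflation provides exactly that.\<close>

lemma cokernel_of_Q_I:
  assumes D: "A \<in> D" "B \<in> D" "C \<in> D" and f: "arr K A B f" and g: "arr K B C g" and gf: "g \<cdot> f \<in> I A C"
    and ext: "\<And>Z h. Z \<in> D \<Longrightarrow> arr K B Z h \<Longrightarrow> h \<cdot> f \<in> I A Z \<Longrightarrow> \<exists>u. arr K C Z u \<and> u \<cdot> g = h"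
    and epi: "\<And>Z u. Z \<in> D \<Longrightarrow> arr K C Z u \<Longrightarrow> u \<cdot> g \<in> I B Z \<Longrightarrow> u \<in> I C Z"
  shows "cokernel_of Q A B C (cls A B f) (cls B C g)"
proof (rule Q.cokernel_ofI)
  show "arr Q A B (cls A B f)" "arr Q B C (cls B C g)" using arr_Q_cls D f g by blast+
  show "Comp Q (cls B C g) (cls A B f) = zero_mor Q A C"
    using Comp_Q[OF D(1,3) f g] cls_zero_iff[OF D(1,3) arr_Comp[OF f g]] gf by simp
  fix Z z assume z: "arr Q B Z z" "Comp Q z (cls A B f) = zero_mor Q A Z"
  obtain h where h: "Z \<in> D" "arr K B Z h" "z = cls B Z h" using z(1) by (elim arr_QE)
  have "h \<cdot> f \<in> I A Z"
    using z(2) Comp_Q[OF D(1) h(1) f h(2)] cls_zero_iff[OF D(1) h(1) arr_Comp[OF f h(2)]] h(3) by simp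
  then obtain u where u: "arr K C Z u" "u \<cdot> g = h" using ext h by blast
  then show "\<exists>u. arr Q C Z u \<and> Comp Q u (cls B C g) = z"
    using arr_Q_cls[OF D(3) h(1) u(1)] Comp_Q[OF D(2) h(1) g u(1)] h(3) by auto
next
  fix Z v assume v: "arr Q C Z v" "Comp Q v (cls B C g) = zero_mor Q B Z"
  obtain u where u: "Z \<in> D" "arr K C Z u" "v = cls C Z u" using v(1) by (elim arr_QE)
  have "u \<cdot> g \<in> I B Z"
    using v(2) Comp_Q[OF D(2) u(1) g u(2)] cls_zero_iff[OF D(2) u(1) arr_Comp[OF g u(2)]] u(3) by simp
  then show "v = zero_mor Q C Z" using epi u cls_zero_iff[OF D(3) u(1,2)] by simp
qed

end

lemma factor_through_eopp: "factor_through (eopp K) W A B = factor_through K W B A"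
  unfolding factor_through_def by auto

lemma ideal_quotient_eopp: "ideal_quotient (eopp K) D W = opp (ideal_quotient K D W)"
proof -
  have "(\<Union>{factor_through K W C A #>\<^bsub>Hom K C A\<^esub> Comp K f g | A C g f.
           A \<in> D \<and> C \<in> D \<and> g \<in> G \<and> f \<in> F \<and> Comp K f g \<in> mor K C A}) =
        (\<Union>{factor_through K W A C #>\<^bsub>Hom K A C\<^esub> Comp K g f | A C g f.
           A \<in> D \<and> C \<in> D \<and> g \<in> F \<and> f \<in> G \<and> Comp K g f \<in> mor K A C})" for G F
    by (rule arg_cong[of _ _ Union]) blast
  then show ?thesis by (simp add: ideal_quotient_def opp_def factor_through_eopp)
qed

section \<open>Cotorsion pairs\<close>

lemma cotorsion_pair_eopp:
  assumes "cotorsion_pair K U V" shows "cotorsion_pair (eopp K) V U"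
proof -
  have iso: "full_subcat (eopp K) X" if X: "full_subcat K X" for X
    unfolding full_subcat_def iso_mor_eopp eopp_simps
  proof (intro conjI ballI allI impI)
    show "X \<subseteq> Obj K" using X by (simp add: full_subcat_def)
    fix A Y f assume *: "A \<in> X" "Y \<in> Obj K" "iso_mor K Y A f"
    obtain g where "iso_mor K A Y g" using *(3) by (auto simp: iso_mor_def)
    then show "Y \<in> X" using * X unfolding full_subcat_def by metis
  qed
  have "summand_closed (eopp K) X" if "summand_closed K X" for X
    using that unfolding summand_closed_def biproduct_eopp by blast
  moreover have "\<exists>A \<in> U. \<exists>C \<in> V. \<exists>x y \<delta>. E_triangle K B y C x A \<delta>" if "B \<in> Obj K" for B
    using assms that unfolding cotorsion_pair_def by blast
  moreover have "\<exists>A \<in> U. \<exists>C \<in> V. \<exists>x y \<delta>. E_triangle K C y A x B \<delta>" if "B \<in> Obj K" for B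
    using assms that unfolding cotorsion_pair_def by blast
  ultimately show ?thesis
    using assms iso unfolding cotorsion_pair_def E_triangle_eopp by simp
qed

context extriangulated_category
begin

lemma cotorsion_pair_Obj: "cotorsion_pair K U V \<Longrightarrow> U \<subseteq> Obj K" "cotorsion_pair K U V \<Longrightarrow> V \<subseteq> Obj K"
  by (auto simp: cotorsion_pair_def full_subcat_def)

lemma cotorsion_pair_Ext:
  "cotorsion_pair K U V \<Longrightarrow> C \<in> U \<Longrightarrow> A \<in> V \<Longrightarrow> \<delta> \<in> carrier (Ext K C A) \<Longrightarrow> \<delta> = \<one>\<^bsub>Ext K C A\<^esub>"
  unfolding cotorsion_pair_def by blast

lemma cotorsion_pair_resolution:
  assumes "cotorsion_pair K U V" "B \<in> Obj K"
  obtains A C x y \<delta> where "A \<in> V" "C \<in> U" "E_triangle K A x C y B \<delta>"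
  using assms unfolding cotorsion_pair_def by blast

lemma cotorsion_pair_coresolution:
  assumes "cotorsion_pair K U V" "B \<in> Obj K"
  obtains A C x y \<delta> where "A \<in> V" "C \<in> U" "E_triangle K B x A y C \<delta>"
  using assms unfolding cotorsion_pair_def by blast

text \<open>The resolution \<open>A \<rightarrow> C \<rightarrow> X\<close> splits, and \<open>X\<close> is a direct summand of \<open>C \<in> U\<close>.\<close>

lemma cotorsion_pair_leftI:
  assumes cp: "cotorsion_pair K U V" and X: "X \<in> Obj K"
    and z: "\<And>A \<delta>. A \<in> V \<Longrightarrow> \<delta> \<in> carrier (Ext K X A) \<Longrightarrow> \<delta> = \<one>\<^bsub>Ext K X A\<^esub>"
  shows "X \<in> U"
proof -
  obtain A C x y \<delta> where t: "A \<in> V" "C \<in> U" "E_triangle K A x C y X \<delta>"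
    using cotorsion_pair_resolution[OF cp X] .
  have "\<delta> = \<one>\<^bsub>Ext K X A\<^esub>" using z t E_triangleD by metis
  then obtain s r where "biproduct K A X C x s r y" using split_triangle_biproduct t by metis
  then have "biproduct K X A C s x y r" by (rule biproduct_swap)
  then show ?thesis using cp t unfolding cotorsion_pair_def summand_closed_def by blast
qed

lemma cotorsion_pair_left_extension:
  assumes cp: "cotorsion_pair K U V" and t: "E_triangle K A x B y C \<delta>" and AC: "A \<in> U" "C \<in> U"
  shows "B \<in> U"
proof (rule cotorsion_pair_leftI[OF cp])
  note d = E_triangleD[OF t]
  show "B \<in> Obj K" using d by blast
  fix X \<epsilon> assume X: "X \<in> V" and e: "\<epsilon> \<in> carrier (Ext K B X)"
  have XO: "X \<in> Obj K" using X cp cotorsion_pair_Obj by blast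
  have "pull K X x \<epsilon> = \<one>\<^bsub>Ext K A X\<^esub>"
    using cotorsion_pair_Ext[OF cp AC(1) X] pull_closed[OF d(1) XO e] by blast
  then obtain \<epsilon>' where e': "\<epsilon>' \<in> carrier (Ext K C X)" "pull K X y \<epsilon>' = \<epsilon>"
    using pull_exact[OF t XO e] by blast
  then have "\<epsilon>' = \<one>\<^bsub>Ext K C X\<^esub>" using cotorsion_pair_Ext[OF cp AC(2) X] by blast
  then show "\<epsilon> = \<one>\<^bsub>Ext K B X\<^esub>" using e'(2) pull_one[OF d(2) XO] by simp
qed

lemma cotorsion_pair_left_zero:
  assumes cp: "cotorsion_pair K U V" and Z: "zero_object K Z"
  shows "Z \<in> U"
proof (rule cotorsion_pair_leftI[OF cp])
  show ZO: "Z \<in> Obj K" using Z by (auto simp: zero_object_def)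
  fix A \<delta> assume A: "A \<in> V" and d: "\<delta> \<in> carrier (Ext K Z A)"
  have AO: "A \<in> Obj K" using A cp cotorsion_pair_Obj by blast
  have "Ident K Z = zero_mor K Z Z" using Z ZO Ident_mor[OF ZO] by (auto simp: zero_object_def)
  then show "\<delta> = \<one>\<^bsub>Ext K Z A\<^esub>" using pull_Ident[OF AO ZO d] pull_zero[OF ZO AO ZO d] by simp
qed

lemma cotorsion_pair_left_biproduct:
  assumes "cotorsion_pair K U V" "A \<in> U" "A' \<in> U" "biproduct K A A' P i i' p p'"
  shows "P \<in> U"
  using cotorsion_pair_left_extension[OF assms(1) Real_zero[OF assms(4)] assms(2,3)] .

lemma cotorsion_pair_rightI:
  assumes cp: "cotorsion_pair K U V" and X: "X \<in> Obj K"
    and z: "\<And>A \<delta>. A \<in> U \<Longrightarrow> \<delta> \<in> carrier (Ext K A X) \<Longrightarrow> \<delta> = \<one>\<^bsub>Ext K A X\<^esub>"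
  shows "X \<in> V"
  using extriangulated_category.cotorsion_pair_leftI[OF extriangulated_category_eopp cotorsion_pair_eopp[OF cp]] X z
  by simp

lemma cotorsion_pair_right_extension:
  assumes cp: "cotorsion_pair K U V" and t: "E_triangle K A x B y C \<delta>" and AC: "A \<in> V" "C \<in> V"
  shows "B \<in> V"
  using extriangulated_category.cotorsion_pair_left_extension[OF extriangulated_category_eopp cotorsion_pair_eopp[OF cp],
      of C y B x A \<delta>] t AC by simp

lemma cotorsion_pair_right_zero: "cotorsion_pair K U V \<Longrightarrow> zero_object K Z \<Longrightarrow> Z \<in> V"
  using extriangulated_category.cotorsion_pair_left_zero[OF extriangulated_category_eopp cotorsion_pair_eopp, of U V Z]
  by (simp add: zero_object_def conj_commute)

lemma cotorsion_pair_right_biproduct: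
  assumes "cotorsion_pair K U V" "A \<in> V" "A' \<in> V" "biproduct K A A' P i i' p p'"
  shows "P \<in> V"
  using cotorsion_pair_right_extension[OF assms(1) Real_zero[OF assms(4)] assms(2,3)] .

end

section \<open>The classes defining the heart\<close>

lemma plus_class_eopp [simp]: "plus_class (eopp K) S W = minus_class K S W"
  unfolding plus_class_def minus_class_def E_triangle_eopp eopp_simps by blast

lemma minus_class_eopp [simp]: "minus_class (eopp K) V W = plus_class K V W"
  unfolding plus_class_def minus_class_def E_triangle_eopp eopp_simps by blast

locale twin_cotorsion = extriangulated_category K
  for K :: "('o, 'm, 'e, 'z) ext_cat_scheme" (structure) +
  fixes S T U V :: "'o set"
  assumes twin: "twin_cotorsion_pair K S T U V"
begin

text \<open>The condition to be checked is \<open>V \<subseteq> T\<close>: objects of \<open>V\<close> are orthogonal to \<open>U\<close>, all the more to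
  \<open>S\<close>. This symmetry halves the work below: statements about \<open>Bplus\<close> and cokernels dualize to
  statements about \<open>Bminus\<close> and kernels.\<close>

lemma twin_cotorsion_eopp: "twin_cotorsion (eopp K) V U T S"
proof -
  have "V \<subseteq> T"
  proof
    fix X assume X: "X \<in> V"
    have cp: "cotorsion_pair K S T" "cotorsion_pair K U V" "S \<subseteq> U"
      using twin by (auto simp: twin_cotorsion_pair_def)
    show "X \<in> T"
      by (rule cotorsion_pair_rightI[OF cp(1)])
        (use X cp cotorsion_pair_Obj cotorsion_pair_Ext[OF cp(2)] in blast)+
  qed
  then show ?thesis
    using twin extriangulated_category_eopp
    by (simp add: twin_cotorsion_def twin_cotorsion_axioms_def twin_cotorsion_pair_def cotorsion_pair_eopp)
qed

lemma ST: "cotorsion_pair K S T" and UV: "cotorsion_pair K U V" and S_U: "S \<subseteq> U"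
  using twin by (auto simp: twin_cotorsion_pair_def)

lemma V_T: "V \<subseteq> T"
  using twin_cotorsion.S_U[OF twin_cotorsion_eopp] .

lemma classes_Obj: "S \<subseteq> Obj K" "T \<subseteq> Obj K" "U \<subseteq> Obj K" "V \<subseteq> Obj K"
  using ST UV cotorsion_pair_Obj by blast+

abbreviation W :: "'o set" where "W \<equiv> T \<inter> U"
abbreviation Bplus :: "'o set" where "Bplus \<equiv> plus_class K V W"
abbreviation Bminus :: "'o set" where "Bminus \<equiv> minus_class K S W"

lemma plusE:
  assumes "X \<in> Bplus"
  obtains A C x y \<delta> where "A \<in> V" "C \<in> W" "E_triangle K A x C y X \<delta>"
  using assms by (auto simp: plus_class_def)

lemma minusE:
  assumes "X \<in> Bminus"
  obtains A C x y \<delta> where "A \<in> W" "C \<in> S" "E_triangle K X x A y C \<delta>"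
  using assms by (auto simp: minus_class_def)

lemma plusI: "A \<in> V \<Longrightarrow> C \<in> W \<Longrightarrow> E_triangle K A x C y X \<delta> \<Longrightarrow> X \<in> Bplus"
  unfolding plus_class_def using E_triangleD(6)[of K A x C y X \<delta>] by blast

lemma minusI: "A \<in> W \<Longrightarrow> C \<in> S \<Longrightarrow> E_triangle K X x A y C \<delta> \<Longrightarrow> X \<in> Bminus"
  unfolding minus_class_def using E_triangleD(4)[of K X x A y C \<delta>] by blast

lemma plus_minus_Obj: "X \<in> Bplus \<Longrightarrow> X \<in> Obj K" "X \<in> Bminus \<Longrightarrow> X \<in> Obj K"
  by (auto simp: plus_class_def minus_class_def)

lemma W_plus: "X \<in> W \<Longrightarrow> X \<in> Bplus"
proof -
  assume X: "X \<in> W"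
  obtain Z where Z: "zero_object K Z" using zero_object_exists by blast
  show ?thesis
    using plusI[OF cotorsion_pair_right_zero[OF UV Z] X E_triangle_zero_Ident[OF Z]] X classes_Obj by blast
qed

lemma plus_biproduct:
  assumes X: "X \<in> Bplus" "X' \<in> Bplus" and R: "biproduct K X X' R k k' r r'"
  shows "R \<in> Bplus"
proof -
  obtain A C x y \<delta> where t: "A \<in> V" "C \<in> W" "E_triangle K A x C y X \<delta>" using plusE X by metis
  obtain A' C' x' y' \<delta>' where t': "A' \<in> V" "C' \<in> W" "E_triangle K A' x' C' y' X' \<delta>'" using plusE X by metis
  note d = E_triangleD[OF t(3)] E_triangleD[OF t'(3)]
  obtain P i i' p p' where P: "biproduct K A A' P i i' p p'" using biproduct_exists[OF d(4,10)] by metis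
  obtain Q j j' q q' where Q: "biproduct K C C' Q j j' q q'" using biproduct_exists[OF d(5,11)] by metis
  have "P \<in> V" using cotorsion_pair_right_biproduct[OF UV t(1) t'(1) P] .
  moreover have "Q \<in> W" using cotorsion_pair_right_biproduct[OF ST _ _ Q] cotorsion_pair_left_biproduct[OF UV _ _ Q]
    t(2) t'(2) by blast
  ultimately show ?thesis using plusI Real_dsum[OF t(3) t'(3) P Q R] by blast
qed

lemma W_minus: "X \<in> W \<Longrightarrow> X \<in> Bminus"
  using twin_cotorsion.W_plus[OF twin_cotorsion_eopp, of X] by (simp add: Int_commute)

lemma minus_biproduct:
  assumes "X \<in> Bminus" "X' \<in> Bminus" "biproduct K X X' R k k' r r'"
  shows "R \<in> Bminus"
  using twin_cotorsion.plus_biproduct[OF twin_cotorsion_eopp, of X X' R r r' k k'] assms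
  by (simp add: Int_commute biproduct_eopp)

definition H :: "'o set" where "H = Bplus \<inter> Bminus"

lemma H_Obj: "H \<subseteq> Obj K"
  unfolding H_def using plus_minus_Obj by blast

lemma HD: "X \<in> H \<Longrightarrow> X \<in> Bplus" "X \<in> H \<Longrightarrow> X \<in> Bminus"
  by (auto simp: H_def)

lemma HI: "X \<in> Bplus \<Longrightarrow> X \<in> Bminus \<Longrightarrow> X \<in> H"
  by (simp add: H_def)

sublocale quotient_setting K H W
proof
  show "H \<subseteq> Obj K" by (rule H_Obj)
  show "W \<subseteq> Obj K" using classes_Obj by blast
  show zW: "Z \<in> W" if "zero_object K Z" for Z
    using cotorsion_pair_right_zero[OF ST that] cotorsion_pair_left_zero[OF UV that] by blast
  show "Z \<in> H" if "zero_object K Z" for Z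
    using zW[OF that] W_plus W_minus by (simp add: H_def)
  show "P \<in> H" if "A \<in> H" "A' \<in> H" "biproduct K A A' P i i' p p'" for A A' P i i' p p'
    using HI[OF plus_biproduct[OF _ _ that(3)] minus_biproduct[OF _ _ that(3)]] HD that(1,2) by blast
  show "P \<in> W" if "A \<in> W" "A' \<in> W" "biproduct K A A' P i i' p p'" for A A' P i i' p p'
    using cotorsion_pair_right_biproduct[OF ST _ _ that(3)] cotorsion_pair_left_biproduct[OF UV _ _ that(3)]
      that(1,2) by blast
qed

lemma heart_eq: "heart K S T U V = Q"
  by (simp add: heart_def H_def Let_def)

section \<open>Morphisms vanishing in the heart\<close>

lemma push_W_one:
  assumes "X \<in> W" "C \<in> S" "arr K A X a" "\<delta> \<in> carrier (Ext K C A)"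
  shows "push K C a \<delta> = \<one>\<^bsub>Ext K C X\<^esub>"
  using cotorsion_pair_Ext[OF ST assms(2)] push_closed[OF assms(3) _ assms(4)] assms classes_Obj by blast

text \<open>A morphism is trivial in the heart exactly when it extends along \<open>A \<rightarrow> X\<close>: every morphism from
  \<open>A\<close> to an object of \<open>W\<close> extends to \<open>X\<close>, as \<open>\<E>(C, W) = 0\<close>. So vanishing in the heart is an equation
  between extensions.\<close>

lemma I_iff_push_one:
  assumes t: "E_triangle K A x X y C \<delta>" "X \<in> W" "C \<in> S" and f: "arr K A B f"
  shows "f \<in> I A B \<longleftrightarrow> push K C f \<delta> = \<one>\<^bsub>Ext K C B\<^esub>"
proof
  note d = E_triangleD[OF t(1)]
  assume "f \<in> I A B"
  then obtain Y g h where g: "Y \<in> W" "arr K A Y g" "arr K Y B h" "f = h \<cdot> g"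
    using I_iff f by (auto simp: arr_def)
  have "push K C f \<delta> = push K C h (push K C g \<delta>)" unfolding g(4) using push_Comp[OF g(2,3) d(6,3)] .
  then show "push K C f \<delta> = \<one>\<^bsub>Ext K C B\<^esub>" using push_W_one[OF g(1) t(3) g(2) d(3)] push_one[OF g(3) d(6)] by simp
next
  note d = E_triangleD[OF t(1)]
  assume "push K C f \<delta> = \<one>\<^bsub>Ext K C B\<^esub>"
  then obtain b where "arr K X B b" "b \<cdot> x = f" using extends_iff_push_one[OF t(1) f] by blast
  then show "f \<in> I A B" using I_I[OF t(2) d(1)] by blast
qed

text \<open>The deflation \<open>W0 \<rightarrow> B\<close> has its kernel in \<open>V\<close>, so morphisms from objects of \<open>U\<close> lift along it.\<close>

lemma U_to_plus_I:
  assumes X: "X \<in> U" and B: "B \<in> Bplus" and g: "arr K A X g" and h: "arr K X B h"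
  shows "h \<cdot> g \<in> I A B"
proof -
  obtain V0 W0 x y \<delta> where t: "V0 \<in> V" "W0 \<in> W" "E_triangle K V0 x W0 y B \<delta>" using plusE[OF B] .
  note d = E_triangleD[OF t(3)]
  have "pull K V0 h \<delta> = \<one>\<^bsub>Ext K X V0\<^esub>"
    using cotorsion_pair_Ext[OF UV X t(1)] pull_closed[OF h d(4,3)] by blast
  then obtain b where b: "arr K X W0 b" "y \<cdot> b = h" using lifts_iff_pull_one[OF t(3) h] by blast
  have "y \<cdot> (b \<cdot> g) = h \<cdot> g" using comp_assoc_arr[OF g b(1) d(2)] b(2) by simp
  then show ?thesis using I_I[OF t(2) arr_Comp[OF g b(1)] d(2)] by simp
qed

text \<open>Take a deflation \<open>U1 \<rightarrow> L\<close> with \<open>U1 \<in> U\<close> and kernel in \<open>V\<close>; only \<open>U1 \<in> T\<close> is in question. As in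
  Schanuel's lemma, \<open>U1 \<rightarrow> L \<rightarrow> B\<close> and \<open>W0 \<rightarrow> B\<close> factor through each other, so the identity of \<open>U1\<close>
  is a sum of a morphism through \<open>W0\<close> and one through the kernel of \<open>U1 \<rightarrow> B\<close>, which lies in \<open>V\<close>.
  Hence every extension of an object of \<open>S\<close> by \<open>U1\<close> is trivial.\<close>

lemma plus_of_V_deflation:
  assumes t: "E_triangle K A x L y B \<delta>" and A: "A \<in> V" and B: "B \<in> Bplus"
  shows "L \<in> Bplus"
proof -
  note d = E_triangleD[OF t]
  obtain V1 U1 x1 y1 \<delta>1 where u: "V1 \<in> V" "U1 \<in> U" "E_triangle K V1 x1 U1 y1 L \<delta>1"
    using cotorsion_pair_resolution[OF UV d(5)] .
  obtain V0 W0 x0 y0 \<delta>0 where w: "V0 \<in> V" "W0 \<in> W" "E_triangle K V0 x0 W0 y0 B \<delta>0" using plusE[OF B] .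
  obtain E dd e h \<epsilon> where E: "E_triangle K E h U1 (y \<cdot> y1) B \<epsilon>" "E_triangle K V1 e E dd A (pull K V1 x \<delta>1)"
    using ET4_op[OF t u(3)] by blast
  have EV: "E \<in> V" using cotorsion_pair_right_extension[OF UV E(2) u(1) A] .
  note du = E_triangleD[OF u(3)] and dw = E_triangleD[OF w(3)] and dE = E_triangleD[OF E(1)]
  have WU: "W0 \<in> U" "W0 \<in> T" using w by auto
  have "pull K V0 (y \<cdot> y1) \<delta>0 = \<one>\<^bsub>Ext K U1 V0\<^esub>"
    using cotorsion_pair_Ext[OF UV u(2) w(1)] pull_closed[OF dE(2) dw(4,3)] by blast
  then obtain a where a: "arr K U1 W0 a" "y0 \<cdot> a = y \<cdot> y1" using lifts_iff_pull_one[OF w(3) dE(2)] by blast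
  have "pull K E y0 \<epsilon> = \<one>\<^bsub>Ext K W0 E\<^esub>"
    using cotorsion_pair_Ext[OF UV WU(1) EV] pull_closed[OF dw(2) dE(4,3)] by blast
  then obtain b where b: "arr K W0 U1 b" "(y \<cdot> y1) \<cdot> b = y0" using lifts_iff_pull_one[OF E(1) dw(2)] by blast
  define m where "m = sub_mor K U1 U1 (Ident K U1) (b \<cdot> a)"
  have ba: "arr K U1 U1 (b \<cdot> a)" using arr_Comp[OF a(1) b(1)] .
  have m: "arr K U1 U1 m" unfolding m_def by (rule arr_sub[OF arr_Ident[OF dE(5)] ba])
  have "(y \<cdot> y1) \<cdot> m = sub_mor K U1 B (y \<cdot> y1) (((y \<cdot> y1) \<cdot> b) \<cdot> a)"
    unfolding m_def using a(1) b(1) d(2) du(2) by (simp add: arr_iff cat_simps)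
  then have "(y \<cdot> y1) \<cdot> m = zero_mor K U1 B" unfolding b(2) a(2) using dE(2) by (simp add: add_simps)
  then obtain c where c: "arr K U1 E c" "h \<cdot> c = m" using factors_through_inflation[OF E(1) m] by blast
  have "U1 \<in> T"
  proof (rule cotorsion_pair_rightI[OF ST])
    show "U1 \<in> Obj K" using dE by blast
    fix C \<eta> assume C: "C \<in> S" and \<eta>: "\<eta> \<in> carrier (Ext K C U1)"
    have CO: "C \<in> Obj K" using C classes_Obj by blast
    have "push K C a \<eta> = \<one>\<^bsub>Ext K C W0\<^esub>"
      using cotorsion_pair_Ext[OF ST C WU(2)] push_closed[OF a(1) CO \<eta>] by blast
    then have 1: "push K C (b \<cdot> a) \<eta> = \<one>\<^bsub>Ext K C U1\<^esub>"
      using push_Comp[OF a(1) b(1) CO \<eta>] push_one[OF b(1) CO] by simp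
    have "E \<in> T" using EV V_T by blast
    then have "push K C c \<eta> = \<one>\<^bsub>Ext K C E\<^esub>"
      using cotorsion_pair_Ext[OF ST C] push_closed[OF c(1) CO \<eta>] by blast
    then have 2: "push K C m \<eta> = \<one>\<^bsub>Ext K C U1\<^esub>"
      using push_Comp[OF c(1) dE(1) CO \<eta>] push_one[OF dE(1) CO] c(2) by simp
    have "add_mor K U1 U1 m (b \<cdot> a) = Ident K U1"
      unfolding m_def using ba arr_Ident[OF dE(5)] by (simp add: add_assoc arr_neg add_simps)
    then have sum: "\<eta> = push K C m \<eta> \<otimes>\<^bsub>Ext K C U1\<^esub> push K C (b \<cdot> a) \<eta>"
      using push_add[OF m ba CO \<eta>] push_Ident[OF dE(5) CO \<eta>] by simp
    interpret G: comm_group "Ext K C U1" using Ext_comm_group CO dE by blast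
    show "\<eta> = \<one>\<^bsub>Ext K C U1\<^esub>" using sum unfolding 1 2 by simp
  qed
  then show ?thesis using plusI[OF u(1) _ u(3)] u(2) by blast
qed

text \<open>The composite of \<open>A \<rightarrow> B\<close> with \<open>B \<rightarrow> W0\<close> has a cone that is an extension of two objects of \<open>S\<close>.\<close>

lemma minus_of_S_cone:
  assumes t: "E_triangle K A x B y C \<delta>" and C: "C \<in> S" and B: "B \<in> Bminus"
  shows "A \<in> Bminus"
proof -
  obtain W0 S0 x0 y0 \<delta>0 where w: "W0 \<in> W" "S0 \<in> S" "E_triangle K B x0 W0 y0 S0 \<delta>0" using minusE[OF B] .
  obtain E d e h \<epsilon> where E: "E_triangle K A (x0 \<cdot> x) W0 h E \<epsilon>" "E_triangle K C d E e S0 (push K S0 y \<delta>0)"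
    using ET4[OF t w(3)] by blast
  have "E \<in> S" using cotorsion_pair_left_extension[OF ST E(2) C w(2)] .
  then show ?thesis using minusI w(1) E(1) by blast
qed

lemma minus_of_S_inflation:
  assumes "E_triangle K A x B y C \<delta>" "C \<in> S" "A \<in> Bminus"
  shows "B \<in> Bminus"
  using twin_cotorsion.plus_of_V_deflation[OF twin_cotorsion_eopp, of C y B x A \<delta>] assms by (simp add: Int_commute)

text \<open>The reflection of \<open>M\<close> in \<open>Bplus\<close>. A morphism \<open>n\<close> from \<open>M\<close> to \<open>Z \<in> Bplus\<close> composed with
  \<open>U1 \<rightarrow> M\<close> factors through an object of \<open>W\<close>, so it annihilates the extension of \<open>S1\<close> by \<open>M\<close>,
  which comes from \<open>U1\<close>.\<close>

lemma plus_reflection: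
  assumes M: "M \<in> Obj K"
  obtains m M' s S1 \<theta> where "E_triangle K M m M' s S1 \<theta>" "S1 \<in> S" "M' \<in> Bplus"
    "\<forall>Z n. Z \<in> Bplus \<longrightarrow> arr K M Z n \<longrightarrow> push K S1 n \<theta> = \<one>\<^bsub>Ext K S1 Z\<^esub>"
proof -
  obtain V1 U1 x1 y1 \<delta>1 where u: "V1 \<in> V" "U1 \<in> U" "E_triangle K V1 x1 U1 y1 M \<delta>1"
    using cotorsion_pair_resolution[OF UV M] .
  note du = E_triangleD[OF u(3)]
  obtain T1 S1 x2 y2 \<delta>2 where v: "T1 \<in> T" "S1 \<in> S" "E_triangle K U1 x2 T1 y2 S1 \<delta>2"
    using cotorsion_pair_coresolution[OF ST du(5)] .
  note dv = E_triangleD[OF v(3)]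
  have "T1 \<in> U" using cotorsion_pair_left_extension[OF UV v(3) u(2)] v(2) S_U by blast
  then have T1: "T1 \<in> W" using v by blast
  obtain M' d e h \<epsilon> where E: "E_triangle K V1 (x2 \<cdot> x1) T1 h M' \<epsilon>" "E_triangle K M d M' e S1 (push K S1 y1 \<delta>2)"
    using ET4[OF u(3) v(3)] by blast
  have "M' \<in> Bplus" using plusI[OF u(1) T1 E(1)] .
  moreover have "push K S1 n (push K S1 y1 \<delta>2) = \<one>\<^bsub>Ext K S1 Z\<^esub>" if Z: "Z \<in> Bplus" "arr K M Z n" for Z n
  proof -
    have n: "arr K U1 Z (n \<cdot> y1)" using Z(2) du(2) arr_Comp by blast
    have "(n \<cdot> y1) \<cdot> Ident K U1 \<in> I U1 Z"
      using U_to_plus_I[OF u(2) Z(1) arr_Ident[OF du(5)] n] .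
    then have "n \<cdot> y1 \<in> I U1 Z" using n by (simp add: arr_iff cat_simps)
    then obtain Y g k where g: "Y \<in> W" "arr K U1 Y g" "arr K Y Z k" "n \<cdot> y1 = k \<cdot> g"
      using I_iff n by (auto simp: arr_def)
    have "push K S1 n (push K S1 y1 \<delta>2) = push K S1 (k \<cdot> g) \<delta>2"
      using push_Comp[OF du(2) Z(2) dv(6,3)] g(4) by simp
    also have "\<dots> = push K S1 k (push K S1 g \<delta>2)" using push_Comp[OF g(2,3) dv(6,3)] .
    finally show ?thesis using push_W_one[OF g(1) v(2) g(2) dv(3)] push_one[OF g(3) dv(6)] by simp
  qed
  ultimately show thesis using that E(2) v(2) by blast
qed

text \<open>A factorization of \<open>h \<cdot> g\<close> through \<open>X \<in> W\<close> extends from \<open>B\<close> to \<open>C\<close>. The difference between \<open>h\<close>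
  and the extended morphism kills \<open>g\<close>, hence factors through \<open>S0 \<in> U\<close>, and is trivial as well.\<close>

lemma S_inflation_epi:
  assumes t: "E_triangle K B g C s S0 \<delta>" "S0 \<in> S" and Z: "Z \<in> Bplus" and h: "arr K C Z h" and hg: "h \<cdot> g \<in> I B Z"
  shows "h \<in> I C Z"
proof -
  note d = E_triangleD[OF t(1)]
  have ZO: "Z \<in> Obj K" using h by (simp add: arr_def)
  obtain X u k where u: "X \<in> W" "arr K B X u" "arr K X Z k" "h \<cdot> g = k \<cdot> u"
    using hg I_iff d ZO by auto
  obtain u' where u': "arr K C X u'" "u' \<cdot> g = u"
    using push_W_one[OF u(1) t(2) u(2) d(3)] extends_iff_push_one[OF t(1) u(2)] by blast
  have ku: "arr K C Z (k \<cdot> u')" using arr_Comp[OF u'(1) u(3)] .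
  define m where "m = sub_mor K C Z h (k \<cdot> u')"
  have m: "arr K C Z m" unfolding m_def by (rule arr_sub[OF h ku])
  have "m \<cdot> g = sub_mor K B Z (h \<cdot> g) (k \<cdot> (u' \<cdot> g))"
    unfolding m_def using h ku u(3) u'(1) d(1) by (simp add: arr_iff cat_simps)
  then have "m \<cdot> g = zero_mor K B Z"
    unfolding u'(2) u(4) using u(2,3) by (simp add: arr_iff cat_simps)
  then obtain c where c: "arr K S0 Z c" "c \<cdot> s = m" using factors_through_deflation[OF t(1) m] by blast
  have "m \<in> I C Z" using U_to_plus_I[OF _ Z d(2) c(1)] t(2) S_U c(2) by blast
  moreover have "k \<cdot> u' \<in> I C Z" using I_I[OF u(1) u'(1) u(3)] .
  ultimately have "add_mor K C Z m (k \<cdot> u') \<in> I C Z" using I_add[OF d(5) ZO] by blast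
  then show ?thesis unfolding m_def using h ku by (simp add: add_assoc arr_neg add_simps)
qed

section \<open>Kernels and cokernels in the heart\<close>

text \<open>Whether \<open>h \<cdot> f\<close> is trivial in the heart and whether \<open>h\<close> extends along \<open>g\<close> are both decided by
  the vanishing of an extension pushed out along \<open>h\<close>; the hypothesis says that the two conditions agree.\<close>

lemma cokernel_of_Q_criterion:
  assumes H: "A \<in> H" "B \<in> H" "C \<in> H"
    and tA: "E_triangle K A x X y S0 \<delta>" "X \<in> W" "S0 \<in> S"
    and f: "arr K A B f" and t: "E_triangle K B g C s S1 \<epsilon>" "S1 \<in> S"
    and eq: "\<And>Z h. Z \<in> H \<Longrightarrow> arr K B Z h \<Longrightarrow>
      push K S0 h (push K S0 f \<delta>) = \<one>\<^bsub>Ext K S0 Z\<^esub> \<longleftrightarrow> push K S1 h \<epsilon> = \<one>\<^bsub>Ext K S1 Z\<^esub>"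
  shows "cokernel_of Q A B C (cls A B f) (cls B C g)"
proof (rule cokernel_of_Q_I[OF H f])
  note d = E_triangleD[OF t(1)] and dA = E_triangleD[OF tA(1)]
  have *: "h \<cdot> f \<in> I A Z \<longleftrightarrow> (\<exists>u. arr K C Z u \<and> u \<cdot> g = h)" if Z: "Z \<in> H" "arr K B Z h" for Z h
  proof -
    have "h \<cdot> f \<in> I A Z \<longleftrightarrow> push K S0 (h \<cdot> f) \<delta> = \<one>\<^bsub>Ext K S0 Z\<^esub>"
      using I_iff_push_one[OF tA arr_Comp[OF f Z(2)]] .
    also have "push K S0 (h \<cdot> f) \<delta> = push K S0 h (push K S0 f \<delta>)" using push_Comp[OF f Z(2) dA(6,3)] .
    also have "\<dots> = \<one>\<^bsub>Ext K S0 Z\<^esub> \<longleftrightarrow> push K S1 h \<epsilon> = \<one>\<^bsub>Ext K S1 Z\<^esub>" using eq[OF Z] .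
    also have "\<dots> \<longleftrightarrow> (\<exists>u. arr K C Z u \<and> u \<cdot> g = h)" using extends_iff_push_one[OF t(1) Z(2)] by blast
    finally show ?thesis .
  qed
  show "arr K B C g" by (rule d)
  have "Ident K C \<cdot> g = g" using d(1) by (simp add: arr_iff cat_simps)
  then show "g \<cdot> f \<in> I A C" using *[OF H(3) d(1)] arr_Ident[OF d(5)] by blast
  show "\<exists>u. arr K C Z u \<and> u \<cdot> g = h" if "Z \<in> H" "arr K B Z h" "h \<cdot> f \<in> I A Z" for Z h
    using * that by blast
  show "u \<in> I C Z" if "Z \<in> H" "arr K C Z u" "u \<cdot> g \<in> I B Z" for Z u
    using S_inflation_epi[OF t HD(1)] that by blast
qed

text \<open>The extension \<open>\<delta>\<close> of \<open>S0\<close> by \<open>A\<close>, pushed out along \<open>f\<close>, is realized by some \<open>B \<rightarrow> M \<rightarrow> S0\<close>, and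
  \<open>h : B \<rightarrow> Z\<close> extends to \<open>M\<close> exactly when \<open>h \<cdot> f\<close> is trivial. The reflection \<open>C\<close> of \<open>M\<close> repairs
  that \<open>M\<close> need not belong to \<open>Bplus\<close>. The octahedral axiom shows that the cone of \<open>B \<rightarrow> C\<close>
  is still in \<open>S\<close>: every cokernel in the heart is, up to isomorphism, an inflation with cone in \<open>S\<close>.\<close>

lemma cokernel_of_Q_exists:
  assumes H: "A \<in> H" "B \<in> H" and f: "arr K A B f"
  obtains C g s S1 \<epsilon> where "C \<in> H" "S1 \<in> S" "E_triangle K B g C s S1 \<epsilon>"
    "cokernel_of Q A B C (cls A B f) (cls B C g)"
proof -
  obtain X S0 x y \<delta> where tA: "X \<in> W" "S0 \<in> S" "E_triangle K A x X y S0 \<delta>" using minusE[OF HD(2)[OF H(1)]] .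
  note dA = E_triangleD[OF tA(3)]
  have BO: "B \<in> Obj K" using f by (simp add: arr_def)
  have p: "push K S0 f \<delta> \<in> carrier (Ext K S0 B)" using push_closed[OF f dA(6,3)] .
  obtain M j k where tM: "E_triangle K B j M k S0 (push K S0 f \<delta>)" using realization_exists[OF BO dA(6) p] by blast
  note dM = E_triangleD[OF tM]
  obtain m C s S1 \<theta> where tC: "E_triangle K M m C s S1 \<theta>" "S1 \<in> S" "C \<in> Bplus"
    "\<forall>Z n. Z \<in> Bplus \<longrightarrow> arr K M Z n \<longrightarrow> push K S1 n \<theta> = \<one>\<^bsub>Ext K S1 Z\<^esub>"
    using plus_reflection[OF dM(5)] .
  obtain E d e h' \<epsilon> where E: "E_triangle K B (m \<cdot> j) C h' E \<epsilon>" "E_triangle K S0 d E e S1 (push K S1 k \<theta>)"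
    "pull K B d \<epsilon> = push K S0 f \<delta>"
    using ET4[OF tM tC(1)] by blast
  note dC = E_triangleD[OF tC(1)] and dE = E_triangleD[OF E(1)] and dE2 = E_triangleD[OF E(2)]
  have ES: "E \<in> S" using cotorsion_pair_left_extension[OF ST E(2) tA(2) tC(2)] .
  have CH: "C \<in> H" using HI[OF tC(3) minus_of_S_inflation[OF E(1) ES HD(2)[OF H(2)]]] .
  have "cokernel_of Q A B C (cls A B f) (cls B C (m \<cdot> j))"
  proof (rule cokernel_of_Q_criterion[OF H CH tA(3,1,2) f E(1) ES])
    fix Z h assume Z: "Z \<in> H" "arr K B Z h"
    have ZO: "Z \<in> Obj K" using Z by (simp add: arr_def)
    show "push K S0 h (push K S0 f \<delta>) = \<one>\<^bsub>Ext K S0 Z\<^esub> \<longleftrightarrow> push K E h \<epsilon> = \<one>\<^bsub>Ext K E Z\<^esub>"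
    proof
      assume "push K S0 h (push K S0 f \<delta>) = \<one>\<^bsub>Ext K S0 Z\<^esub>"
      then obtain n where n: "arr K M Z n" "n \<cdot> j = h" using extends_iff_push_one[OF tM Z(2)] by blast
      obtain n' where n': "arr K C Z n'" "n' \<cdot> m = n"
        using tC(4) HD(1)[OF Z(1)] n(1) extends_iff_push_one[OF tC(1) n(1)] by blast
      have "n' \<cdot> (m \<cdot> j) = h" using comp_assoc_arr[OF dM(1) dC(1) n'(1)] n n' by simp
      then show "push K E h \<epsilon> = \<one>\<^bsub>Ext K E Z\<^esub>" using n'(1) extends_iff_push_one[OF E(1) Z(2)] by blast
    next
      assume "push K E h \<epsilon> = \<one>\<^bsub>Ext K E Z\<^esub>"
      then show "push K S0 h (push K S0 f \<delta>) = \<one>\<^bsub>Ext K S0 Z\<^esub>"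
        unfolding E(3)[symmetric] using push_pull[OF Z(2) dE2(1) dE(3)] pull_one[OF dE2(1) ZO] by simp
    qed
  qed
  then show thesis using that[OF CH ES E(1)] by blast
qed

lemma H_eopp: "twin_cotorsion.H (eopp K) V U T S = H"
proof -
  interpret op: twin_cotorsion "eopp K" V U T S by (rule twin_cotorsion_eopp)
  show ?thesis by (simp add: op.H_def H_def Int_commute)
qed

lemma cls_eopp: "quotient_setting.cls (eopp K) W A B f = cls B A f"
proof -
  interpret op: twin_cotorsion "eopp K" V U T S by (rule twin_cotorsion_eopp)
  show ?thesis using op.cls_def[of A B f] by (simp add: cls_def factor_through_eopp Int_commute)
qed

text \<open>Together with the symmetry of twin cotorsion pairs, this makes the class of hearts self-dual.\<close>

lemma heart_eopp: "heart (eopp K) V U T S = opp Q"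
  using twin_cotorsion.heart_eq[OF twin_cotorsion_eopp]
  by (simp add: H_eopp ideal_quotient_eopp Int_commute)

lemma kernel_of_Q_criterion:
  assumes H: "L \<in> H" "C \<in> H" "D \<in> H"
    and tD: "E_triangle K V0 x X y D \<delta>" "X \<in> W" "V0 \<in> V"
    and g: "arr K C D g" and t: "E_triangle K V1 e L m C \<epsilon>" "V1 \<in> V"
    and eq: "\<And>Z h. Z \<in> H \<Longrightarrow> arr K Z C h \<Longrightarrow>
      pull K V0 h (pull K V0 g \<delta>) = \<one>\<^bsub>Ext K Z V0\<^esub> \<longleftrightarrow> pull K V1 h \<epsilon> = \<one>\<^bsub>Ext K Z V1\<^esub>"
  shows "kernel_of Q L C D (cls L C m) (cls C D g)"
proof -
  interpret op: twin_cotorsion "eopp K" V U T S by (rule twin_cotorsion_eopp)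
  have "cokernel_of op.Q D C L (op.cls D C g) (op.cls C L m)"
    by (rule op.cokernel_of_Q_criterion[where x = y and X = X and y = x and ?S0.0 = V0 and \<delta> = \<delta> and s = e
          and ?S1.0 = V1 and \<epsilon> = \<epsilon>])
      (use assms in \<open>simp_all add: H_eopp Int_commute\<close>)
  then show ?thesis
    by (simp add: H_eopp Int_commute cls_eopp ideal_quotient_eopp cokernel_of_opp)
qed

lemma kernel_of_Q_exists:
  assumes H: "B \<in> H" "C \<in> H" and g: "arr K B C g"
  shows "\<exists>A f. kernel_of Q A B C f (cls B C g)"
proof -
  interpret op: twin_cotorsion "eopp K" V U T S by (rule twin_cotorsion_eopp)
  obtain A f where "cokernel_of op.Q C B A (op.cls C B g) (op.cls B A f)"
    using op.cokernel_of_Q_exists[of C B g] assms by (metis H_eopp arr_eopp)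
  then show ?thesis
    by (auto simp: H_eopp Int_commute cls_eopp ideal_quotient_eopp cokernel_of_opp)
qed

lemma preabelian_category_Q: "preabelian_category Q"
proof
  fix B C y assume *: "B \<in> Obj Q" "C \<in> Obj Q" "y \<in> mor Q B C"
  then obtain g where "arr K B C g" "y = cls B C g" using arr_QE[of B C y] by (auto simp: arr_def)
  then show "\<exists>A x. kernel_of Q A B C x y" using kernel_of_Q_exists * by simp
next
  fix A B x assume *: "A \<in> Obj Q" "B \<in> Obj Q" "x \<in> mor Q A B"
  then obtain f where "arr K A B f" "x = cls A B f" using arr_QE[of A B x] by (auto simp: arr_def)
  then show "\<exists>C y. cokernel_of Q A B C x y" using cokernel_of_Q_exists[of A B f] * by (metis Obj_Q)
qed

text \<open>Conversely, every inflation \<open>g\<close> between objects of the heart with cone in \<open>S\<close> is a cokernel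
  there. The octahedral axiom, applied to \<open>W0 \<rightarrow> C \<rightarrow> S0\<close>, produces an object \<open>L\<close> with \<open>L \<rightarrow> W0 \<rightarrow> S0\<close>
  and \<open>V0 \<rightarrow> L \<rightarrow> B\<close>. The first triangle shows \<open>L \<in> Bminus\<close> and computes the cokernel of \<open>m\<close>,
  because \<open>m\<close> pushes its extension to that of \<open>g\<close>; the second shows \<open>L \<in> Bplus\<close> and computes the
  kernel of \<open>g\<close>.\<close>

lemma S_inflation_kernel:
  assumes H: "B \<in> H" "C \<in> H" and t: "E_triangle K B g C s S0 \<delta>" "S0 \<in> S"
    and w: "E_triangle K V0 x W0 q C \<delta>'" "V0 \<in> V" "W0 \<in> W"
  obtains L h m e \<delta>'' where "L \<in> H" "E_triangle K L h W0 (s \<cdot> q) S0 \<delta>''"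
    "E_triangle K V0 e L m B (pull K V0 g \<delta>')" "q \<cdot> h = g \<cdot> m" "push K S0 m \<delta>'' = \<delta>"
    "pull K L s \<delta>'' = push K C e \<delta>'"
    "kernel_of Q L B C (cls L B m) (cls B C g)" "cokernel_of Q L B C (cls L B m) (cls B C g)"
proof -
  obtain L m e h \<delta>'' where E: "E_triangle K L h W0 (s \<cdot> q) S0 \<delta>''" "q \<cdot> h = g \<cdot> m"
    "E_triangle K V0 e L m B (pull K V0 g \<delta>')" "push K S0 m \<delta>'' = \<delta>" "pull K L s \<delta>'' = push K C e \<delta>'"
    using ET4_op[OF t(1) w(1)] by metis
  note d = E_triangleD[OF t(1)] and dm = E_triangleD[OF E(3)]
  have LH: "L \<in> H"
    by (rule HI[OF plus_of_V_deflation[OF E(3) w(2) HD(1)[OF H(1)]] minusI[OF w(3) t(2) E(1)]])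
  have "kernel_of Q L B C (cls L B m) (cls B C g)"
    by (rule kernel_of_Q_criterion[OF LH H w(1,3,2) d(1) E(3) w(2) refl])
  moreover have "cokernel_of Q L B C (cls L B m) (cls B C g)"
    by (rule cokernel_of_Q_criterion[OF LH H E(1) w(3) t(2) dm(2) t]) (simp add: E(4))
  ultimately show thesis using that LH E by blast
qed

text \<open>An object of \<open>W\<close> is zero in the heart, so adding it as a direct summand changes nothing.\<close>

lemma proj_iso_Q:
  assumes B: "B \<in> H" and X: "X \<in> W" and P: "biproduct K B X P i i' p p'"
  shows "arr Q P B (cls P B p)" "arr Q B P (cls B P i)"
    "Comp Q (cls B P i) (cls P B p) = Ident Q P" "Comp Q (cls P B p) (cls B P i) = Ident Q B"
proof -
  note a = biproduct_arr[OF P]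
  have XH: "X \<in> H" using HI W_plus W_minus X by blast
  have PH: "P \<in> H" using D_biproduct[OF B XH P] .
  have eqs: "p \<cdot> i = Ident K B" "add_mor K P P (i \<cdot> p) (i' \<cdot> p') = Ident K P" using P by (auto simp: biproduct_def)
  show "arr Q P B (cls P B p)" "arr Q B P (cls B P i)" using arr_Q_cls B PH a by blast+
  show "Comp Q (cls P B p) (cls B P i) = Ident Q B" using Comp_Q[OF B B a(1,3)] eqs by simp
  have ip: "arr K P P (i \<cdot> p)" and ip': "arr K P P (i' \<cdot> p')" and id: "arr K P P (Ident K P)"
    using arr_Comp[OF a(3,1)] arr_Comp[OF a(4,2)] arr_Ident a(1) by (simp_all add: arr_def)
  have "sub_mor K P P (Ident K P) (i \<cdot> p) = i' \<cdot> p'"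
    unfolding eqs(2)[symmetric] add_commute[OF ip ip'] using ip ip' by (simp add: add_assoc arr_neg add_simps)
  then have "cls P P (Ident K P) = cls P P (i \<cdot> p)"
    using cls_eq_iff[OF id ip] I_I[OF X a(4,2)] by simp
  then show "Comp Q (cls B P i) (cls P B p) = Ident Q P" using Comp_Q[OF PH PH a(3,1)] by simp
qed

text \<open>In the heart \<open>B\<close> may be replaced by \<open>B \<oplus> W0\<close>, from which \<open>[c, q]\<close> is a deflation onto \<open>D\<close>. The
  pullback of \<open>g\<close> along it is the kernel \<open>M\<close> of \<open>B \<oplus> W0 \<rightarrow> D \<rightarrow> S0\<close>: its inflation into \<open>B \<oplus> W0\<close>
  again has cone \<open>S0\<close>, so it is a cokernel in the heart. What needs proof is that \<open>M\<close> lies in \<open>Bplus\<close>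
  and that the square, which is only a weak pullback before passing to the quotient, is a pullback in the
  heart. For the former, \<open>M\<close> is an extension of \<open>B\<close> by \<open>L\<close> induced from \<open>V0 \<rightarrow> L\<close>, hence an extension
  of \<open>B \<oplus> C\<close> by \<open>V0\<close>. For the latter, the ambiguity is a morphism through \<open>L\<close>, the kernel of \<open>g\<close>
  in the heart.\<close>

lemma S_inflation_pullback:
  assumes H: "B \<in> H" "C \<in> H" "D \<in> H" and t: "E_triangle K C g D s S0 \<delta>" "S0 \<in> S" and c: "arr K B D c"
  obtains A a b where "pullback_square Q A B C D a b (cls B D c) (cls C D g)" "is_cokernel Q A B a"
proof -
  note dt = E_triangleD[OF t(1)]
  obtain V0 W0 x q \<delta>' where w: "V0 \<in> V" "W0 \<in> W" "E_triangle K V0 x W0 q D \<delta>'" using plusE[OF HD(1)[OF H(3)]] .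
  note dw = E_triangleD[OF w(3)]
  obtain L h m e \<delta>'' where L: "L \<in> H" "E_triangle K L h W0 (s \<cdot> q) S0 \<delta>''"
    "E_triangle K V0 e L m C (pull K V0 g \<delta>')" "q \<cdot> h = g \<cdot> m" "push K S0 m \<delta>'' = \<delta>"
    "pull K L s \<delta>'' = push K D e \<delta>'"
    "kernel_of Q L C D (cls L C m) (cls C D g)"
    using S_inflation_kernel[OF H(2,3) t w(3,1,2)] by metis
  note dL = E_triangleD[OF L(2)] and dm = E_triangleD[OF L(3)]
  have BO: "B \<in> Obj K" using c by (simp add: arr_def)
  obtain P i i' p p' where P: "biproduct K B W0 P i i' p p'" using biproduct_exists[OF BO dw(5)] by metis
  note a = biproduct_arr[OF P]
  have W0H: "W0 \<in> H" using HI W_plus W_minus w(2) by blast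
  have PH: "P \<in> H" using D_biproduct[OF H(1) W0H P] .
  have Peq: "p \<cdot> i = Ident K B" "p' \<cdot> i' = Ident K W0" "p \<cdot> i' = zero_mor K W0 B" "p' \<cdot> i = zero_mor K B W0"
    using P by (auto simp: biproduct_def)
  have sc: "arr K B S0 (s \<cdot> c)" using arr_Comp[OF c dt(2)] .
  define n where "n = neg_mor K B D c"
  have n: "arr K B D n" unfolding n_def using arr_neg[OF c] .
  have sn: "neg_mor K B S0 (s \<cdot> c) = s \<cdot> n" unfolding n_def using c dt(2) by (simp add: arr_iff cat_simps)
  define y where "y = add_mor K P S0 ((s \<cdot> c) \<cdot> p) ((s \<cdot> q) \<cdot> p')"
  obtain M z k \<epsilon> where M: "E_triangle K M z P y S0 \<epsilon>"
    "E_triangle K L k M (p \<cdot> z) B (pull K L (s \<cdot> n) \<delta>'')" "z \<cdot> k = i' \<cdot> h" "push K S0 k \<delta>'' = \<epsilon>"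
    using deflation_from_biproduct[OF L(2) sc P] unfolding sn y_def by blast
  note dM = E_triangleD[OF M(1)] and dk = E_triangleD[OF M(2)]
  define \<beta> where "\<beta> = p \<cdot> z"
  have \<beta>: "arr K M B \<beta>" unfolding \<beta>_def by (rule dk)
  have \<beta>k: "\<beta> \<cdot> k = zero_mor K L B" using E_triangle_Comp_zero[OF M(2)] by (simp add: \<beta>_def)
  \<comment> \<open>The extension of \<open>B\<close> by \<open>L\<close> that \<open>M\<close> realizes comes from \<open>V0\<close>.\<close>
  have from_V0: "pull K L (s \<cdot> n) \<delta>'' = push K B e (pull K V0 n \<delta>')"
    using pull_Comp[OF dt(2) n dL(4,3)] L(6) push_pull[OF dm(1) n dw(3)] by simp
  have \<delta>n: "pull K V0 n \<delta>' \<in> carrier (Ext K B V0)" using pull_closed[OF n dw(4,3)] .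
  have MH: "M \<in> H"
  proof (rule HI)
    obtain E d' e' h' \<eta> where E: "E_triangle K V0 (k \<cdot> e) M h' E \<eta>"
      "E_triangle K C d' E e' B (push K B m (pull K L (s \<cdot> n) \<delta>''))"
      using ET4[OF L(3) M(2)] by blast
    have "push K B m (pull K L (s \<cdot> n) \<delta>'') = push K B (m \<cdot> e) (pull K V0 n \<delta>')"
      unfolding from_V0 using push_Comp[OF dm(1,2) BO \<delta>n] by simp
    also have "\<dots> = \<one>\<^bsub>Ext K B C\<^esub>"
      unfolding E_triangle_Comp_zero[OF L(3)] using push_zero[OF dm(6,4) BO \<delta>n] .
    finally obtain u r where "biproduct K C B E d' u r e'" using split_triangle_biproduct E(2) by metis
    then have "E \<in> Bplus" using plus_biproduct[OF HD(1)[OF H(2)] HD(1)[OF H(1)]] by blast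
    then show "M \<in> Bplus" using plus_of_V_deflation[OF E(1) w(1)] by blast
    show "M \<in> Bminus" using minus_of_S_cone[OF M(1) t(2) HD(2)[OF PH]] .
  qed
  define \<gamma> where "\<gamma> = add_mor K P D (c \<cdot> p) (q \<cdot> p')"
  have \<gamma>: "arr K P D \<gamma>" unfolding \<gamma>_def by (rule arr_add[OF arr_Comp[OF a(3) c] arr_Comp[OF a(4) dw(2)]])
  have "Ident K S0 \<cdot> y = s \<cdot> \<gamma>"
    unfolding y_def \<gamma>_def using a c dt(2) dw(2) by (simp add: arr_iff cat_simps)
  then obtain f where f: "arr K M C f" "\<gamma> \<cdot> z = g \<cdot> f" "push K S0 f \<epsilon> = pull K C (Ident K S0) \<delta>"
    using ET3_op[OF M(1) t(1), of \<gamma> "Ident K S0"] \<gamma> arr_Ident[OF dt(6)] dM(4) dt(4) by (auto simp: arr_def)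
  have f\<epsilon>: "push K S0 f \<epsilon> = \<delta>" unfolding f(3) using pull_Ident[OF dt(4,6,3)] .
  have \<gamma>z: "\<gamma> \<cdot> z = add_mor K M D (c \<cdot> \<beta>) (q \<cdot> (p' \<cdot> z))"
    unfolding \<gamma>_def \<beta>_def using a c dw(2) dM(1) by (simp add: arr_iff cat_simps)
  \<comment> \<open>In the heart, \<open>f\<close> restricts to \<open>m\<close> along \<open>k\<close>: both push the extension of \<open>S0\<close> by \<open>L\<close> to \<open>\<delta>\<close>.\<close>
  have fk: "arr K L C (f \<cdot> k)" using arr_Comp[OF dk(1) f(1)] .
  have "push K S0 (f \<cdot> k) \<delta>'' = push K S0 m \<delta>''"
    using push_Comp[OF dk(1) f(1) dL(6,3)] M(4) f\<epsilon> L(5) by simp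
  then have "push K S0 (sub_mor K L C (f \<cdot> k) m) \<delta>'' = \<one>\<^bsub>Ext K S0 C\<^esub>"
    using push_sub_eq_one[OF fk dm(2) dL(6,3)] by blast
  then have "sub_mor K L C (f \<cdot> k) m \<in> I L C"
    using I_iff_push_one[OF L(2) w(2) t(2) arr_sub[OF fk dm(2)]] by blast
  then have fkm: "cls L C (f \<cdot> k) = cls L C m" using cls_eq_iff[OF fk dm(2)] by blast
  have "pullback_square Q M B C D (cls M B \<beta>) (cls M C f) (cls B D c) (cls C D g)"
  proof (rule Q.pullback_squareI)
    show "arr Q M B (cls M B \<beta>)" "arr Q M C (cls M C f)" "arr Q B D (cls B D c)" "arr Q C D (cls C D g)"
      using arr_Q_cls MH H \<beta> f(1) c dt(1) by blast+
    have qz: "arr K M D (q \<cdot> (p' \<cdot> z))" and cb: "arr K M D (c \<cdot> \<beta>)"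
      using arr_Comp[OF arr_Comp[OF dM(1) a(4)] dw(2)] arr_Comp[OF \<beta> c] by blast+
    have gf: "arr K M D (g \<cdot> f)" using arr_Comp[OF f(1) dt(1)] .
    have "sub_mor K M D (g \<cdot> f) (c \<cdot> \<beta>) = q \<cdot> (p' \<cdot> z)"
      unfolding f(2)[symmetric] \<gamma>z add_commute[OF cb qz] using cb qz by (simp add: add_assoc arr_neg add_simps)
    then have "cls M D (g \<cdot> f) = cls M D (c \<cdot> \<beta>)"
      using cls_eq_iff[OF gf cb] I_I[OF w(2) arr_Comp[OF dM(1) a(4)] dw(2)] by simp
    then show "Comp Q (cls B D c) (cls M B \<beta>) = Comp Q (cls C D g) (cls M C f)"
      using Comp_Q[OF MH H(3) \<beta> c] Comp_Q[OF MH H(3) f(1) dt(1)] by simp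
  next
    fix Z X Y assume X: "arr Q Z B X" and Y: "arr Q Z C Y" and XY: "Comp Q (cls B D c) X = Comp Q (cls C D g) Y"
    obtain u where u: "Z \<in> H" "arr K Z B u" "X = cls Z B u" using X by (elim arr_QE)
    obtain v where v: "arr K Z C v" "Y = cls Z C v" using Y by (elim arr_QE)
    have ZO: "Z \<in> Obj K" using u(2) by (simp add: arr_def)
    have cu: "arr K Z D (c \<cdot> u)" and gv: "arr K Z D (g \<cdot> v)" using arr_Comp[OF u(2) c] arr_Comp[OF v(1) dt(1)] .
    have "cls Z D (c \<cdot> u) = cls Z D (g \<cdot> v)"
      using XY Comp_Q[OF u(1) H(3) u(2) c] Comp_Q[OF u(1) H(3) v(1) dt(1)] u(3) v(2) by simp
    then have "sub_mor K Z D (c \<cdot> u) (g \<cdot> v) \<in> I Z D" using cls_eq_iff[OF cu gv] by blast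
    then obtain W1 j l where j: "W1 \<in> W" "arr K Z W1 j" "arr K W1 D l" "sub_mor K Z D (c \<cdot> u) (g \<cdot> v) = l \<cdot> j"
      using I_iff[OF ZO dt(5)] by blast
    have "pull K V0 l \<delta>' = \<one>\<^bsub>Ext K W1 V0\<^esub>"
      using cotorsion_pair_Ext[OF UV _ w(1)] j(1) pull_closed[OF j(3) dw(4,3)] by blast
    then obtain l' where l': "arr K W1 W0 l'" "q \<cdot> l' = l" using lifts_iff_pull_one[OF w(3) j(3)] by blast
    define r where "r = l' \<cdot> j"
    have r: "arr K Z W0 r" unfolding r_def using arr_Comp[OF j(2) l'(1)] .
    have qr: "q \<cdot> r = sub_mor K Z D (c \<cdot> u) (g \<cdot> v)"
      unfolding r_def j(4) l'(2)[symmetric] using comp_assoc_arr[OF j(2) l'(1) dw(2)] by simp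
    have cu_qr: "sub_mor K Z D (c \<cdot> u) (q \<cdot> r) = g \<cdot> v"
      unfolding qr using cu gv by (simp add: neg_add arr_neg add_simps add_neg_cancel)
    define o' where "o' = sub_mor K Z P (i \<cdot> u) (i' \<cdot> r)"
    have o': "arr K Z P o'" unfolding o'_def by (rule arr_sub[OF arr_Comp[OF u(2) a(1)] arr_Comp[OF r a(2)]])
    have po: "p \<cdot> o' = u"
    proof -
      have "p \<cdot> o' = sub_mor K Z B ((p \<cdot> i) \<cdot> u) ((p \<cdot> i') \<cdot> r)"
        unfolding o'_def using a u(2) r by (simp add: arr_iff cat_simps)
      then show ?thesis unfolding Peq using u(2) r by (simp add: arr_iff cat_simps)
    qed
    have p'o: "p' \<cdot> o' = neg_mor K Z W0 r"
    proof -
      have "p' \<cdot> o' = sub_mor K Z W0 ((p' \<cdot> i) \<cdot> u) ((p' \<cdot> i') \<cdot> r)"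
        unfolding o'_def using a u(2) r by (simp add: arr_iff cat_simps)
      then show ?thesis unfolding Peq using u(2) r by (simp add: arr_iff cat_simps)
    qed
    have \<gamma>o: "\<gamma> \<cdot> o' = g \<cdot> v"
    proof -
      have "\<gamma> \<cdot> o' = add_mor K Z D (c \<cdot> (p \<cdot> o')) (q \<cdot> (p' \<cdot> o'))"
        unfolding \<gamma>_def using a c dw(2) o' by (simp add: arr_iff cat_simps)
      also have "\<dots> = sub_mor K Z D (c \<cdot> u) (q \<cdot> r)"
        unfolding po p'o using dw(2) r by (simp add: arr_iff cat_simps)
      finally show ?thesis using cu_qr by simp
    qed
    have "y = s \<cdot> \<gamma>" unfolding y_def \<gamma>_def using a c dt(2) dw(2) by (simp add: arr_iff cat_simps)
    then have "y \<cdot> o' = s \<cdot> (g \<cdot> v)" using comp_assoc_arr[OF o' \<gamma> dt(2)] \<gamma>o by simp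
    also have "\<dots> = (s \<cdot> g) \<cdot> v" using comp_assoc_arr[OF v(1) dt(1,2)] by simp
    also have "\<dots> = zero_mor K Z S0"
      unfolding E_triangle_Comp_zero[OF t(1)] using v(1) dt(6) by (simp add: arr_iff cat_simps)
    finally obtain \<zeta> where \<zeta>: "arr K Z M \<zeta>" "z \<cdot> \<zeta> = o'" using factors_through_inflation[OF M(1) o'] by blast
    have \<beta>\<zeta>: "\<beta> \<cdot> \<zeta> = u" unfolding \<beta>_def using comp_assoc_arr[OF \<zeta>(1) dM(1) a(3)] \<zeta>(2) po by simp
    have f\<zeta>: "arr K Z C (f \<cdot> \<zeta>)" using arr_Comp[OF \<zeta>(1) f(1)] .
    have gf\<zeta>: "g \<cdot> (f \<cdot> \<zeta>) = g \<cdot> v"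
      using comp_assoc_arr[OF \<zeta>(1) f(1) dt(1)] comp_assoc_arr[OF \<zeta>(1) dM(1) \<gamma>] f(2) \<zeta>(2) \<gamma>o by simp
    \<comment> \<open>\<open>f \<cdot> \<zeta>\<close> and \<open>v\<close> may differ by a morphism into the kernel \<open>L\<close> of \<open>g\<close>; correct \<open>\<zeta>\<close> by it.\<close>
    have diff: "arr K Z C (sub_mor K Z C (f \<cdot> \<zeta>) v)" using arr_sub[OF f\<zeta> v(1)] .
    have "g \<cdot> sub_mor K Z C (f \<cdot> \<zeta>) v = zero_mor K Z D"
      using gf\<zeta> dt(1) f\<zeta> v(1) gv by (simp add: arr_iff cat_simps)
    then have "Comp Q (cls C D g) (cls Z C (sub_mor K Z C (f \<cdot> \<zeta>) v)) = zero_mor Q Z D"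
      using Comp_Q[OF u(1) H(3) diff dt(1)] zero_Q[OF u(1) H(3)] by simp
    then obtain \<Lambda> where \<Lambda>: "arr Q Z L \<Lambda>" "Comp Q (cls L C m) \<Lambda> = cls Z C (sub_mor K Z C (f \<cdot> \<zeta>) v)"
      using Q.kernel_of_lift[OF L(7) arr_Q_cls[OF u(1) H(2) diff]] by blast
    obtain l0 where l0: "arr K Z L l0" "\<Lambda> = cls Z L l0" using \<Lambda>(1) by (elim arr_QE)
    have kl: "arr K Z M (k \<cdot> l0)" using arr_Comp[OF l0(1) dk(1)] .
    define \<omega> where "\<omega> = sub_mor K Z M \<zeta> (k \<cdot> l0)"
    have \<omega>: "arr K Z M \<omega>" unfolding \<omega>_def using arr_sub[OF \<zeta>(1) kl] .
    have "\<beta> \<cdot> \<omega> = sub_mor K Z B (\<beta> \<cdot> \<zeta>) ((\<beta> \<cdot> k) \<cdot> l0)"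
      unfolding \<omega>_def using \<beta> \<zeta>(1) dk(1) l0(1) by (simp add: arr_iff cat_simps)
    then have 1: "\<beta> \<cdot> \<omega> = u" unfolding \<beta>k \<beta>\<zeta> using u(2) l0(1) BO by (simp add: arr_iff cat_simps)
    have 2: "cls Z C (f \<cdot> \<omega>) = cls Z C v"
    proof -
      have "f \<cdot> \<omega> = sub_mor K Z C (f \<cdot> \<zeta>) ((f \<cdot> k) \<cdot> l0)"
        unfolding \<omega>_def using f(1) \<zeta>(1) dk(1) l0(1) by (simp add: arr_iff cat_simps)
      then have "cls Z C (f \<cdot> \<omega>) = sub_mor Q Z C (cls Z C (f \<cdot> \<zeta>)) (cls Z C ((f \<cdot> k) \<cdot> l0))"
        using sub_Q[OF u(1) H(2) f\<zeta> arr_Comp[OF l0(1) fk]] by simp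
      also have "cls Z C ((f \<cdot> k) \<cdot> l0) = cls Z C (sub_mor K Z C (f \<cdot> \<zeta>) v)"
        using Comp_Q[OF u(1) H(2) l0(1) fk] fkm \<Lambda>(2) l0(2) by simp
      also have "sub_mor Q Z C (cls Z C (f \<cdot> \<zeta>)) (cls Z C (sub_mor K Z C (f \<cdot> \<zeta>) v))
          = cls Z C (sub_mor K Z C (f \<cdot> \<zeta>) (sub_mor K Z C (f \<cdot> \<zeta>) v))"
        using sub_Q[OF u(1) H(2) f\<zeta> diff] .
      also have "sub_mor K Z C (f \<cdot> \<zeta>) (sub_mor K Z C (f \<cdot> \<zeta>) v) = v"
        using f\<zeta> v(1) by (simp add: neg_add arr_neg add_simps add_neg_cancel)
      finally show ?thesis .
    qed
    show "\<exists>\<Omega>. arr Q Z M \<Omega> \<and> Comp Q (cls M B \<beta>) \<Omega> = X \<and> Comp Q (cls M C f) \<Omega> = Y"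
      using arr_Q_cls[OF u(1) MH \<omega>] Comp_Q[OF u(1) H(1) \<omega> \<beta>] Comp_Q[OF u(1) H(2) \<omega> f(1)] 1 2 u(3) v(2)
      by (intro exI[of _ "cls Z M \<omega>"]) simp
  next
    fix Z \<Omega> assume \<Omega>: "arr Q Z M \<Omega>" "Comp Q (cls M B \<beta>) \<Omega> = zero_mor Q Z B" "Comp Q (cls M C f) \<Omega> = zero_mor Q Z C"
    obtain \<omega> where \<omega>: "Z \<in> H" "arr K Z M \<omega>" "\<Omega> = cls Z M \<omega>" using \<Omega>(1) by (elim arr_QE)
    have ZO: "Z \<in> Obj K" using \<omega>(2) by (simp add: arr_def)
    have "\<beta> \<cdot> \<omega> \<in> I Z B"
      using \<Omega>(2) \<omega>(3) Comp_Q[OF \<omega>(1) H(1) \<omega>(2) \<beta>] cls_zero_iff[OF \<omega>(1) H(1) arr_Comp[OF \<omega>(2) \<beta>]] by simp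
    then obtain W1 j l where j: "W1 \<in> W" "arr K Z W1 j" "arr K W1 B l" "\<beta> \<cdot> \<omega> = l \<cdot> j"
      using I_iff[OF ZO BO] by blast
    \<comment> \<open>\<open>l\<close> lifts to \<open>M\<close> because the obstruction comes from \<open>\<E>(W1, V0) = 0\<close>.\<close>
    have "pull K V0 l (pull K V0 n \<delta>') = \<one>\<^bsub>Ext K W1 V0\<^esub>"
      using cotorsion_pair_Ext[OF UV _ w(1)] j(1) pull_closed[OF j(3) dw(4) \<delta>n] by blast
    then have "pull K L l (pull K L (s \<cdot> n) \<delta>'') = \<one>\<^bsub>Ext K W1 L\<^esub>"
      unfolding from_V0 using push_pull[OF dm(1) j(3) \<delta>n] push_one[OF dm(1)] j(3) by (simp add: arr_def)
    then obtain l' where l': "arr K W1 M l'" "\<beta> \<cdot> l' = l"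
      using lifts_iff_pull_one[OF M(2) j(3)] unfolding \<beta>_def by blast
    have lj: "arr K Z M (l' \<cdot> j)" using arr_Comp[OF j(2) l'(1)] .
    have diff: "arr K Z M (sub_mor K Z M \<omega> (l' \<cdot> j))" using arr_sub[OF \<omega>(2) lj] .
    have "\<beta> \<cdot> sub_mor K Z M \<omega> (l' \<cdot> j) = sub_mor K Z B (\<beta> \<cdot> \<omega>) ((\<beta> \<cdot> l') \<cdot> j)"
      using \<beta> \<omega>(2) l'(1) j(2) by (simp add: arr_iff cat_simps)
    then have "\<beta> \<cdot> sub_mor K Z M \<omega> (l' \<cdot> j) = zero_mor K Z B"
      unfolding l'(2) j(4) using j(2,3) by (simp add: arr_iff cat_simps)
    then obtain l0 where l0: "arr K Z L l0" "k \<cdot> l0 = sub_mor K Z M \<omega> (l' \<cdot> j)"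
      using factors_through_inflation[OF M(2) diff] unfolding \<beta>_def by blast
    have "l' \<cdot> j \<in> I Z M" using I_I[OF j(1,2) l'(1)] .
    then have "cls Z M (k \<cdot> l0) = \<Omega>"
      unfolding l0(2) \<omega>(3) using cls_eq_iff[OF diff \<omega>(2)] \<omega>(2) lj I_neg[OF ZO dM(4)]
      by (simp add: add_commute[of Z M \<omega>] add_assoc arr_neg add_simps)
    then have \<Omega>kl: "\<Omega> = Comp Q (cls L M k) (cls Z L l0)" using Comp_Q[OF \<omega>(1) MH l0(1) dk(1)] by simp
    have "zero_mor Q Z C = Comp Q (Comp Q (cls M C f) (cls L M k)) (cls Z L l0)"
      using \<Omega>(3) Q.comp_assoc_arr[OF arr_Q_cls[OF \<omega>(1) L(1) l0(1)] arr_Q_cls[OF L(1) MH dk(1)] arr_Q_cls[OF MH H(2) f(1)]]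
      unfolding \<Omega>kl by simp
    also have "Comp Q (cls M C f) (cls L M k) = cls L C m" using Comp_Q[OF L(1) H(2) dk(1) f(1)] fkm by simp
    finally have "Comp Q (cls L C m) (cls Z L l0) = Comp Q (cls L C m) (zero_mor Q Z L)"
      using Q.Comp_zero_right[of "cls L C m" L Z] arr_Q_cls[OF L(1) H(2) dm(2)] \<omega>(1) by (simp add: Q.arr_iff)
    then have "cls Z L l0 = zero_mor Q Z L"
      using Q.kernel_of_mono[OF L(7) arr_Q_cls[OF \<omega>(1) L(1) l0(1)] Q.arr_zero] \<omega>(1) L(1) by simp
    then show "\<Omega> = zero_mor Q Z M"
      unfolding \<Omega>kl using Q.Comp_zero_right[of "cls L M k" L Z] arr_Q_cls[OF L(1) MH dk(1)] \<omega>(1) by (simp add: Q.arr_iff)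
  qed
  moreover have "is_cokernel Q M B (cls M B \<beta>)"
  proof -
    obtain V2 W2 x2 q2 \<delta>2 where w2: "V2 \<in> V" "W2 \<in> W" "E_triangle K V2 x2 W2 q2 P \<delta>2" using plusE[OF HD(1)[OF PH]] .
    obtain N m2 where "cokernel_of Q N M P (cls N M m2) (cls M P z)"
      using S_inflation_kernel[OF MH PH M(1) t(2) w2(3,1,2)] by metis
    from Q.cokernel_of_Comp_iso[OF this proj_iso_Q[OF H(1) w(2) P]]
    have "cokernel_of Q N M B (cls N M m2) (Comp Q (cls P B p) (cls M P z))" .
    moreover have "Comp Q (cls P B p) (cls M P z) = cls M B \<beta>"
      using Comp_Q[OF MH H(1) dM(1) a(3)] by (simp add: \<beta>_def)
    ultimately show ?thesis unfolding is_cokernel_def by metis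
  qed
  ultimately show thesis using that by blast
qed

text \<open>The cokernel \<open>d\<close> is isomorphic to an inflation with cone in \<open>S\<close>. Along such an inflation a
  pullback with the required property exists, and pullbacks are unique up to isomorphism.\<close>

theorem left_quasi_abelian_category_Q: "left_quasi_abelian_category Q"
proof -
  interpret QQ: preabelian_category Q by (rule preabelian_category_Q)
  show ?thesis
  proof
    fix A B C D a b c d
    assume pb: "pullback_square Q A B C D a b c d" and d: "is_cokernel Q C D d"
    note pa = Q.pullback_square_arr[OF pb]
    obtain X x where x: "cokernel_of Q X C D x d" using d by (auto simp: is_cokernel_def)
    obtain f where f: "X \<in> H" "C \<in> H" "arr K X C f" "x = cls X C f"
      using Q.cokernel_of_arr(1)[OF x] by (elim arr_QE)
    obtain D' g s S1 \<epsilon> where D': "D' \<in> H" "S1 \<in> S" "E_triangle K C g D' s S1 \<epsilon>"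
      "cokernel_of Q X C D' x (cls C D' g)"
      using cokernel_of_Q_exists[OF f(1,2,3)] f(4) by metis
    obtain \<phi> \<psi> where \<phi>: "arr Q D D' \<phi>" "arr Q D' D \<psi>" "Comp Q \<psi> \<phi> = Ident Q D" "Comp Q \<phi> d = cls C D' g"
      using Q.cokernel_of_unique[OF x D'(4)] by metis
    have pb': "pullback_square Q A B C D' a b (Comp Q \<phi> c) (cls C D' g)"
      using Q.pullback_square_iso_corner[OF pb \<phi>(1-3)] \<phi>(4) by simp
    obtain c0 where c0: "B \<in> H" "arr K B D' c0" "Comp Q \<phi> c = cls B D' c0"
      using Q.arr_Comp[OF pa(3) \<phi>(1)] by (elim arr_QE)
    obtain A' a' b' where "pullback_square Q A' B C D' a' b' (cls B D' c0) (cls C D' g)" "is_cokernel Q A' B a'"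
      using S_inflation_pullback[OF c0(1) f(2) D'(1,3,2) c0(2)] .
    then show "is_cokernel Q A B a" using Q.is_cokernel_via_pullback pb' c0(3) by metis
  qed
qed

theorem quasi_abelian_category_heart: "quasi_abelian_category (heart K S T U V)"
proof -
  have "left_quasi_abelian_category (heart (eopp K) V U T S)"
    using twin_cotorsion.left_quasi_abelian_category_Q[OF twin_cotorsion_eopp]
    by (simp add: twin_cotorsion.heart_eq[OF twin_cotorsion_eopp])
  then have "right_quasi_abelian_category (opp (opp Q))"
    unfolding heart_eopp by (rule left_quasi_abelian_category.right_quasi_abelian_category_opp)
  moreover have "opp (opp Q) = Q" by (simp add: opp_def)
  ultimately show ?thesis
    using left_quasi_abelian_category_Q by (simp add: heart_eq quasi_abelian_category_def)
qed

end

theorem theorem1p2: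
  fixes \<B> :: "('o, 'm, 'e) ext_cat"
    and \<S> \<T> \<U> \<V> :: "'o set"
  assumes "extriangulated_category \<B>"
    and "twin_cotorsion_pair \<B> \<S> \<T> \<U> \<V>"
  shows "(\<exists>X. exact_structure (heart \<B> \<S> \<T> \<U> \<V>) X \<and>
              (\<forall>Y. exact_structure (heart \<B> \<S> \<T> \<U> \<V>) Y \<longrightarrow> Y \<subseteq> X) \<and>
              (\<forall>x y. kernel_cokernel_pair (heart \<B> \<S> \<T> \<U> \<V>) x y \<longrightarrow> (x, y) \<in> X)) \<and>
         quasi_abelian_category (heart \<B> \<S> \<T> \<U> \<V>)"
proof -
  interpret twin_cotorsion \<B> \<S> \<T> \<U> \<V>
    using assms by (simp add: twin_cotorsion_def twin_cotorsion_axioms_def)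
  interpret heart: quasi_abelian_category "heart \<B> \<S> \<T> \<U> \<V>" by (rule quasi_abelian_category_heart)
  let ?X = "{(x, y). kernel_cokernel_pair (heart \<B> \<S> \<T> \<U> \<V>) x y}"
  have "Y \<subseteq> ?X" if "exact_structure (heart \<B> \<S> \<T> \<U> \<V>) Y" for Y
    using exact_structure.exact_kernel_cokernel[OF that] by auto
  then show ?thesis
    using heart.exact_structure_kernel_cokernel_pairs heart.quasi_abelian_category_axioms
    by (intro conjI exI[of _ ?X]) auto
qed

end
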